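(* Let $(\theta_n)_{n=1}^{\infty}$ be a regular sequence with $\lim_{n}\theta_n^{1/n}=1$, and let $X=T[(\mathcal F_n,\theta_n)_{n=1}^{\infty}]$. Then for every $\varepsilon>0$, every infinite dimensional block subspace $Y$ of $X$ contains, for every $n\in\mathbb N$, a sequence of disjointly supported vectors $(y_i)_{i=1}^n$ which is $(1+\varepsilon)$-equivalent to the canonical basis of $\ell_\infty^n$.
   Context: $\mathbb N=\{1,2,\dots\}$; $c_{00}$ is the space of finitely supported real sequences with standard basis $(e_i)$; for $x=\sum a_ie_i$ and $E\subset\mathbb N$, $Ex=\sum_{i\in E}a_ie_i$. For finite $E,F\subset\mathbb N$, $E<F$ means $\max E<\min F$ or one of them is empty; $n\le E$ means $n\le\min E$. Schreier families: $\mathcal F_0=\{\emptyset\}\cup\{\{n\}:n\in\mathbb N\}$ and $\mathcal F_{n+1}=\{\emptyset\}\cup\{\bigcup_{i=1}^kA_i: k\in\mathbb N,\ A_i\in\mathcal F_n,\ k\le A_1<A_2<\dots<A_k\}$. A finite sequence $(E_i)_{i=1}^d$ of subsets of $\mathbb N$ is $\mathcal M$-admissible if $E_1<\dots<E_d$ and $\{\min E_1,\dots,\min E_d\}\in\mathcal M$. The mixed Tsirelson space $T[(\mathcal M_k,\theta_k)_{k=1}^\infty]$ is the completion of $c_{00}$ under the norm defined implicitly by $$\|x\|=\max\Big\{\|x\|_\infty,\ \sup_k\theta_k\sup\Big\{\sum_{i=1}^d\|E_ix\|: d\in\mathbb N,\ (E_i)_{i=1}^d\text{ is }\mathcal M_k\text{-admissible}\Big\}\Big\}.$$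 A sequence $(\theta_n)_{n\ge1}$ is regular if $\theta_n\in(0,1)$ for all $n$, $\theta_n\downarrow0$, and $\theta_{n+m}\ge\theta_n\theta_m$ for all $n,m$. A block subspace is the closed linear span of a block sequence (nonzero vectors of $c_{00}$ with successive supports). $(y_i)_{i=1}^n$ is $C$-equivalent to the canonical basis of $\ell_\infty^n$ if there are $a,b>0$ with $b/a\le C$ and $a\max|\lambda_i|\le\|\sum\lambda_iy_i\|\le b\max|\lambda_i|$ for all scalars $\lambda_i$. *)

theory Defs
  imports "HOL-Analysis.Analysis" "HOL-Probability.Discrete_Topology"
begin

section \<open>Finitely supported sequences\<close>

text \<open>Sequences are indexed by the positive integers. They are rendered as functions on
  \<open>nat\<close> that vanish at \<open>0\<close>, and sets of indices as subsets of \<open>{1..}\<close>.\<close>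

definition supp :: "(nat \<Rightarrow> real) \<Rightarrow> nat set" where
  "supp x = {i. x i \<noteq> 0}"

definition c00 :: "(nat \<Rightarrow> real) set" where
  "c00 = {x. finite (supp x) \<and> x 0 = 0}"

definition unit_vec :: "nat \<Rightarrow> nat \<Rightarrow> real" where
  "unit_vec i = (\<lambda>j. if j = i then 1 else 0)"

definition restr :: "nat set \<Rightarrow> (nat \<Rightarrow> real) \<Rightarrow> nat \<Rightarrow> real" where
  "restr E x = (\<lambda>i. if i \<in> E then x i else 0)"

definition block_less :: "nat set \<Rightarrow> nat set \<Rightarrow> bool" where
  "block_less E F \<longleftrightarrow> E = {} \<or> F = {} \<or> Max E < Min F"

section \<open>Schreier families and admissible sequences\<close>

text \<open>The sets \<open>A\<^sub>1, \<dots>, A\<^sub>k\<close> are the entries of the list \<open>A\<close>. They are taken nonempty, so that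
  the order is a genuine one and the condition \<open>k \<le> A\<^sub>1\<close> bounds every element of the union.\<close>

fun schreier :: "nat \<Rightarrow> nat set set" where
  "schreier 0 = {{}} \<union> {{n} | n. 1 \<le> n}"
| "schreier (Suc n) = {{}} \<union> {\<Union>(set A) | A. A \<noteq> [] \<and> set A \<subseteq> schreier n \<and> {} \<notin> set A \<and>
      sorted_wrt block_less A \<and> length A \<le> Min (hd A)}"

definition admissible :: "nat set set \<Rightarrow> nat set list \<Rightarrow> bool" where
  "admissible M E \<longleftrightarrow> E \<noteq> [] \<and> (\<forall>A\<in>set E. finite A \<and> A \<noteq> {} \<and> A \<subseteq> {1..}) \<and>
     sorted_wrt block_less E \<and> Min ` set E \<in> M"

section \<open>Mixed Tsirelson norms\<close>

definition norm_on_c00 :: "((nat \<Rightarrow> real) \<Rightarrow> real) \<Rightarrow> bool" where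
  "norm_on_c00 N \<longleftrightarrow>
     (\<forall>x\<in>c00. 0 \<le> N x \<and> (N x = 0 \<longleftrightarrow> x = (\<lambda>_. 0))) \<and>
     (\<forall>x\<in>c00. \<forall>c. N (\<lambda>i. c * x i) = \<bar>c\<bar> * N x) \<and>
     (\<forall>x\<in>c00. \<forall>y\<in>c00. N (\<lambda>i. x i + y i) \<le> N x + N y)"

text \<open>For a norm \<open>N\<close> all the suprema below are suprema of bounded sets.\<close>

definition is_mixed_Tsirelson_norm ::
    "(nat \<Rightarrow> nat set set) \<Rightarrow> (nat \<Rightarrow> real) \<Rightarrow> ((nat \<Rightarrow> real) \<Rightarrow> real) \<Rightarrow> bool" where
  "is_mixed_Tsirelson_norm M \<theta> N \<longleftrightarrow> norm_on_c00 N \<and>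
     (\<forall>x\<in>c00. N x = max (SUP i\<in>{1..}. \<bar>x i\<bar>)
        (SUP k\<in>{1..}. \<theta> k * (SUP E\<in>{E. admissible (M k) E}. \<Sum>A\<leftarrow>E. N (restr A x))))"

text \<open>The last conjunct only fixes the irrelevant values outside of \<open>c00\<close>; existence and
  uniqueness are shown below.\<close>

definition mixed_Tsirelson_norm ::
    "(nat \<Rightarrow> nat set set) \<Rightarrow> (nat \<Rightarrow> real) \<Rightarrow> (nat \<Rightarrow> real) \<Rightarrow> real" where
  "mixed_Tsirelson_norm M \<theta> =
     (THE N. is_mixed_Tsirelson_norm M \<theta> N \<and> (\<forall>x. x \<notin> c00 \<longrightarrow> N x = 0))"

definition regular_seq :: "(nat \<Rightarrow> real) \<Rightarrow> bool" where
  "regular_seq \<theta> \<longleftrightarrow> (\<forall>n\<ge>1. 0 < \<theta> n \<and> \<theta> n < 1) \<and>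
     (\<forall>m n. 1 \<le> m \<and> m \<le> n \<longrightarrow> \<theta> n \<le> \<theta> m) \<and> \<theta> \<longlonglongrightarrow> 0 \<and>
     (\<forall>n\<ge>1. \<forall>m\<ge>1. \<theta> (n + m) \<ge> \<theta> n * \<theta> m)"

section \<open>Completions of \<open>c00\<close>\<close>

text \<open>A completion of \<open>(c00, N)\<close> is a complete normed space \<open>X\<close>, here a closed subspace of an
  arbitrary Banach space, together with a linear isometry \<open>J\<close> of \<open>(c00, N)\<close> onto a dense
  subspace of \<open>X\<close>.\<close>

definition is_completion ::
    "((nat \<Rightarrow> real) \<Rightarrow> real) \<Rightarrow> 'a::banach set \<Rightarrow> ((nat \<Rightarrow> real) \<Rightarrow> 'a) \<Rightarrow> bool" where
  "is_completion N X J \<longleftrightarrow>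
     (\<forall>x\<in>c00. \<forall>y\<in>c00. J (\<lambda>i. x i + y i) = J x + J y) \<and>
     (\<forall>x\<in>c00. \<forall>c. J (\<lambda>i. c * x i) = c *\<^sub>R J x) \<and>
     (\<forall>x\<in>c00. norm (J x) = N x) \<and>
     X = closure (J ` c00)"

text \<open>Coordinates and supports of elements of the completion refer to the Schauder basis
  \<open>J (unit_vec i)\<close>, \<open>i \<ge> 1\<close>.\<close>

definition coords :: "((nat \<Rightarrow> real) \<Rightarrow> 'a::banach) \<Rightarrow> 'a \<Rightarrow> nat \<Rightarrow> real" where
  "coords J y = (THE a. a 0 = 0 \<and> (\<lambda>i. a i *\<^sub>R J (unit_vec i)) sums y)"

definition block_sequence :: "(nat \<Rightarrow> nat \<Rightarrow> real) \<Rightarrow> bool" where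
  "block_sequence u \<longleftrightarrow> (\<forall>k. u k \<in> c00 \<and> u k \<noteq> (\<lambda>_. 0)) \<and>
     (\<forall>k. block_less (supp (u k)) (supp (u (Suc k))))"

text \<open>Block sequences are infinite here, so block subspaces are infinite dimensional.\<close>

definition block_subspace :: "((nat \<Rightarrow> real) \<Rightarrow> 'a::banach) \<Rightarrow> 'a set \<Rightarrow> bool" where
  "block_subspace J Y \<longleftrightarrow> (\<exists>u. block_sequence u \<and> Y = closure (span (range (\<lambda>k. J (u k)))))"

definition disjointly_supported ::
    "((nat \<Rightarrow> real) \<Rightarrow> 'a::banach) \<Rightarrow> nat \<Rightarrow> (nat \<Rightarrow> 'a) \<Rightarrow> bool" where
  "disjointly_supported J n y \<longleftrightarrow>
     (\<forall>i\<in>{1..n}. \<forall>j\<in>{1..n}. i \<noteq> j \<longrightarrow> supp (coords J (y i)) \<inter> supp (coords J (y j)) = {})"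

definition equivalent_linf_basis :: "real \<Rightarrow> nat \<Rightarrow> (nat \<Rightarrow> 'a::banach) \<Rightarrow> bool" where
  "equivalent_linf_basis C n y \<longleftrightarrow> (\<exists>a>0. \<exists>b>0. b / a \<le> C \<and>
     (\<forall>c. a * Max ((\<lambda>i. \<bar>c i\<bar>) ` {1..n}) \<le> norm (\<Sum>i=1..n. c i *\<^sub>R y i) \<and>
          norm (\<Sum>i=1..n. c i *\<^sub>R y i) \<le> b * Max ((\<lambda>i. \<bar>c i\<bar>) ` {1..n})))"

instance bcontfun :: (metric_space, banach) banach ..

section \<open>Existence and uniqueness of the norm\<close>

lemma c00_zero [simp]: "(\<lambda>_. 0) \<in> c00"
  by (simp add: c00_def supp_def)

lemma c00_unit [simp]: "1 \<le> i \<Longrightarrow> unit_vec i \<in> c00"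
  by (auto simp: c00_def supp_def unit_vec_def)

lemma c00_add [simp]:
  assumes "x \<in> c00" "y \<in> c00" shows "(\<lambda>i. x i + y i) \<in> c00"
proof -
  have "supp (\<lambda>i. x i + y i) \<subseteq> supp x \<union> supp y" by (auto simp: supp_def)
  then show ?thesis using assms by (auto simp: c00_def intro: finite_subset)
qed

lemma c00_scale [simp]:
  assumes "x \<in> c00" shows "(\<lambda>i. c * x i) \<in> c00"
proof -
  have "supp (\<lambda>i. c * x i) \<subseteq> supp x" by (auto simp: supp_def)
  then show ?thesis using assms by (auto simp: c00_def intro: finite_subset)
qed

lemma c00_diff [simp]: "x \<in> c00 \<Longrightarrow> y \<in> c00 \<Longrightarrow> (\<lambda>i. x i - y i) \<in> c00"
  using c00_add[OF _ c00_scale[of y "-1"]] by simp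

lemma c00_restr [simp]:
  assumes "x \<in> c00" shows "restr E x \<in> c00"
proof -
  have "supp (restr E x) \<subseteq> supp x" by (auto simp: supp_def restr_def)
  then show ?thesis using assms by (auto simp: c00_def restr_def intro: finite_subset)
qed

lemma c00_finite: "x \<in> c00 \<Longrightarrow> finite (supp x)"
  by (simp add: c00_def)

lemma admissible_split:
  assumes "admissible M E" "A \<in> set E"
  obtains us vs where "E = us @ A # vs" "\<And>B. B \<in> set us \<union> set vs \<Longrightarrow> A \<inter> B = {}"
proof -
  have disj: "B \<inter> C = {}" if "block_less B C" "finite B" "finite C" for B C
  proof (rule ccontr)
    assume "B \<inter> C \<noteq> {}"
    then obtain i where i: "i \<in> B" "i \<in> C" by blast
    have "Max B < Min C" using that(1) i by (auto simp: block_less_def)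
    moreover have "i \<le> Max B" "Min C \<le> i" using that i by auto
    ultimately show False by simp
  qed
  obtain us vs where E: "E = us @ A # vs" using assms(2) by (meson split_list)
  have "A \<inter> B = {}" if "B \<in> set us \<union> set vs" for B
  proof -
    have "block_less A B \<or> block_less B A"
      using assms(1) that by (auto simp: admissible_def E sorted_wrt_append)
    moreover have "finite A" "finite B" using assms(1) that by (auto simp: admissible_def E)
    ultimately show ?thesis using disj by blast
  qed
  with E show thesis using that by blast
qed

lemma sum_list_zero: "(\<And>A. A \<in> set E \<Longrightarrow> h A = 0) \<Longrightarrow> (\<Sum>A\<leftarrow>E. h A) = (0::real)"
  by (induction E) auto

lemma admissible_sum_le:
  assumes "admissible M E" "\<And>A. A \<in> set E \<Longrightarrow> h A \<le> c" "0 \<le> (c::real)"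
  shows "(\<Sum>A\<leftarrow>E. if j \<in> A then h A else 0) \<le> c"
proof (cases "\<exists>A\<in>set E. j \<in> A")
  case True
  then obtain A where A: "A \<in> set E" "j \<in> A" by blast
  obtain us vs where E: "E = us @ A # vs" and d: "\<And>B. B \<in> set us \<union> set vs \<Longrightarrow> A \<inter> B = {}"
    using admissible_split[OF assms(1) A(1)] by metis
  have "(\<Sum>A\<leftarrow>us. if j \<in> A then h A else 0) = 0" "(\<Sum>A\<leftarrow>vs. if j \<in> A then h A else 0) = 0"
    using d A(2) by (intro sum_list_zero; force)+
  then show ?thesis using A assms(2)[OF A(1)] by (simp add: E)
next
  case False
  then have "(\<Sum>A\<leftarrow>E. if j \<in> A then h A else 0) = 0" by (intro sum_list_zero) auto
  then show ?thesis using assms(3) by simp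
qed

lemma norm_on_c00_le_sum:
  assumes N: "norm_on_c00 N" and S: "finite S" "0 \<notin> S"
  shows "supp x \<subseteq> S \<Longrightarrow> x \<in> c00 \<Longrightarrow> N x \<le> (\<Sum>i\<in>S. \<bar>x i\<bar> * N (unit_vec i))"
  using S
proof (induction S arbitrary: x rule: finite_induct)
  case empty
  then have "x = (\<lambda>_. 0)" by (auto simp: supp_def)
  moreover have "N (\<lambda>_. 0) = 0"
    using N[unfolded norm_on_c00_def, THEN conjunct1, rule_format, OF c00_zero] by simp
  ultimately show ?case by simp
next
  case (insert j S)
  have j: "1 \<le> j" using insert.prems by (cases j) auto
  define z where "z = restr S x"
  have z: "z \<in> c00" "supp z \<subseteq> S"
    using c00_restr[OF insert.prems(2)] by (auto simp: z_def supp_def restr_def)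
  have x: "x = (\<lambda>i. z i + x j * unit_vec j i)"
    using insert.prems(1) insert.hyps by (auto simp: z_def restr_def unit_vec_def supp_def fun_eq_iff)
  have "N x \<le> N z + N (\<lambda>i. x j * unit_vec j i)"
  proof (subst x)
    have e: "(\<lambda>i. x j * unit_vec j i) \<in> c00" by (rule c00_scale[OF c00_unit[OF j]])
    show "N (\<lambda>i. z i + x j * unit_vec j i) \<le> N z + N (\<lambda>i. x j * unit_vec j i)"
      using N[unfolded norm_on_c00_def, THEN conjunct2, THEN conjunct2, rule_format, OF z(1) e] .
  qed
  also have "N (\<lambda>i. x j * unit_vec j i) = \<bar>x j\<bar> * N (unit_vec j)"
    using N j by (auto simp: norm_on_c00_def)
  also have "N z \<le> (\<Sum>i\<in>S. \<bar>z i\<bar> * N (unit_vec i))"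
    using insert z by auto
  also have "\<dots> = (\<Sum>i\<in>S. \<bar>x i\<bar> * N (unit_vec i))"
    by (intro sum.cong) (auto simp: z_def restr_def)
  finally show ?case using insert by simp
qed

text \<open>For every norm the sums in the implicit equation are bounded.\<close>

lemma norm_on_c00_admissible_le:
  assumes N: "norm_on_c00 N" and E: "admissible M E" and x: "x \<in> c00"
  shows "(\<Sum>A\<leftarrow>E. N (restr A x)) \<le> (\<Sum>i\<in>supp x. \<bar>x i\<bar> * N (unit_vec i))"
proof -
  have fin: "finite (supp x)" "0 \<notin> supp x" using x by (auto simp: c00_def supp_def)
  have nn: "0 \<le> \<bar>x i\<bar> * N (unit_vec i)" if "i \<in> supp x" for i
    using N fin that by (cases i) (auto simp: norm_on_c00_def)
  have "(\<Sum>A\<leftarrow>E. N (restr A x)) \<le> (\<Sum>A\<leftarrow>E. \<Sum>i\<in>supp x. if i \<in> A then \<bar>x i\<bar> * N (unit_vec i) else 0)"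
  proof (intro sum_list_mono)
    fix A
    have "N (restr A x) \<le> (\<Sum>i\<in>supp x. \<bar>restr A x i\<bar> * N (unit_vec i))"
      by (rule norm_on_c00_le_sum[OF N fin _ c00_restr[OF x]]) (auto simp: supp_def restr_def)
    also have "\<dots> = (\<Sum>i\<in>supp x. if i \<in> A then \<bar>x i\<bar> * N (unit_vec i) else 0)"
      by (intro sum.cong) (auto simp: restr_def)
    finally show "N (restr A x) \<le> \<dots>" .
  qed
  also have "\<dots> = (\<Sum>i\<in>supp x. \<Sum>A\<leftarrow>E. if i \<in> A then \<bar>x i\<bar> * N (unit_vec i) else 0)"
    by (induction E) (simp_all add: sum.distrib)
  also have "\<dots> \<le> (\<Sum>i\<in>supp x. \<bar>x i\<bar> * N (unit_vec i))"
    by (intro sum_mono admissible_sum_le[OF E]) (use nn in auto)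
  finally show ?thesis .
qed

locale mixed_Tsirelson_data =
  fixes M :: "nat \<Rightarrow> nat set set" and \<theta> :: "nat \<Rightarrow> real" and c :: real
  assumes M: "k \<ge> 1 \<Longrightarrow> \<exists>E. admissible (M k) E"
    and \<theta>_pos: "k \<ge> 1 \<Longrightarrow> 0 < \<theta> k" and \<theta>_le: "k \<ge> 1 \<Longrightarrow> \<theta> k \<le> c" and c: "c < 1"
begin

lemma c_pos: "0 < c"
  using \<theta>_pos[of 1] \<theta>_le[of 1] by simp

lemma bdd_coord: "x \<in> c00 \<Longrightarrow> bdd_above ((\<lambda>i. \<bar>x i\<bar>) ` {1..})"
proof -
  assume "x \<in> c00"
  then have "finite ((\<lambda>i. \<bar>x i\<bar>) ` supp x)" by (auto dest: c00_finite)
  then have "finite (insert 0 ((\<lambda>i. \<bar>x i\<bar>) ` supp x))" by simp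
  moreover have "(\<lambda>i. \<bar>x i\<bar>) ` {1..} \<subseteq> insert 0 ((\<lambda>i. \<bar>x i\<bar>) ` supp x)"
    by (auto simp: supp_def)
  ultimately show ?thesis by (meson bdd_above.I2 bdd_above_finite bdd_above_mono)
qed

lemma bdd_inner:
  assumes "norm_on_c00 N" "x \<in> c00"
  shows "bdd_above ((\<lambda>E. \<Sum>A\<leftarrow>E. N (restr A x)) ` {E. admissible (M k) E})"
  using norm_on_c00_admissible_le[OF assms(1) _ assms(2)] by (auto intro!: bdd_aboveI)

lemma inner_le:
  assumes "norm_on_c00 N" "x \<in> c00" "k \<ge> 1"
  shows "(SUP E\<in>{E. admissible (M k) E}. \<Sum>A\<leftarrow>E. N (restr A x))
     \<le> (\<Sum>i\<in>supp x. \<bar>x i\<bar> * N (unit_vec i))"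
  using norm_on_c00_admissible_le[OF assms(1) _ assms(2)] M[OF assms(3)] by (intro cSUP_least) auto

lemma bdd_outer:
  assumes "norm_on_c00 N" "x \<in> c00"
  shows "bdd_above ((\<lambda>k. \<theta> k * (SUP E\<in>{E. admissible (M k) E}. \<Sum>A\<leftarrow>E. N (restr A x))) ` {1..})"
proof (rule bdd_aboveI2)
  fix k :: nat assume "k \<in> {1..}"
  then have k: "k \<ge> 1" by simp
  let ?W = "\<Sum>i\<in>supp x. \<bar>x i\<bar> * N (unit_vec i)"
  have W: "0 \<le> ?W"
  proof (rule sum_nonneg)
    fix i assume "i \<in> supp x"
    then have "1 \<le> i" using assms by (cases i) (auto simp: c00_def supp_def)
    then show "0 \<le> \<bar>x i\<bar> * N (unit_vec i)" using assms by (auto simp: norm_on_c00_def)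
  qed
  have "\<theta> k * (SUP E\<in>{E. admissible (M k) E}. \<Sum>A\<leftarrow>E. N (restr A x)) \<le> \<theta> k * ?W"
    using inner_le[OF assms k] \<theta>_pos[OF k] by (intro mult_left_mono) auto
  also have "\<dots> \<le> c * ?W" using \<theta>_le[OF k] W by (rule mult_right_mono)
  finally show "\<theta> k * (SUP E\<in>{E. admissible (M k) E}. \<Sum>A\<leftarrow>E. N (restr A x)) \<le> c * ?W" .
qed

lemma is_mixed_iff:
  assumes N: "norm_on_c00 N"
  shows "is_mixed_Tsirelson_norm M \<theta> N \<longleftrightarrow>
    (\<forall>x\<in>c00. (\<forall>i\<ge>1. \<bar>x i\<bar> \<le> N x) \<and>
       (\<forall>k\<ge>1. \<forall>E. admissible (M k) E \<longrightarrow> \<theta> k * (\<Sum>A\<leftarrow>E. N (restr A x)) \<le> N x) \<and>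
       (\<forall>C. (\<forall>i\<ge>1. \<bar>x i\<bar> \<le> C) \<and>
            (\<forall>k\<ge>1. \<forall>E. admissible (M k) E \<longrightarrow> \<theta> k * (\<Sum>A\<leftarrow>E. N (restr A x)) \<le> C) \<longrightarrow> N x \<le> C))"
proof -
  have "(N x = max (SUP i\<in>{1..}. \<bar>x i\<bar>)
        (SUP k\<in>{1..}. \<theta> k * (SUP E\<in>{E. admissible (M k) E}. \<Sum>A\<leftarrow>E. N (restr A x)))) \<longleftrightarrow>
     ((\<forall>i\<ge>1. \<bar>x i\<bar> \<le> N x) \<and>
       (\<forall>k\<ge>1. \<forall>E. admissible (M k) E \<longrightarrow> \<theta> k * (\<Sum>A\<leftarrow>E. N (restr A x)) \<le> N x) \<and>
       (\<forall>C. (\<forall>i\<ge>1. \<bar>x i\<bar> \<le> C) \<and>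
            (\<forall>k\<ge>1. \<forall>E. admissible (M k) E \<longrightarrow> \<theta> k * (\<Sum>A\<leftarrow>E. N (restr A x)) \<le> C) \<longrightarrow> N x \<le> C))"
    (is "N x = ?R \<longleftrightarrow> ?P (N x)") if x: "x \<in> c00" for x
  proof -
    have R: "?R \<le> C \<longleftrightarrow> (\<forall>i\<ge>1. \<bar>x i\<bar> \<le> C) \<and>
       (\<forall>k\<ge>1. \<forall>E. admissible (M k) E \<longrightarrow> \<theta> k * (\<Sum>A\<leftarrow>E. N (restr A x)) \<le> C)" for C
    proof -
      have "(SUP i\<in>{1..}. \<bar>x i\<bar>) \<le> C \<longleftrightarrow> (\<forall>i\<ge>1. \<bar>x i\<bar> \<le> C)"
        using bdd_coord[OF x] by (subst cSUP_le_iff) auto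
      moreover have "(SUP k\<in>{1..}. \<theta> k * (SUP E\<in>{E. admissible (M k) E}. \<Sum>A\<leftarrow>E. N (restr A x))) \<le> C \<longleftrightarrow>
        (\<forall>k\<ge>1. \<theta> k * (SUP E\<in>{E. admissible (M k) E}. \<Sum>A\<leftarrow>E. N (restr A x)) \<le> C)"
        using bdd_outer[OF N x] by (subst cSUP_le_iff) auto
      moreover have "\<theta> k * (SUP E\<in>{E. admissible (M k) E}. \<Sum>A\<leftarrow>E. N (restr A x)) \<le> C \<longleftrightarrow>
         (\<forall>E. admissible (M k) E \<longrightarrow> \<theta> k * (\<Sum>A\<leftarrow>E. N (restr A x)) \<le> C)" if k: "k \<ge> 1" for k
      proof -
        have "(SUP E\<in>{E. admissible (M k) E}. \<Sum>A\<leftarrow>E. N (restr A x)) \<le> C / \<theta> k \<longleftrightarrow>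
          (\<forall>E. admissible (M k) E \<longrightarrow> (\<Sum>A\<leftarrow>E. N (restr A x)) \<le> C / \<theta> k)"
          using bdd_inner[OF N x] M[OF k] by (subst cSUP_le_iff) auto
        then show ?thesis using \<theta>_pos[OF k] by (simp add: pos_le_divide_eq mult.commute)
      qed
      ultimately show ?thesis by auto
    qed
    show ?thesis
    proof
      assume *: "N x = ?R"
      have "?R \<le> ?R" by simp
      then have "?R \<le> N x" unfolding * .
      then show "?P (N x)" using R[of "N x"] R[unfolded *[symmetric]] by blast
    next
      assume P: "?P (N x)"
      have ge: "?R \<le> N x" using P R[of "N x"] by blast
      have le: "N x \<le> ?R" using P R[of ?R] by blast
      show "N x = ?R" by (rule order.antisym[OF le ge])
    qed
  qed
  then show ?thesis using N by (auto simp: is_mixed_Tsirelson_norm_def)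
qed

lemma norm_restr_le_norm:
  assumes 1: "is_mixed_Tsirelson_norm M \<theta> N1" and 2: "is_mixed_Tsirelson_norm M \<theta> N2"
  shows "x \<in> c00 \<Longrightarrow> N1 (restr F x) \<le> N2 x"
proof (induction "card (supp x)" arbitrary: x rule: less_induct)
  case less
  note x = less.prems
  have n1: "norm_on_c00 N1" and n2: "norm_on_c00 N2"
    using 1 2 by (auto simp: is_mixed_Tsirelson_norm_def)
  let ?z = "restr F x"
  have z: "?z \<in> c00" using x by simp
  show ?case
  proof (rule ccontr)
    assume *: "\<not> N1 ?z \<le> N2 x"
    have pos: "0 \<le> N2 x" using n2 x by (auto simp: norm_on_c00_def)
    let ?C = "max (N2 x) (c * N1 ?z)"
    have "N1 ?z \<le> ?C"
    proof -
      have "\<bar>?z i\<bar> \<le> ?C" if "i \<ge> 1" for i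
      proof -
        have "\<bar>?z i\<bar> \<le> \<bar>x i\<bar>" by (simp add: restr_def)
        also have "\<dots> \<le> N2 x" using 2 x that is_mixed_iff[OF n2] by blast
        finally show ?thesis by simp
      qed
      moreover have "\<theta> k * (\<Sum>A\<leftarrow>E. N1 (restr A ?z)) \<le> ?C" if k: "k \<ge> 1" and E: "admissible (M k) E" for k E
      proof (cases "\<exists>A\<in>set E. supp x \<subseteq> A")
        case True
        then obtain A where A: "A \<in> set E" "supp x \<subseteq> A" by blast
        obtain us vs where E': "E = us @ A # vs" and d: "\<And>B. B \<in> set us \<union> set vs \<Longrightarrow> A \<inter> B = {}"
          using admissible_split[OF E A(1)] by metis
        have r0: "N1 (restr B ?z) = 0" if "B \<in> set us \<union> set vs" for B
        proof -
          have "restr B ?z = (\<lambda>_. 0)" using d[OF that] A(2)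
            by (auto simp: restr_def supp_def fun_eq_iff)
          then show ?thesis using n1 by (simp add: norm_on_c00_def)
        qed
        have "(\<Sum>A\<leftarrow>us. N1 (restr A ?z)) = 0" "(\<Sum>A\<leftarrow>vs. N1 (restr A ?z)) = 0"
          using r0 by (auto intro!: sum_list_zero)
        moreover have "restr A ?z = ?z" using A(2) by (auto simp: restr_def supp_def fun_eq_iff)
        ultimately have "(\<Sum>A\<leftarrow>E. N1 (restr A ?z)) = N1 ?z" by (simp add: E')
        then have "\<theta> k * (\<Sum>A\<leftarrow>E. N1 (restr A ?z)) \<le> c * N1 ?z"
          using \<theta>_le[OF k] * pos by (simp add: mult_right_mono)
        then show ?thesis by simp
      next
        case False
        have "(\<Sum>A\<leftarrow>E. N1 (restr A ?z)) \<le> (\<Sum>A\<leftarrow>E. N2 (restr A x))"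
        proof (rule sum_list_mono)
          fix A assume "A \<in> set E"
          then have "\<not> supp x \<subseteq> A" using False by blast
          then have "supp (restr A x) \<subset> supp x" by (auto simp: supp_def restr_def)
          then have "card (supp (restr A x)) < card (supp x)"
            using x by (intro psubset_card_mono) (auto dest: c00_finite)
          then have "N1 (restr F (restr A x)) \<le> N2 (restr A x)" using less.hyps x by auto
          moreover have "restr F (restr A x) = restr A ?z" by (auto simp: restr_def)
          ultimately show "N1 (restr A ?z) \<le> N2 (restr A x)" by simp
        qed
        then have "\<theta> k * (\<Sum>A\<leftarrow>E. N1 (restr A ?z)) \<le> \<theta> k * (\<Sum>A\<leftarrow>E. N2 (restr A x))"
          using \<theta>_pos[OF k] by (intro mult_left_mono) auto
        also have "\<dots> \<le> N2 x" using 2 x k E is_mixed_iff[OF n2] by blast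
        finally show ?thesis by simp
      qed
      ultimately show ?thesis using 1 z is_mixed_iff[OF n1] by blast
    qed
    moreover have "c * N1 ?z < N1 ?z" using c * pos by simp
    ultimately show False using * by auto
  qed
qed

text \<open>Existence: the norm is the supremum over the following set of functionals.\<close>

inductive_set norming :: "(nat \<Rightarrow> real) set" where
  unit: "i \<ge> 1 \<Longrightarrow> \<bar>s\<bar> = 1 \<Longrightarrow> (\<lambda>j. s * unit_vec i j) \<in> norming"
| comb: "k \<ge> 1 \<Longrightarrow> admissible (M k) E \<Longrightarrow> (\<And>A. A \<in> set E \<Longrightarrow> g A \<in> norming) \<Longrightarrow>
     (\<lambda>j. \<theta> k * (\<Sum>A\<leftarrow>E. restr A (g A) j)) \<in> norming"

definition pair :: "(nat \<Rightarrow> real) \<Rightarrow> (nat \<Rightarrow> real) \<Rightarrow> real" where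
  "pair f x = (\<Sum>i\<in>supp x. f i * x i)"

lemma pair_superset: "finite S \<Longrightarrow> supp x \<subseteq> S \<Longrightarrow> pair f x = (\<Sum>i\<in>S. f i * x i)"
  unfolding pair_def by (rule sum.mono_neutral_left) (auto simp: supp_def)

lemma pair_add:
  assumes "x \<in> c00" "y \<in> c00" shows "pair f (\<lambda>i. x i + y i) = pair f x + pair f y"
proof -
  let ?S = "supp x \<union> supp y"
  have "finite ?S" using assms by (auto dest: c00_finite)
  moreover have "supp (\<lambda>i. x i + y i) \<subseteq> ?S" by (auto simp: supp_def)
  ultimately show ?thesis
    by (simp add: pair_superset[of ?S] sum.distrib[symmetric] algebra_simps)
qed

lemma pair_scale:
  assumes "x \<in> c00" shows "pair f (\<lambda>i. t * x i) = t * pair f x"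
proof -
  have "supp (\<lambda>i. t * x i) \<subseteq> supp x" by (auto simp: supp_def)
  then show ?thesis using c00_finite[OF assms]
    by (simp add: pair_superset[of "supp x"] sum_distrib_left algebra_simps)
qed

lemma pair_unit:
  assumes "x \<in> c00" shows "pair (\<lambda>j. s * unit_vec i j) x = s * x i"
proof -
  have "pair (\<lambda>j. s * unit_vec i j) x = (\<Sum>j\<in>insert i (supp x). s * unit_vec i j * x j)"
    using c00_finite[OF assms] by (intro pair_superset) auto
  also have "\<dots> = (\<Sum>j\<in>insert i (supp x). if j = i then s * x i else 0)"
    by (intro sum.cong) (auto simp: unit_vec_def)
  finally show ?thesis using c00_finite[OF assms] by (simp add: sum.delta)
qed

lemma pair_comb:
  assumes "x \<in> c00"
  shows "pair (\<lambda>j. t * (\<Sum>A\<leftarrow>E. restr A (g A) j)) x = t * (\<Sum>A\<leftarrow>E. pair (g A) (restr A x))"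
proof -
  have p: "pair (g A) (restr A x) = (\<Sum>i\<in>supp x. restr A (g A) i * x i)" for A
  proof -
    have "supp (restr A x) \<subseteq> supp x" by (auto simp: supp_def restr_def)
    then have "pair (g A) (restr A x) = (\<Sum>i\<in>supp x. g A i * restr A x i)"
      by (rule pair_superset[OF c00_finite[OF assms]])
    also have "\<dots> = (\<Sum>i\<in>supp x. restr A (g A) i * x i)"
      by (intro sum.cong) (auto simp: restr_def)
    finally show ?thesis .
  qed
  have "(\<Sum>A\<leftarrow>E. pair (g A) (restr A x)) = (\<Sum>i\<in>supp x. (\<Sum>A\<leftarrow>E. restr A (g A) i) * x i)"
    unfolding p by (induction E) (simp_all add: sum.distrib algebra_simps)
  then show ?thesis by (simp add: pair_def sum_distrib_left algebra_simps)
qed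

lemma norming_le_1: "f \<in> norming \<Longrightarrow> \<bar>f j\<bar> \<le> 1"
proof (induction rule: norming.induct)
  case (unit i s) then show ?case by (auto simp: unit_vec_def)
next
  case (comb k E g)
  have "\<bar>\<Sum>A\<leftarrow>E. restr A (g A) j\<bar> \<le> (\<Sum>A\<leftarrow>E. \<bar>restr A (g A) j\<bar>)"
    using sum_list_abs[of "map (\<lambda>A. restr A (g A) j) E"] by (simp add: comp_def)
  also have "\<dots> = (\<Sum>A\<leftarrow>E. if j \<in> A then \<bar>g A j\<bar> else 0)"
    by (intro arg_cong[where f = sum_list] map_cong) (auto simp: restr_def)
  also have "\<dots> \<le> 1" using comb by (intro admissible_sum_le) auto
  finally have "\<theta> k * \<bar>\<Sum>A\<leftarrow>E. restr A (g A) j\<bar> \<le> 1 * 1"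
    using \<theta>_pos[of k] \<theta>_le[of k] c comb by (intro mult_mono) auto
  then show ?case using \<theta>_pos[of k] comb by (simp add: abs_mult)
qed

lemma norming_uminus: "f \<in> norming \<Longrightarrow> (\<lambda>j. - f j) \<in> norming"
proof (induction rule: norming.induct)
  case (unit i s) then show ?case using norming.unit[of i "-s"] by simp
next
  case (comb k E g)
  have "(\<lambda>j. - (\<theta> k * (\<Sum>A\<leftarrow>E. restr A (g A) j))) = (\<lambda>j. \<theta> k * (\<Sum>A\<leftarrow>E. restr A ((\<lambda>i. - g A i)) j))"
  proof
    fix j
    have "(\<Sum>A\<leftarrow>E. restr A ((\<lambda>i. - g A i)) j) = - (\<Sum>A\<leftarrow>E. restr A (g A) j)"
      by (induction E) (auto simp: restr_def)
    then show "- (\<theta> k * (\<Sum>A\<leftarrow>E. restr A (g A) j)) = \<theta> k * (\<Sum>A\<leftarrow>E. restr A ((\<lambda>i. - g A i)) j)"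
      by simp
  qed
  then show ?case using norming.comb[of k E "\<lambda>A j. - g A j"] comb by auto
qed

lemma norming_nonempty: "norming \<noteq> {}"
  using norming.unit[of 1 1] by auto

definition T :: "(nat \<Rightarrow> real) \<Rightarrow> real" where
  "T x = (if x \<in> c00 then SUP f\<in>norming. \<bar>pair f x\<bar> else 0)"

lemma bdd_pair: "bdd_above ((\<lambda>f. \<bar>pair f x\<bar>) ` norming)"
proof (rule bdd_aboveI2)
  fix f assume f: "f \<in> norming"
  have "\<bar>pair f x\<bar> \<le> (\<Sum>i\<in>supp x. \<bar>f i * x i\<bar>)" unfolding pair_def by (rule sum_abs)
  also have "\<dots> \<le> (\<Sum>i\<in>supp x. 1 * \<bar>x i\<bar>)"
    unfolding abs_mult by (intro sum_mono mult_right_mono norming_le_1[OF f]) auto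
  finally show "\<bar>pair f x\<bar> \<le> (\<Sum>i\<in>supp x. 1 * \<bar>x i\<bar>)" .
qed

lemma T_le_iff: "x \<in> c00 \<Longrightarrow> T x \<le> C \<longleftrightarrow> (\<forall>f\<in>norming. \<bar>pair f x\<bar> \<le> C)"
  unfolding T_def using bdd_pair norming_nonempty by (simp add: cSUP_le_iff)

lemma pair_le_T: "x \<in> c00 \<Longrightarrow> f \<in> norming \<Longrightarrow> \<bar>pair f x\<bar> \<le> T x"
  using T_le_iff[of x "T x"] by auto

lemma coord_le_T: "x \<in> c00 \<Longrightarrow> i \<ge> 1 \<Longrightarrow> \<bar>x i\<bar> \<le> T x"
  using pair_le_T[of x "\<lambda>j. 1 * unit_vec i j"] norming.unit[of i 1] pair_unit[of x 1 i] by simp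

lemma norm_on_c00_T: "norm_on_c00 T"
  unfolding norm_on_c00_def
proof (intro conjI ballI allI)
  fix x assume x: "x \<in> c00"
  show nn: "0 \<le> T x" using coord_le_T[OF x, of 1] by simp
  show "T x = 0 \<longleftrightarrow> x = (\<lambda>_. 0)"
  proof
    assume "T x = 0"
    then have "x i = 0" for i using coord_le_T[OF x, of i] x by (cases i) (auto simp: c00_def)
    then show "x = (\<lambda>_. 0)" by auto
  next
    assume "x = (\<lambda>_. 0)"
    then have "T x \<le> 0" using x by (simp add: T_le_iff pair_def)
    then show "T x = 0" using nn by simp
  qed
next
  fix x and a :: real assume x: "x \<in> c00"
  have le: "T (\<lambda>i. a * x i) \<le> \<bar>a\<bar> * T x" if "x \<in> c00" for a x
    using that by (auto simp: T_le_iff pair_scale abs_mult intro!: mult_left_mono pair_le_T)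
  show "T (\<lambda>i. a * x i) = \<bar>a\<bar> * T x"
  proof (cases "a = 0")
    case True
    have "T (\<lambda>_. 0) \<le> 0" by (simp add: T_le_iff pair_def)
    moreover have "0 \<le> T (\<lambda>_. 0)" using coord_le_T[of "\<lambda>_. 0" 1] by simp
    ultimately show ?thesis using True by simp
  next
    case False
    have "T x \<le> \<bar>1 / a\<bar> * T (\<lambda>i. a * x i)"
      using le[of "\<lambda>i. a * x i" "1 / a"] x False by simp
    then have "\<bar>a\<bar> * T x \<le> T (\<lambda>i. a * x i)" using False by (simp add: field_simps)
    then show ?thesis using le[OF x, of a] by simp
  qed
next
  fix x y assume xy: "x \<in> c00" "y \<in> c00"
  have "\<bar>pair f x + pair f y\<bar> \<le> T x + T y" if "f \<in> norming" for f
    using pair_le_T[OF xy(1) that] pair_le_T[OF xy(2) that] by linarith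
  then show "T (\<lambda>i. x i + y i) \<le> T x + T y"
    using xy by (simp add: T_le_iff pair_add)
qed

lemma is_mixed_T: "is_mixed_Tsirelson_norm M \<theta> T"
  unfolding is_mixed_iff[OF norm_on_c00_T]
proof (intro ballI conjI allI impI)
  fix x and i :: nat assume "x \<in> c00" "1 \<le> i"
  then show "\<bar>x i\<bar> \<le> T x" by (rule coord_le_T)
next
  fix x E and k :: nat assume x: "x \<in> c00" and k: "1 \<le> k" and E: "admissible (M k) E"
  have ne: "length E > 0" using E by (auto simp: admissible_def)
  show "\<theta> k * (\<Sum>A\<leftarrow>E. T (restr A x)) \<le> T x"
  proof (rule field_le_epsilon)
    fix e :: real assume e: "0 < e"
    define d where "d = e / (\<theta> k * length E)"
    have d: "0 < d" "\<theta> k * (length E * d) = e" using e \<theta>_pos[OF k] ne by (auto simp: d_def)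
    have "\<exists>f\<in>norming. T (restr A x) - d \<le> pair f (restr A x)" for A
    proof -
      have "\<not> T (restr A x) \<le> T (restr A x) - d" using d by simp
      then obtain f where f: "f \<in> norming" "T (restr A x) - d < \<bar>pair f (restr A x)\<bar>"
        using x by (auto simp: T_le_iff not_le)
      have "pair (\<lambda>j. - f j) y = - pair f y" for y by (simp add: pair_def sum_negf)
      then show ?thesis using f norming_uminus[OF f(1)]
        by (cases "pair f (restr A x) \<ge> 0") (auto intro: less_imp_le bexI[of _ f] bexI[of _ "\<lambda>j. - f j"])
    qed
    then obtain g where g: "\<And>A. g A \<in> norming" "\<And>A. T (restr A x) - d \<le> pair (g A) (restr A x)"
      by metis
    have "(\<Sum>A\<leftarrow>E. T (restr A x)) - length E * d = (\<Sum>A\<leftarrow>E. T (restr A x) - d)"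
      by (induction E) (auto simp: algebra_simps)
    also have "\<dots> \<le> (\<Sum>A\<leftarrow>E. pair (g A) (restr A x))" using g by (intro sum_list_mono)
    finally have "\<theta> k * ((\<Sum>A\<leftarrow>E. T (restr A x)) - length E * d) \<le> \<theta> k * (\<Sum>A\<leftarrow>E. pair (g A) (restr A x))"
      using \<theta>_pos[OF k] by (intro mult_left_mono) auto
    also have "\<dots> = pair (\<lambda>j. \<theta> k * (\<Sum>A\<leftarrow>E. restr A (g A) j)) x" by (rule pair_comb[OF x, symmetric])
    also have "\<dots> \<le> T x" using pair_le_T[OF x norming.comb[OF k E, of g, OF g(1)]] by simp
    finally show "\<theta> k * (\<Sum>A\<leftarrow>E. T (restr A x)) \<le> T x + e" using d by (simp add: right_diff_distrib)
  qed
next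
  fix x C assume x: "x \<in> c00"
    and C: "(\<forall>i\<ge>1. \<bar>x i\<bar> \<le> C) \<and>
            (\<forall>k\<ge>1. \<forall>E. admissible (M k) E \<longrightarrow> \<theta> k * (\<Sum>A\<leftarrow>E. T (restr A x)) \<le> C)"
  have "\<bar>pair f x\<bar> \<le> C" if "f \<in> norming" for f
    using that
  proof cases
    case (unit i s)
    then show ?thesis using C pair_unit[OF x] by (simp add: abs_mult)
  next
    case (comb k E g)
    have "\<bar>\<Sum>A\<leftarrow>E. pair (g A) (restr A x)\<bar> \<le> (\<Sum>A\<leftarrow>E. \<bar>pair (g A) (restr A x)\<bar>)"
      using sum_list_abs[of "map (\<lambda>A. pair (g A) (restr A x)) E"] by (simp add: comp_def)
    also have "\<dots> \<le> (\<Sum>A\<leftarrow>E. T (restr A x))"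
      using comb x by (intro sum_list_mono pair_le_T) auto
    finally have "\<theta> k * \<bar>\<Sum>A\<leftarrow>E. pair (g A) (restr A x)\<bar> \<le> \<theta> k * (\<Sum>A\<leftarrow>E. T (restr A x))"
      using \<theta>_pos[of k] comb by (intro mult_left_mono) auto
    also have "\<dots> \<le> C" using C comb by blast
    finally show ?thesis using comb \<theta>_pos[of k] by (simp add: pair_comb[OF x] abs_mult)
  qed
  then show "T x \<le> C" using T_le_iff[OF x] by blast
qed

lemma mixed_Tsirelson_norm_unique:
  assumes "is_mixed_Tsirelson_norm M \<theta> N" "x \<in> c00" shows "N x = T x"
  using norm_restr_le_norm[OF assms(1) is_mixed_T assms(2), of UNIV]
    norm_restr_le_norm[OF is_mixed_T assms, of UNIV] by (simp add: restr_def)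

lemma mixed_Tsirelson_norm_eq_T: "mixed_Tsirelson_norm M \<theta> = T"
  unfolding mixed_Tsirelson_norm_def
proof (rule the_equality)
  show "is_mixed_Tsirelson_norm M \<theta> T \<and> (\<forall>x. x \<notin> c00 \<longrightarrow> T x = 0)"
    using is_mixed_T by (simp add: T_def)
  show "N = T" if "is_mixed_Tsirelson_norm M \<theta> N \<and> (\<forall>x. x \<notin> c00 \<longrightarrow> N x = 0)" for N
  proof
    fix x show "N x = T x"
      using that mixed_Tsirelson_norm_unique[of N x] by (cases "x \<in> c00") (auto simp: T_def)
  qed
qed

lemma is_mixed_Tsirelson_norm: "is_mixed_Tsirelson_norm M \<theta> (mixed_Tsirelson_norm M \<theta>)"
  using is_mixed_T by (simp add: mixed_Tsirelson_norm_eq_T)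

section \<open>Existence of the completion\<close>

lemma is_completion_exists:
  "\<exists>(X :: ((nat \<Rightarrow> real) discrete \<Rightarrow>\<^sub>C real) set) J. is_completion (mixed_Tsirelson_norm M \<theta>) X J"
proof -
  define h where "h x d = (if of_discrete d \<in> norming then pair (of_discrete d) x else 0)" for x d
  define J where "J x = Bcontfun (h x)" for x
  have cont: "continuous_on UNIV (g :: (nat \<Rightarrow> real) discrete \<Rightarrow> real)" for g
    by (simp add: continuous_on_open_vimage open_discrete)
  have J: "apply_bcontfun (J x) = h x" if x: "x \<in> c00" for x
    unfolding J_def
  proof (rule Bcontfun_inverse, rule bcontfun_normI[OF cont])
    fix d show "norm (h x d) \<le> T x"
      using pair_le_T[OF x] coord_le_T[OF x, of 1] by (auto simp: h_def)
  qed
  have nJ: "norm (J x) = T x" if x: "x \<in> c00" for x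
  proof (rule antisym)
    show "norm (J x) \<le> T x"
      using pair_le_T[OF x] coord_le_T[OF x, of 1] by (intro norm_bound) (auto simp: J[OF x] h_def)
    have "\<bar>pair f x\<bar> \<le> norm (J x)" if "f \<in> norming" for f
      using norm_bounded[of "J x" "discrete f"] that by (simp add: J[OF x] h_def discrete_inverse)
    then show "T x \<le> norm (J x)" using x by (simp add: T_le_iff)
  qed
  have "is_completion T (closure (J ` c00)) J"
    unfolding is_completion_def
    by (intro conjI ballI allI refl nJ bcontfun_eqI)
       (auto simp: J plus_bcontfun.rep_eq scaleR_bcontfun.rep_eq h_def pair_add pair_scale)
  then show ?thesis unfolding mixed_Tsirelson_norm_eq_T by blast
qed

section \<open>Well-definedness of coordinates\<close>

lemma coords_ex1:
  assumes "is_completion (mixed_Tsirelson_norm M \<theta>) X J" "y \<in> X"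
  shows "\<exists>!a. a 0 = 0 \<and> (\<lambda>i. a i *\<^sub>R J (unit_vec i)) sums y"
proof -
  have Jadd: "\<And>x z. x \<in> c00 \<Longrightarrow> z \<in> c00 \<Longrightarrow> J (\<lambda>i. x i + z i) = J x + J z"
    and Jsc: "\<And>x c. x \<in> c00 \<Longrightarrow> J (\<lambda>i. c * x i) = c *\<^sub>R J x"
    and Jn: "\<And>x. x \<in> c00 \<Longrightarrow> norm (J x) = T x"
    and y: "y \<in> closure (J ` c00)"
    using assms by (auto simp: is_completion_def mixed_Tsirelson_norm_eq_T)
  have Jdiff: "J (\<lambda>i. x i - z i) = J x - J z" if "x \<in> c00" "z \<in> c00" for x z
    using Jadd[OF that(1) c00_scale[OF that(2), of "-1"]] Jsc[OF that(2), of "-1"] by simp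
  have S: "restr {..<n} a \<in> c00 \<and> (\<Sum>i<n. a i *\<^sub>R J (unit_vec i)) = J (restr {..<n} a)"
    if a: "a 0 = 0" for a n
  proof (induction n)
    case 0
    have "J (\<lambda>_. 0) = 0" using Jsc[of "\<lambda>_. 0" 0] by simp
    then show ?case by (simp add: restr_def)
  next
    case (Suc n)
    show ?case
    proof (cases "n = 0")
      case True
      have "restr {..<Suc n} a = restr {..<n} a" using a True by (auto simp: restr_def)
      then show ?thesis using Suc a True by simp
    next
      case False
      have e: "restr {..<Suc n} a = (\<lambda>i. restr {..<n} a i + a n * unit_vec n i)"
        by (auto simp: restr_def unit_vec_def fun_eq_iff less_Suc_eq)
      show ?thesis unfolding e using Suc False by (simp add: Jadd Jsc)
    qed
  qed
  have restr_le: "T (restr F x) \<le> T x" if "x \<in> c00" for F x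
    by (rule norm_restr_le_norm[OF is_mixed_T is_mixed_T that])
  have uniq: "a = b" if a: "a 0 = 0" "(\<lambda>i. a i *\<^sub>R J (unit_vec i)) sums y"
    and b: "b 0 = 0" "(\<lambda>i. b i *\<^sub>R J (unit_vec i)) sums y" for a b
  proof
    fix i
    show "a i = b i"
    proof (cases "i = 0")
      case False
      define z where "z = (\<lambda>i. a i - b i)"
      have z: "z 0 = 0" "(\<lambda>i. z i *\<^sub>R J (unit_vec i)) sums 0"
        using a b sums_diff[OF a(2) b(2)] by (auto simp: z_def scaleR_diff_left)
      have "(\<lambda>n. norm (J (restr {..<n} z))) \<longlonglongrightarrow> 0"
        using z(2) S[of z, OF z(1)] by (intro tendsto_norm_zero) (simp add: sums_def)
      then have "\<bar>z i\<bar> \<le> 0"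
      proof (rule LIMSEQ_le_const, intro exI allI impI)
        fix n assume "Suc i \<le> n"
        then show "\<bar>z i\<bar> \<le> norm (J (restr {..<n} z))"
        using coord_le_T[of "restr {..<n} z" i] S[of z n, OF z(1)] False Jn
        by (auto simp: restr_def)
      qed
      then show ?thesis by (simp add: z_def)
    qed (use a b in simp)
  qed
  obtain w where w: "\<forall>k. w k \<in> J ` c00" "w \<longlonglongrightarrow> y"
    using y unfolding closure_sequential by blast
  have "\<forall>k. \<exists>x. x \<in> c00 \<and> w k = J x" using w(1) by blast
  from choice[OF this] obtain v where v: "\<And>k. v k \<in> c00" "\<And>k. w k = J (v k)" by blast
  have Cau: "Cauchy w" using w(2) by (rule LIMSEQ_imp_Cauchy)
  have diffT: "T (\<lambda>i. v k i - v l i) = dist (w k) (w l)" for k l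
    using v Jn[of "\<lambda>i. v k i - v l i"] by (simp add: Jdiff dist_norm)
  have "Cauchy (\<lambda>k. v k i)" for i
  proof (cases "i = 0")
    case True
    then show ?thesis using v(1) by (simp add: c00_def LIMSEQ_imp_Cauchy[OF tendsto_const])
  next
    case False
    have "dist (v k i) (v l i) \<le> dist (w k) (w l)" for k l
      using coord_le_T[of "\<lambda>i. v k i - v l i" i] v(1) False diffT[of k l] by (simp add: dist_real_def)
    then show ?thesis using Cau unfolding Cauchy_def by (meson le_less_trans)
  qed
  then have "\<forall>i. \<exists>a. (\<lambda>k. v k i) \<longlonglongrightarrow> a" using Cauchy_convergent convergent_def by blast
  then obtain a where a: "\<And>i. (\<lambda>k. v k i) \<longlonglongrightarrow> a i" by metis
  have a0: "a 0 = 0" using a[of 0] v(1) by (simp add: c00_def LIMSEQ_const_iff)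
  have close: "norm (J (restr {..<n} (v k)) - J (restr {..<n} a)) \<le> e"
    if e: "\<And>l. l \<ge> k \<Longrightarrow> dist (w k) (w l) \<le> e" for n k e
  proof -
    have v0: "v l 0 = 0" for l using v(1) by (simp add: c00_def)
    have "(\<lambda>l. \<Sum>i<n. v l i *\<^sub>R J (unit_vec i)) \<longlonglongrightarrow> (\<Sum>i<n. a i *\<^sub>R J (unit_vec i))"
      by (intro tendsto_intros a)
    then have "(\<lambda>l. J (restr {..<n} (v l))) \<longlonglongrightarrow> J (restr {..<n} a)"
      using S a0 v0 by simp
    then have lim: "(\<lambda>l. norm (J (restr {..<n} (v k)) - J (restr {..<n} (v l)))) \<longlonglongrightarrow>
        norm (J (restr {..<n} (v k)) - J (restr {..<n} a))"
      by (intro tendsto_intros)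
    have "norm (J (restr {..<n} (v k)) - J (restr {..<n} (v l))) \<le> e" if "l \<ge> k" for l
    proof -
      have r: "restr {..<n} (\<lambda>i. v k i - v l i) = (\<lambda>i. restr {..<n} (v k) i - restr {..<n} (v l) i)"
        by (auto simp: restr_def)
      have "norm (J (restr {..<n} (v k)) - J (restr {..<n} (v l))) = T (restr {..<n} (\<lambda>i. v k i - v l i))"
        using v(1) by (subst Jn[symmetric]) (auto simp: r Jdiff)
      also have "\<dots> \<le> T (\<lambda>i. v k i - v l i)" using v(1) by (intro restr_le) auto
      also have "\<dots> \<le> e" using e[OF that] by (simp add: diffT)
      finally show ?thesis .
    qed
    then show ?thesis by (intro tendsto_upperbound[OF lim]) (auto simp: eventually_sequentially)
  qed
  have "(\<lambda>n. J (restr {..<n} a)) \<longlonglongrightarrow> y"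
  proof (rule LIMSEQ_I)
    fix e :: real assume "0 < e"
    then have e: "0 < e / 3" by simp
    obtain k0 where k0: "\<And>k l. k \<ge> k0 \<Longrightarrow> l \<ge> k0 \<Longrightarrow> dist (w k) (w l) < e / 3"
      using metric_CauchyD[OF Cau e] by blast
    obtain k1 where k1: "\<And>k. k \<ge> k1 \<Longrightarrow> norm (w k - y) < e / 3" using LIMSEQ_D[OF w(2) e] by blast
    define k where "k = max k0 k1"
    have fin: "finite (supp (v k))" using v(1) by (rule c00_finite)
    obtain n0 where n0: "supp (v k) \<subseteq> {..<n0}" using finite_nat_bounded[OF fin] by blast
    have "norm (J (restr {..<n} a) - y) < e" if n: "n \<ge> n0" for n
    proof -
      have "restr {..<n} (v k) = v k" using n0 n by (force simp: restr_def supp_def fun_eq_iff)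
      then have "norm (w k - J (restr {..<n} a)) \<le> e / 3"
        using close[of k "e / 3" n] k0 v(2) by (auto simp: k_def less_imp_le)
      moreover have "norm (w k - y) < e / 3" using k1 by (simp add: k_def)
      moreover have "norm (J (restr {..<n} a) - y) \<le> norm (w k - J (restr {..<n} a)) + norm (w k - y)"
        unfolding dist_norm[symmetric] by (rule dist_triangle3)
      ultimately show ?thesis using \<open>0 < e\<close> by linarith
    qed
    then show "\<exists>n0. \<forall>n\<ge>n0. norm (J (restr {..<n} a) - y) < e" by blast
  qed
  then have "(\<lambda>i. a i *\<^sub>R J (unit_vec i)) sums y" using S[of a, OF a0] by (simp add: sums_def)
  then show ?thesis using a0 uniq by blast
qed

end

lemma singleton_in_schreier: "1 \<le> m \<Longrightarrow> {m} \<in> schreier n"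
proof (induction n)
  case (Suc n)
  then show ?case by (auto intro!: exI[of _ "[{m}]"])
qed auto

lemma regular_seq_mixed_Tsirelson_data:
  assumes "regular_seq \<theta>" shows "mixed_Tsirelson_data schreier \<theta> (\<theta> 1)"
proof
  show "\<exists>E. admissible (schreier k) E" for k
    using singleton_in_schreier[of 1 k] by (intro exI[of _ "[{1}]"]) (simp add: admissible_def)
qed (use assms in \<open>auto simp: regular_seq_def\<close>)

end

theory Submission
  imports Defs
begin

text \<open>
  The norm is \<open>1\<close>-unconditional, so it suffices to find disjoint vectors of norm at least one whose
  sum has norm at most \<open>1 + \<epsilon>\<close>. By James' argument for \<open>\<ell>\<^sub>\<infinity>\<close> this follows if, for every \<open>p\<close>, some \<open>p\<close>
  such vectors have a sum of norm at most a constant \<open>D\<close> that does not depend on \<open>p\<close>. They are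
  constructed by induction on \<open>p\<close>: given \<open>p\<close>-tuples far out, one takes an average of order \<open>j\<close> of the
  tuples, interlaced with an average of order \<open>j\<close>, divided by roughly \<open>\<theta>\<^sub>j\<close>, of a rapidly increasing sequence
  of flat vectors. A functional of weight \<open>\<theta>\<^sub>k\<close> with \<open>k\<close> large does not see the new vector, and
  one with \<open>k\<close> small splits the tuples cheaply and hence loses a factor \<open>\<theta>\<^sub>1\<close> on them, so that
  \<open>D = 10 / (1 - \<theta>\<^sub>1)\<close>, the solution of \<open>D = 10 + \<theta>\<^sub>1 D\<close>, is preserved. The condition
  \<open>\<theta>\<^sub>n\<^sup>1\<^sup>/\<^sup>n \<longlonglongrightarrow> 1\<close> enters twice: it yields the flat vectors (James' argument for \<open>\<ell>\<^sub>1\<close>), and orders \<open>j\<close>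
  at which \<open>\<theta>\<close> varies by a factor of at most two over a window of prescribed length.
\<close>

section \<open>Schreier families\<close>

text \<open>The obstacle is that each new vector must withstand two kinds of operations. It is an
  average of order \<open>j\<close>, but averages of total order \<open>Q\<close> are still to
  follow, so only the weight \<theta> at \<open>j + Q\<close> is available for keeping its norm at
  least one. The flatness of the whole tuple is tested by families of order \<open>K\<close>, whose
  intervals contain averages of order \<open>j - K\<close> only, so from above the weight at
  \<open>j - K\<close> counts. Hence the window from \<open>j - K\<close> to \<open>j + Q\<close>.
  It also dictates the recursion: \<open>j\<close> is fixed first, from \<open>K\<close> and
  \<open>Q\<close>, and only then the old tuples are requested, with offset \<open>Q + j\<close> and
  flat up to an order beyond which all weights are negligible against \<theta> at
  \<open>j + Q\<close>. The constant 10 is 5 times the factor two lost on the window. Of the 5, a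
  flat vector accounts for 4: the pieces of an average of vectors of norm at most one add up to at
  most 2, and doubling brings its norm up to one. The remaining 1 is the error caused by members of
  the rapidly increasing sequence that precede the critical one.\<close>

definition before :: "nat set \<Rightarrow> nat set \<Rightarrow> bool" where
  "before A B \<longleftrightarrow> (\<forall>a\<in>A. \<forall>b\<in>B. a < b)"

lemma schreier_finite: "A \<in> schreier n \<Longrightarrow> finite A"
  by (induction n arbitrary: A) auto

lemma schreier_empty [simp]: "{} \<in> schreier n"
  by (cases n) auto

lemma schreier_pos: "A \<in> schreier n \<Longrightarrow> a \<in> A \<Longrightarrow> 1 \<le> a"
proof (induction n arbitrary: A)
  case (Suc n)
  then show ?case by auto
qed auto

lemma block_less_iff_before:
  "finite A \<Longrightarrow> finite B \<Longrightarrow> A \<noteq> {} \<Longrightarrow> B \<noteq> {} \<Longrightarrow> block_less A B \<longleftrightarrow> before A B"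
  by (auto simp: block_less_def before_def)

text \<open>With empty pieces allowed and their number bounded by every element of the union, the
  description survives intersecting or moving the pieces, so heredity, spreading and composition can
  be proved piece by piece. In the converse direction empty pieces are filtered out, which can only
  shorten the list.\<close>

lemma schreier_Suc_iff:
  "A \<in> schreier (Suc n) \<longleftrightarrow> (\<exists>As. A = \<Union>(set As) \<and> set As \<subseteq> schreier n \<and>
     sorted_wrt before As \<and> (\<forall>a\<in>A. length As \<le> a))" (is "?L \<longleftrightarrow> ?R")
proof
  assume ?L
  show ?R
  proof (cases "A = {}")
    case True
    then show ?thesis by (intro exI[of _ "[]"]) auto
  next
    case False
    with \<open>?L\<close> obtain As where As: "A = \<Union>(set As)" "As \<noteq> []" "set As \<subseteq> schreier n"
      "{} \<notin> set As" "sorted_wrt block_less As" "length As \<le> Min (hd As)"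
      by auto
    have fin: "finite B" "B \<noteq> {}" if "B \<in> set As" for B
      using As that schreier_finite by auto
    have s: "sorted_wrt before As"
      using As(5) by (rule sorted_wrt_mono_rel[rotated]) (use fin block_less_iff_before in auto)
    have "length As \<le> a" if aA: "a \<in> A" for a
    proof -
      obtain B Bs where Bs: "As = B # Bs" using As(2) by (cases As) auto
      have "Min B \<le> a"
      proof (cases "a \<in> B")
        case True then show ?thesis using fin(1)[of B] Bs by auto
      next
        case False
        then obtain C where C: "C \<in> set Bs" "a \<in> C" using aA As(1) unfolding Bs by auto
        have "Min B \<in> B" using fin[of B] Bs by auto
        then show ?thesis using s C unfolding Bs before_def by fastforce
      qed
      then show ?thesis using As(6) Bs by simp
    qed
    then show ?thesis using As s by blast
  qed
next
  assume ?R
  then obtain As where As: "A = \<Union>(set As)" "set As \<subseteq> schreier n"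
    "sorted_wrt before As" "\<forall>a\<in>A. length As \<le> a" by blast
  show ?L
  proof (cases "A = {}")
    case False
    define Bs where "Bs = filter (\<lambda>B. B \<noteq> {}) As"
    have Bs: "A = \<Union>(set Bs)" "set Bs \<subseteq> schreier n" "{} \<notin> set Bs" using As by (auto simp: Bs_def)
    have ne: "Bs \<noteq> []" using False Bs by auto
    have fin: "finite B" "B \<noteq> {}" if "B \<in> set Bs" for B
      using Bs that schreier_finite by auto
    have "sorted_wrt before Bs" unfolding Bs_def using As(3) by (rule sorted_wrt_filter)
    then have s: "sorted_wrt block_less Bs"
      by (rule sorted_wrt_mono_rel[rotated]) (use fin block_less_iff_before in auto)
    have h: "hd Bs \<in> set Bs" using ne by simp
    have "Min (hd Bs) \<in> A" using fin[OF h] Bs(1) h by (meson Min_in UnionI)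
    then have "length As \<le> Min (hd Bs)" using As by blast
    moreover have "length Bs \<le> length As" by (simp add: Bs_def)
    ultimately show ?thesis using Bs ne s by auto
  qed simp
qed

lemma schreier_SucE:
  assumes "A \<in> schreier (Suc n)"
  obtains As where "A = \<Union>(set As)" "set As \<subseteq> schreier n"
    "sorted_wrt before As" "\<forall>a\<in>A. length As \<le> a"
  using assms[unfolded schreier_Suc_iff] by (elim exE conjE)

lemma schreier_mono_Suc: "A \<in> schreier n \<Longrightarrow> A \<in> schreier (Suc n)"
  unfolding schreier_Suc_iff using schreier_pos[of A n] by (intro exI[of _ "[A]"]) auto

lemma schreier_mono: "m \<le> n \<Longrightarrow> A \<in> schreier m \<Longrightarrow> A \<in> schreier n"
  by (induction n rule: dec_induct) (auto intro: schreier_mono_Suc simp del: schreier.simps)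

lemma schreier_subset: "A \<in> schreier n \<Longrightarrow> B \<subseteq> A \<Longrightarrow> B \<in> schreier n"
proof (induction n arbitrary: A B)
  case 0
  then show ?case by auto
next
  case (Suc n)
  obtain As where As: "A = \<Union>(set As)" "set As \<subseteq> schreier n"
    "sorted_wrt before As" "\<forall>a\<in>A. length As \<le> a" by (rule schreier_SucE[OF Suc.prems(1)])
  have "sorted_wrt before (map ((\<inter>) B) As)" unfolding sorted_wrt_map
    using As(3) by (rule sorted_wrt_mono_rel[rotated]) (auto simp: before_def)
  moreover have "set (map ((\<inter>) B) As) \<subseteq> schreier n" using Suc.IH As(2) by auto
  moreover have "B = \<Union>(set (map ((\<inter>) B) As))" using As(1) Suc.prems(2) by auto
  moreover have "\<forall>a\<in>B. length (map ((\<inter>) B) As) \<le> a" using As(4) Suc.prems(2) by auto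
  ultimately show ?case unfolding schreier_Suc_iff by blast
qed

text \<open>Two maps on a common index set, instead of two sets, let the induction restrict
  \<open>G\<close> to the indices that \<open>f\<close> sends into one piece. Moving points to the
  right keeps the bound on the number of pieces.\<close>

lemma schreier_spread:
  fixes G :: "nat set"
  assumes "f ` G \<in> schreier n" "strict_mono_on G f" "strict_mono_on G g" "\<And>s. s \<in> G \<Longrightarrow> f s \<le> g s"
  shows "g ` G \<in> schreier n"
  using assms
proof (induction n arbitrary: G)
  case 0
  then have "f ` G = {} \<or> (\<exists>a\<ge>1. f ` G = {a})" by auto
  then show ?case
  proof
    assume "\<exists>a\<ge>1. f ` G = {a}"
    then obtain a where a: "1 \<le> a" "f ` G = {a}" by blast
    then have "a \<in> f ` G" by simp
    then obtain s where s: "s \<in> G" "f s = a" by (elim imageE) simp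
    have "inj_on f G" using 0(2) by (rule strict_mono_on_imp_inj_on)
    then have "G = {s}" using a s by (auto simp: inj_on_def)
    then show ?thesis using 0(4)[of s] a s by auto
  qed simp
next
  case (Suc n)
  obtain As where As: "f ` G = \<Union>(set As)" "set As \<subseteq> schreier n"
    "sorted_wrt before As" "\<forall>a\<in>f ` G. length As \<le> a"
    by (rule schreier_SucE[OF Suc.prems(1)])
  let ?h = "\<lambda>A. g ` {s\<in>G. f s \<in> A}"
  have "?h A \<in> schreier n" if "A \<in> set As" for A
  proof (rule Suc.IH)
    show "f ` {s \<in> G. f s \<in> A} \<in> schreier n"
      by (rule schreier_subset[of A]) (use that As in auto)
  qed (use Suc.prems in \<open>auto simp: strict_mono_on_def\<close>)
  moreover have "sorted_wrt before (map ?h As)" unfolding sorted_wrt_map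
    using As(3)
  proof (rule sorted_wrt_mono_rel[rotated])
    fix A B assume "before A B"
    then show "before (?h A) (?h B)"
      using Suc.prems(2,3) unfolding before_def strict_mono_on_def
      by clarsimp (metis linorder_neqE_nat not_less_iff_gr_or_eq)
  qed
  moreover have "g ` G = \<Union>(set (map ?h As))" using As(1) by auto
  moreover have "\<forall>a\<in>g ` G. length (map ?h As) \<le> a"
    using As(4) Suc.prems(4) by (auto intro: order_trans)
  ultimately show ?case unfolding schreier_Suc_iff by (intro exI[of _ "map ?h As"]) auto
qed

text \<open>Orders add: the pieces of \<open>L\<close> group the sets \<open>P l\<close>, and since
  \<open>P l\<close> lies to the right of \<open>l\<close>, the bound on the number of pieces passes
  from \<open>L\<close> to the union.\<close>

lemma schreier_compose:
  assumes "L \<in> schreier n" "\<And>l. l \<in> L \<Longrightarrow> P l \<in> schreier m" "\<And>l x. l \<in> L \<Longrightarrow> x \<in> P l \<Longrightarrow> l \<le> x"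
    "\<And>l l' x. l \<in> L \<Longrightarrow> l' \<in> L \<Longrightarrow> l < l' \<Longrightarrow> x \<in> P l \<Longrightarrow> x < l'"
  shows "(\<Union>l\<in>L. P l) \<in> schreier (n + m)"
  using assms
proof (induction n arbitrary: L)
  case 0
  then show ?case by auto
next
  case (Suc n)
  obtain As where As: "L = \<Union>(set As)" "set As \<subseteq> schreier n"
    "sorted_wrt before As" "\<forall>a\<in>L. length As \<le> a"
    by (rule schreier_SucE[OF Suc.prems(1)])
  let ?h = "\<lambda>A. \<Union>l\<in>A. P l"
  have "?h A \<in> schreier (n + m)" if "A \<in> set As" for A
  proof (rule Suc.IH)
    show "A \<in> schreier n" using As that by auto
    have s: "A \<subseteq> L" using that As by auto
    show "P l \<in> schreier m" if "l \<in> A" for l using Suc.prems(2) s that by blast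
    show "l \<le> x" if "l \<in> A" "x \<in> P l" for l x using Suc.prems(3) s that by blast
    show "x < l'" if "l \<in> A" "l' \<in> A" "l < l'" "x \<in> P l" for l l' x using Suc.prems(4) s that by blast
  qed
  moreover have "sorted_wrt before (map ?h As)" unfolding sorted_wrt_map
    using As(3)
  proof (rule sorted_wrt_mono_rel[rotated])
    fix A B assume AB: "A \<in> set As" "B \<in> set As" "before A B"
    show "before (?h A) (?h B)"
      unfolding before_def
    proof clarify
      fix x y l l' assume "l \<in> A" "l' \<in> B" and x: "x \<in> P l" and y: "y \<in> P l'"
      then have "l \<in> L" "l' \<in> L" "l < l'" using AB As(1) by (auto simp: before_def)
      then show "x < y" using Suc.prems(3)[of l' y] Suc.prems(4)[of l l' x] x y by force
    qed
  qed
  moreover have "(\<Union>l\<in>L. P l) = \<Union>(set (map ?h As))" using As(1) by auto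
  moreover have "\<forall>a\<in>\<Union>l\<in>L. P l. length (map ?h As) \<le> a"
    using As(4) Suc.prems(3) by (auto intro: order_trans)
  ultimately show ?case unfolding add_Suc schreier_Suc_iff by (intro exI[of _ "map ?h As"]) auto
qed

section \<open>Admissible families of intervals\<close>

text \<open>Admissible families of intervals \<open>{l..u l}\<close>, indexed by their left ends \<open>l \<in> L\<close>.\<close>

definition adm :: "nat \<Rightarrow> nat set \<Rightarrow> (nat \<Rightarrow> nat) \<Rightarrow> bool" where
  "adm k L u \<longleftrightarrow> L \<in> schreier k \<and> (\<forall>l\<in>L. l \<le> u l) \<and> (\<forall>l\<in>L. \<forall>l'\<in>L. l < l' \<longrightarrow> u l < l')"

definition comb :: "nat set \<Rightarrow> (nat \<Rightarrow> real) \<Rightarrow> (nat \<Rightarrow> nat \<Rightarrow> real) \<Rightarrow> nat \<Rightarrow> real" where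
  "comb S a w = (\<lambda>i. \<Sum>s\<in>S. a s * w s i)"

lemma adm_finite: "adm k L u \<Longrightarrow> finite L"
  by (auto simp: adm_def schreier_finite)

lemma adm_mono: "k \<le> k' \<Longrightarrow> adm k L u \<Longrightarrow> adm k' L u"
  using schreier_mono by (auto simp: adm_def)

lemma adm_disjoint:
  assumes "adm k L u" "l \<in> L" "l' \<in> L" "l \<noteq> l'"
  shows "{l..u l} \<inter> {l'..u l'} = {}"
  using assms unfolding adm_def by (cases l l' rule: linorder_cases) fastforce+

lemma comb_c00 [intro]:
  assumes "finite S" "\<And>s. s \<in> S \<Longrightarrow> w s \<in> c00" shows "comb S a w \<in> c00"
  using assms
proof (induction S rule: finite_induct)
  case empty
  then show ?case by (simp add: comb_def)
next
  case (insert s S)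
  then show ?case using c00_add[OF c00_scale[of "w s" "a s"], of "comb S a w"]
    by (simp add: comb_def)
qed

lemma restr_comb: "restr A (comb S a w) = comb S a (\<lambda>s. restr A (w s))"
  by (auto simp: restr_def comb_def fun_eq_iff)

lemma supp_comb: "supp (comb S a w) \<subseteq> (\<Union>s\<in>S. supp (w s))"
proof
  fix i assume "i \<in> supp (comb S a w)"
  then obtain s where "s \<in> S" "a s * w s i \<noteq> 0"
    unfolding supp_def comb_def by (auto elim: sum.not_neutral_contains_not_neutral)
  then show "i \<in> (\<Union>s\<in>S. supp (w s))" by (auto simp: supp_def)
qed

lemma restr_ident: "supp x \<subseteq> A \<Longrightarrow> restr A x = x"
  by (auto simp: restr_def supp_def fun_eq_iff)

lemma restr_zero: "supp x \<inter> A = {} \<Longrightarrow> restr A x = (\<lambda>_. 0)"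
  by (auto simp: restr_def supp_def fun_eq_iff)

locale subexponential_Tsirelson =
  fixes \<theta> :: "nat \<Rightarrow> real"
  assumes regular: "regular_seq \<theta>" and root_lim: "(\<lambda>n. root n (\<theta> n)) \<longlonglongrightarrow> 1"

sublocale subexponential_Tsirelson \<subseteq> mixed_Tsirelson_data schreier \<theta> "\<theta> 1"
  by (rule regular_seq_mixed_Tsirelson_data[OF regular])

section \<open>Unconditionality of the norm and its evaluation by intervals\<close>

context subexponential_Tsirelson
begin

lemma theta_pos: "1 \<le> n \<Longrightarrow> 0 < \<theta> n"
  and theta_less_1: "1 \<le> n \<Longrightarrow> \<theta> n < 1"
  and theta_antimono: "1 \<le> m \<Longrightarrow> m \<le> n \<Longrightarrow> \<theta> n \<le> \<theta> m"
  and theta_lim: "\<theta> \<longlonglongrightarrow> 0"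
  and theta_mult: "1 \<le> n \<Longrightarrow> 1 \<le> m \<Longrightarrow> \<theta> n * \<theta> m \<le> \<theta> (n + m)"
  using regular by (auto simp: regular_seq_def)

lemma T_nonneg: "x \<in> c00 \<Longrightarrow> 0 \<le> T x"
  and T_zero [simp]: "T (\<lambda>_. 0) = 0"
  and T_scale: "x \<in> c00 \<Longrightarrow> T (\<lambda>i. c * x i) = \<bar>c\<bar> * T x"
  and T_add: "x \<in> c00 \<Longrightarrow> y \<in> c00 \<Longrightarrow> T (\<lambda>i. x i + y i) \<le> T x + T y"
  using norm_on_c00_T c00_zero by (auto simp: norm_on_c00_def)

lemma T_comb:
  assumes "finite S" "\<And>s. s \<in> S \<Longrightarrow> w s \<in> c00"
  shows "T (comb S a w) \<le> (\<Sum>s\<in>S. \<bar>a s\<bar> * T (w s))"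
  using assms
proof (induction S rule: finite_induct)
  case empty
  then show ?case by (simp add: comb_def)
next
  case (insert s S)
  have "T (comb (insert s S) a w) \<le> T (\<lambda>i. a s * w s i) + T (comb S a w)"
    using T_add[of "\<lambda>i. a s * w s i" "comb S a w"] insert by (simp add: comb_def comb_c00[unfolded comb_def])
  then show ?case using insert by (simp add: T_scale)
qed

text \<open>Sign changes of coordinates commute with restricting and combining functionals; this is
  the source of 1-unconditionality.\<close>

lemma norming_signs: "f \<in> norming \<Longrightarrow> (\<And>j. \<bar>s j\<bar> = 1) \<Longrightarrow> (\<lambda>j. s j * f j) \<in> norming"
proof (induction rule: norming.induct)
  case (unit i r)
  have "(\<lambda>j. s j * (r * unit_vec i j)) = (\<lambda>j. (s i * r) * unit_vec i j)"
    by (auto simp: unit_vec_def)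
  then show ?case using unit norming.unit[of i "s i * r"] by (simp add: abs_mult)
next
  case (comb k E g)
  have e: "s j * (\<theta> k * (\<Sum>A\<leftarrow>E. restr A (g A) j)) = \<theta> k * (\<Sum>A\<leftarrow>E. restr A (\<lambda>j. s j * g A j) j)" for j
  proof -
    have "(\<Sum>A\<leftarrow>E. restr A (\<lambda>j. s j * g A j) j) = s j * (\<Sum>A\<leftarrow>E. restr A (g A) j)"
      by (induction E) (auto simp: restr_def algebra_simps)
    then show ?thesis by simp
  qed
  then show ?case using norming.comb[of k E "\<lambda>A j. s j * g A j"] comb unfolding e by blast
qed

text \<open>The signs \<open>s\<close> make every term \<open>s i * f i * y i\<close> equal to its
  absolute value. The functional so altered is still norming and dominates the pairing of
  \<open>f\<close> with \<open>x\<close> term by term.\<close>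

lemma T_mono:
  assumes xy: "x \<in> c00" "y \<in> c00" and le: "\<And>i. \<bar>x i\<bar> \<le> \<bar>y i\<bar>"
  shows "T x \<le> T y"
  unfolding T_le_iff[OF xy(1)]
proof
  fix f assume f: "f \<in> norming"
  define s where "s j = (if 0 \<le> f j * y j then 1 else - 1 :: real)" for j
  have g: "(\<lambda>j. s j * f j) \<in> norming" by (rule norming_signs[OF f]) (auto simp: s_def)
  have sub: "supp x \<subseteq> supp y"
  proof
    fix i assume "i \<in> supp x" then show "i \<in> supp y" using le[of i] by (auto simp: supp_def)
  qed
  have "\<bar>pair f x\<bar> \<le> (\<Sum>i\<in>supp y. \<bar>f i * x i\<bar>)"
    using pair_superset[OF c00_finite[OF xy(2)] sub, of f] by simp
  also have "\<dots> \<le> (\<Sum>i\<in>supp y. s i * f i * y i)"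
  proof (rule sum_mono)
    fix i
    have "\<bar>f i * x i\<bar> \<le> \<bar>f i * y i\<bar>" using le[of i] by (simp add: abs_mult mult_left_mono)
    then show "\<bar>f i * x i\<bar> \<le> s i * f i * y i" by (auto simp: s_def)
  qed
  also have "\<dots> = pair (\<lambda>j. s j * f j) y" by (simp add: pair_def)
  also have "\<dots> \<le> T y" using pair_le_T[OF xy(2) g] by simp
  finally show "\<bar>pair f x\<bar> \<le> T y" .
qed

lemma T_restr_mono: "x \<in> c00 \<Longrightarrow> A \<subseteq> B \<Longrightarrow> T (restr A x) \<le> T (restr B x)"
  by (rule T_mono) (simp_all, auto simp: restr_def)

lemma T_le_l1:
  assumes "finite F" "supp x \<subseteq> F" "0 \<notin> F" shows "T x \<le> (\<Sum>i\<in>F. \<bar>x i\<bar>)"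
proof -
  have x: "x \<in> c00" using assms by (auto simp: c00_def supp_def intro: finite_subset)
  show ?thesis unfolding T_le_iff[OF x]
  proof
    fix f assume f: "f \<in> norming"
    have "\<bar>pair f x\<bar> \<le> (\<Sum>i\<in>F. \<bar>f i * x i\<bar>)"
      using pair_superset[OF assms(1,2), of f] by simp
    also have "\<dots> \<le> (\<Sum>i\<in>F. \<bar>x i\<bar>)"
    proof (rule sum_mono)
      fix i show "\<bar>f i * x i\<bar> \<le> \<bar>x i\<bar>"
        using mult_right_mono[OF norming_le_1[OF f, of i], of "\<bar>x i\<bar>"] by (simp add: abs_mult)
    qed
    finally show "\<bar>pair f x\<bar> \<le> (\<Sum>i\<in>F. \<bar>x i\<bar>)" .
  qed
qed

lemma T_adm:
  assumes x: "x \<in> c00" and k: "1 \<le> k" and a: "adm k L u"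
  shows "\<theta> k * (\<Sum>l\<in>L. T (restr {l..u l} x)) \<le> T x"
proof (cases "L = {}")
  case True
  then show ?thesis using T_nonneg[OF x] by simp
next
  case False
  let ?I = "\<lambda>l. {l..u l}"
  let ?xs = "sorted_list_of_set L"
  have fin: "finite L" using a by (rule adm_finite)
  have ne: "l \<le> u l" "1 \<le> l" if "l \<in> L" for l
    using a that schreier_pos by (auto simp: adm_def)
  have "admissible (schreier k) (map ?I ?xs)"
    unfolding admissible_def
  proof (intro conjI)
    show "map ?I ?xs \<noteq> []" using False fin by simp
    show "\<forall>A\<in>set (map ?I ?xs). finite A \<and> A \<noteq> {} \<and> A \<subseteq> {1..}"
      using ne fin by fastforce
    show "sorted_wrt block_less (map ?I ?xs)"
      unfolding sorted_wrt_map
    proof (rule sorted_wrt_mono_rel[of _ "(<)"])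
      show "sorted_wrt (<) ?xs" by (rule strict_sorted_list_of_set)
      fix l l' assume l: "l \<in> set ?xs" "l' \<in> set ?xs" "l < l'"
      then have "u l < l'" using a fin by (auto simp: adm_def)
      then show "block_less (?I l) (?I l')" using l ne fin by (auto simp: block_less_def)
    qed
    have "Min (?I l) = l" if "l \<in> L" for l using ne[OF that] by (intro Min_eqI) auto
    then have "Min ` set (map ?I ?xs) = L" using fin by (simp add: image_image)
    then show "Min ` set (map ?I ?xs) \<in> schreier k" using a by (simp add: adm_def)
  qed
  then have "\<theta> k * (\<Sum>A\<leftarrow>map ?I ?xs. T (restr A x)) \<le> T x"
    using is_mixed_T x k is_mixed_iff[OF norm_on_c00_T] by blast
  also have "(\<Sum>A\<leftarrow>map ?I ?xs. T (restr A x)) = (\<Sum>l\<in>L. T (restr (?I l) x))"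
    using fin by (simp add: comp_def sum_list_distinct_conv_sum_set)
  finally show ?thesis .
qed

text \<open>By monotonicity of the norm the sets of an admissible family may be enlarged to intervals.\<close>

lemma T_leI:
  assumes x: "x \<in> c00" and coord: "\<And>i. \<bar>x i\<bar> \<le> C"
    and adm: "\<And>k L u. 1 \<le> k \<Longrightarrow> adm k L u \<Longrightarrow> \<theta> k * (\<Sum>l\<in>L. T (restr {l..u l} x)) \<le> C"
  shows "T x \<le> C"
proof -
  have "\<theta> k * (\<Sum>A\<leftarrow>E. T (restr A x)) \<le> C" if k: "1 \<le> k" and E: "admissible (schreier k) E" for k E
  proof -
    have nE: "finite A" "A \<noteq> {}" "A \<subseteq> {1..}" if "A \<in> set E" for A
      using E that by (auto simp: admissible_def)
    have s: "sorted_wrt before E" using E unfolding admissible_def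
      by (elim conjE, elim sorted_wrt_mono_rel[rotated]) (use nE block_less_iff_before in auto)
    have ord: "A = B \<or> before A B \<or> before B A" if "A \<in> set E" "B \<in> set E" for A B
      using s that by (induction E) auto
    have dis: "distinct E" using s nE(2)
    proof (induction E)
      case (Cons A E)
      have "A \<notin> set E"
      proof
        assume "A \<in> set E"
        then have "before A A" using Cons.prems by auto
        moreover have "A \<noteq> {}" using Cons.prems by auto
        ultimately show False by (auto simp: before_def)
      qed
      then show ?case using Cons by auto
    qed simp
    have inj: "inj_on Min (set E)"
    proof (rule inj_onI, rule ccontr)
      fix A B assume AB: "A \<in> set E" "B \<in> set E" "Min A = Min B" "A \<noteq> B"
      have "Min A \<in> A" "Min B \<in> B" using AB(1,2) nE by (blast intro: Min_in)+
      then show False using ord[OF AB(1,2)] AB(3,4) by (auto simp: before_def)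
    qed
    \<comment> \<open>A member of \<open>E\<close> can be recovered from its minimum, because the
      members are nonempty and successive.\<close>
    define L where "L = Min ` set E"
    define u where "u l = Max (the_inv_into (set E) Min l)" for l
    have u: "u (Min A) = Max A" if "A \<in> set E" for A
      using inj that by (simp add: u_def the_inv_into_f_f)
    have "adm k L u"
      unfolding adm_def
    proof (intro conjI ballI impI)
      show "L \<in> schreier k" using E by (simp add: L_def admissible_def)
      show "l \<le> u l" if "l \<in> L" for l using that nE u by (auto simp: L_def)
      fix l l' assume l: "l \<in> L" "l' \<in> L" "l < l'"
      then obtain A B where AB: "A \<in> set E" "B \<in> set E" "l = Min A" "l' = Min B" by (auto simp: L_def)
      have m: "Min A \<in> A" "Min B \<in> B" "Max A \<in> A"
        using AB(1,2) nE by (blast intro: Min_in Max_in)+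
      have "before A B" using ord[OF AB(1,2)] l(3) m AB(3,4)
        by (metis before_def less_asym less_irrefl)
      then show "u l < l'" using m AB u by (auto simp: before_def)
    qed
    then have "\<theta> k * (\<Sum>l\<in>L. T (restr {l..u l} x)) \<le> C" by (rule adm[OF k])
    moreover have "(\<Sum>A\<leftarrow>E. T (restr A x)) \<le> (\<Sum>l\<in>L. T (restr {l..u l} x))"
    proof -
      have "(\<Sum>A\<leftarrow>E. T (restr A x)) = (\<Sum>A\<in>set E. T (restr A x))"
        by (rule sum_list_distinct_conv_sum_set[OF dis])
      also have "\<dots> \<le> (\<Sum>A\<in>set E. T (restr {Min A..u (Min A)} x))"
        by (intro sum_mono T_restr_mono[OF x]) (use u nE in auto)
      also have "\<dots> = (\<Sum>l\<in>L. T (restr {l..u l} x))"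
        unfolding L_def using inj by (simp add: sum.reindex)
      finally show ?thesis .
    qed
    ultimately show ?thesis using theta_pos[OF k] by (meson less_imp_le mult_left_mono order_trans)
  qed
  then show ?thesis using is_mixed_T x coord is_mixed_iff[OF norm_on_c00_T] by blast
qed

text \<open>The pieces are added without the weight. A bound on the norm alone only controls such a
  sum by \<open>T x / \<theta> k\<close>, so a \<open>C\<close> comparable to the norm is a genuine
  restriction: weights of index at most \<open>k\<close> act on a flat vector with their full
  smallness.\<close>

definition flat :: "nat \<Rightarrow> real \<Rightarrow> (nat \<Rightarrow> real) \<Rightarrow> bool" where
  "flat k C x \<longleftrightarrow> (\<forall>L u. adm k L u \<longrightarrow> (\<Sum>l\<in>L. T (restr {l..u l} x)) \<le> C)"

lemma flat_mono: "k' \<le> k \<Longrightarrow> C \<le> C' \<Longrightarrow> flat k C x \<Longrightarrow> flat k' C' x"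
  unfolding flat_def using adm_mono by (meson order_trans)

lemma flat_norm:
  assumes "flat k C x" "x \<in> c00" shows "T x \<le> C"
proof -
  obtain n where n: "supp x \<subseteq> {..<n}" using finite_nat_bounded[OF c00_finite[OF assms(2)]] by blast
  \<comment> \<open>A single long interval is admissible at every order.\<close>
  have "adm k {1} (\<lambda>_. Suc n)" by (simp add: adm_def singleton_in_schreier)
  then have "T (restr {1..Suc n} x) \<le> C" using assms(1) unfolding flat_def by fastforce
  moreover have "supp x \<subseteq> {1..Suc n}"
    using n assms(2) by (fastforce simp: supp_def c00_def Suc_le_eq intro: gr0I)
  ultimately show ?thesis by (simp add: restr_ident)
qed

lemma flatD: "flat k C x \<Longrightarrow> adm k L u \<Longrightarrow> (\<Sum>l\<in>L. T (restr {l..u l} x)) \<le> C"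
  by (auto simp: flat_def)

text \<open>A crude bound whose merit is its independence of the order \<open>k\<close>; it controls
  those members of a rapidly increasing sequence that come before the critical one.\<close>

lemma adm_sum_le_l1:
  assumes "adm k L u" "finite F" "supp x \<subseteq> F" "0 \<notin> F"
  shows "(\<Sum>l\<in>L. T (restr {l..u l} x)) \<le> (\<Sum>i\<in>F. \<bar>x i\<bar>)"
proof -
  have "(\<Sum>l\<in>L. T (restr {l..u l} x)) \<le> (\<Sum>l\<in>L. \<Sum>i\<in>F \<inter> {l..u l}. \<bar>x i\<bar>)"
  proof (rule sum_mono)
    fix l
    have "T (restr {l..u l} x) \<le> (\<Sum>i\<in>F \<inter> {l..u l}. \<bar>restr {l..u l} x i\<bar>)"
      by (rule T_le_l1) (use assms in \<open>auto simp: supp_def restr_def\<close>)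
    also have "\<dots> = (\<Sum>i\<in>F \<inter> {l..u l}. \<bar>x i\<bar>)" by (intro sum.cong) (auto simp: restr_def)
    finally show "T (restr {l..u l} x) \<le> \<dots>" .
  qed
  also have "\<dots> = (\<Sum>i\<in>(\<Union>l\<in>L. F \<inter> {l..u l}). \<bar>x i\<bar>)"
    using adm_disjoint[OF assms(1)] assms(2) adm_finite[OF assms(1)]
    by (intro sum.UNION_disjoint[symmetric]) blast+
  also have "\<dots> \<le> (\<Sum>i\<in>F. \<bar>x i\<bar>)" using assms(2) by (intro sum_mono2) auto
  finally show ?thesis .
qed

end

section \<open>Special convex combinations\<close>

lemma sum_le_of_finite_partition:
  fixes a :: "nat \<Rightarrow> real"
  assumes "finite S" "finite L" "\<And>l. l \<in> L \<Longrightarrow> G l \<subseteq> S" "disjoint_family_on G L" "\<And>s. 0 \<le> a s"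
  shows "(\<Sum>l\<in>L. sum a (G l)) \<le> sum a S"
proof -
  have "(\<Sum>l\<in>L. sum a (G l)) = sum a (\<Union>l\<in>L. G l)"
    using assms by (intro sum.UNION_disjoint_family[symmetric]) (auto intro: finite_subset)
  also have "\<dots> \<le> sum a S" using assms by (intro sum_mono2) auto
  finally show ?thesis .
qed

lemma sum_Un_le:
  fixes a :: "nat \<Rightarrow> real"
  assumes "finite A" "finite B" "\<And>s. 0 \<le> a s" shows "sum a (A \<union> B) \<le> sum a A + sum a B"
proof -
  have "0 \<le> sum a (A \<inter> B)" by (intro sum_nonneg assms(3))
  then show ?thesis using sum.union_inter[OF assms(1,2), of a] by linarith
qed

lemma sum_UNION_le:
  fixes a :: "nat \<Rightarrow> real"
  assumes "finite I" "\<And>i. i \<in> I \<Longrightarrow> finite (A i)" "\<And>s. 0 \<le> a s"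
  shows "sum a (\<Union>i\<in>I. A i) \<le> (\<Sum>i\<in>I. sum a (A i))"
  using assms(1,2)
proof (induction I rule: finite_induct)
  case (insert i I)
  then have "sum a (A i \<union> (\<Union>i\<in>I. A i)) \<le> sum a (A i) + sum a (\<Union>i\<in>I. A i)"
    by (intro sum_Un_le assms(3)) auto
  then show ?case using insert by auto
qed simp

text \<open>The intervals between consecutive members of a strictly increasing sequence carry the
  blocks; \<open>m (Suc s)\<close> is the right end of the \<open>s\<close>-th one.\<close>

theorem special_convex_combination:
  fixes m :: "nat \<Rightarrow> nat" and \<epsilon> :: real
  assumes m: "strict_mono m" and "0 < \<epsilon>"
  shows "\<exists>S a. finite S \<and> S \<noteq> {} \<and> S \<subseteq> {s0..} \<and> (\<forall>s. 0 \<le> a s) \<and> (\<forall>s. s \<notin> S \<longrightarrow> a s = 0) \<and> sum a S = 1 \<and>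
     m ` S \<in> schreier (Suc n) \<and>
     (\<forall>G\<subseteq>S. (\<lambda>s. m (Suc s)) ` G \<in> schreier n \<longrightarrow> sum a G \<le> \<epsilon>)"
  using \<open>0 < \<epsilon>\<close>
proof (induction n arbitrary: s0 \<epsilon>)
  case 0
  obtain r :: nat where r: "1 / \<epsilon> \<le> r" "1 \<le> r"
    by (metis One_nat_def max.cobounded1 max.cobounded2 of_nat_max real_arch_simple
        of_nat_le_iff order_trans)
  \<comment> \<open>Starting at \<open>s0 + r\<close> forces \<open>r \<le> m s\<close> on
    \<open>S\<close>, as a union of \<open>r\<close> singletons requires; each point then weighs
    \<open>1 / r\<close>.\<close>
  define S where "S = {s0 + r..<s0 + r + r}"
  define a where "a s = (if s \<in> S then 1 / r else 0 :: real)" for s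
  have mS: "m ` S \<in> schreier (Suc 0)"
  proof -
    have le: "r \<le> m s" if "s \<in> S" for s
      using that strict_mono_imp_increasing[OF m, of s] by (simp add: S_def)
    show ?thesis unfolding schreier_Suc_iff
    proof (intro exI[of _ "map (\<lambda>s. {m s}) [s0 + r..<s0 + r + r]"] conjI)
      show "set (map (\<lambda>s. {m s}) [s0 + r..<s0 + r + r]) \<subseteq> schreier 0"
        using le r(2) by (fastforce simp: S_def)
      show "sorted_wrt before (map (\<lambda>s. {m s}) [s0 + r..<s0 + r + r])"
        unfolding sorted_wrt_map before_def using m
        by (intro sorted_wrt_mono_rel[OF _ sorted_wrt_upt]) (auto simp: strict_mono_def)
    qed (use le in \<open>auto simp: S_def\<close>)
  qed
  have mass: "sum a G \<le> \<epsilon>" if G: "G \<subseteq> S" "(\<lambda>s. m (Suc s)) ` G \<in> schreier 0" for G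
  proof -
    have "card G \<le> 1"
    proof -
      have "inj_on (\<lambda>s. m (Suc s)) G" using m by (auto simp: inj_on_def strict_mono_eq)
      then have "card G = card ((\<lambda>s. m (Suc s)) ` G)" by (simp add: card_image)
      also have "\<dots> \<le> 1" using G(2) by auto
      finally show ?thesis .
    qed
    have "sum a G = card G * (1 / r)" using G(1) by (simp add: a_def subset_iff)
    also have "\<dots> \<le> 1 / r" using \<open>card G \<le> 1\<close> by (cases "card G") auto
    also have "\<dots> \<le> \<epsilon>" using r 0 by (simp add: field_simps)
    finally show ?thesis .
  qed
  have "sum a S = 1" using r(2) by (simp add: a_def S_def)
  then show ?case using mS mass r(2)
    by (intro exI[of _ S] exI[of _ a]) (auto simp: S_def a_def)
next
  case (Suc n)
  \<comment> \<open>The group that contains the least element of a test set is estimated by one, any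
    other by \<open>\<epsilon> / 2\<close>; for this \<open>r\<close> the average of these bounds is
    at most \<open>\<epsilon>\<close>.\<close>
  obtain r :: nat where r: "2 / \<epsilon> \<le> r" "1 \<le> r"
    by (metis One_nat_def max.cobounded1 max.cobounded2 of_nat_max real_arch_simple
        of_nat_le_iff order_trans)
  \<comment> \<open>A test set of order \<open>Suc n\<close> whose least right end is at most
    \<open>m s1\<close> has at most \<open>m s1\<close> pieces of order \<open>n\<close>, and the
    tolerance is divided accordingly.\<close>
  let ?P = "\<lambda>s1 S a. finite S \<and> S \<noteq> {} \<and> S \<subseteq> {s1..} \<and> (\<forall>s. 0 \<le> a s) \<and> (\<forall>s. s \<notin> S \<longrightarrow> a s = 0) \<and>
     sum a S = (1::real) \<and> m ` S \<in> schreier (Suc n) \<and>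
     (\<forall>G\<subseteq>S. (\<lambda>s. m (Suc s)) ` G \<in> schreier n \<longrightarrow> sum a G \<le> \<epsilon> / (2 * m s1 + 2))"
  have ex: "\<exists>S a. ?P s1 S a" for s1
    by (rule Suc.IH) (use Suc.prems in simp)
  then obtain S a where P: "\<And>s1. ?P s1 (S s1) (a s1)" by metis
  have Pm: "sum (a s1) G \<le> \<epsilon> / (2 * m s1 + 2)"
    if "G \<subseteq> S s1" "(\<lambda>s. m (Suc s)) ` G \<in> schreier n" for s1 G
    using P that by blast
  have Pf: "finite (S s1)" for s1 using P by blast
  \<comment> \<open>The groups are chosen one after another, so that the tolerance of each can
    depend on where the preceding ones end.\<close>
  define t where "t = rec_nat (s0 + r) (\<lambda>_ s1. Suc (Max (S s1)))"
  have t0: "t 0 = s0 + r" and tS: "t (Suc i) = Suc (Max (S (t i)))" for i by (auto simp: t_def)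
  have St: "S (t i) \<subseteq> {t i..<t (Suc i)}" for i
    using P[of "t i"] by (fastforce simp: tS less_Suc_eq_le)
  have tmono: "t i < t (Suc i)" for i using St[of i] P[of "t i"] by fastforce
  then have tsm: "strict_mono t" by (simp add: strict_mono_Suc_iff)
  then have tle: "t i \<le> t j" if "i \<le> j" for i j using that by (simp add: strict_mono_less_eq)
  define U where "U = (\<Union>i<r. S (t i))"
  define b where "b s = (\<Sum>i<r. a (t i) s) / r" for s
  have sep: "s < s'" if "s \<in> S (t i)" "s' \<in> S (t j)" "i < j" for s s' i j
    using St[of i] St[of j] tle[of "Suc i" j] that by fastforce
  have bG: "sum b G = (\<Sum>i<r. sum (a (t i)) (G \<inter> S (t i))) / r" if "finite G" for G
  proof -
    have "sum b G = (\<Sum>i<r. sum (a (t i)) G) / r"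
      unfolding b_def by (simp add: sum_divide_distrib[symmetric] sum.swap[of _ G])
    also have "(\<Sum>i<r. sum (a (t i)) G) = (\<Sum>i<r. sum (a (t i)) (G \<inter> S (t i)))"
      by (intro sum.cong refl sum.mono_neutral_right) (use P that in auto)
    finally show ?thesis .
  qed
  have finU: "finite U" using P by (auto simp: U_def)
  have "sum b U = 1"
  proof -
    have "U \<inter> S (t i) = S (t i)" if "i < r" for i using that by (auto simp: U_def)
    then show ?thesis using P r(2) by (simp add: bG[OF finU])
  qed
  moreover have "m ` U \<in> schreier (Suc (Suc n))"
    unfolding schreier_Suc_iff[of _ "Suc n"]
  proof (intro exI[of _ "map (\<lambda>i. m ` S (t i)) [0..<r]"] conjI ballI)
    show "m ` U = \<Union>(set (map (\<lambda>i. m ` S (t i)) [0..<r]))"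
      by (simp add: U_def image_UN lessThan_atLeast0)
    show "set (map (\<lambda>i. m ` S (t i)) [0..<r]) \<subseteq> schreier (Suc n)" using P by auto
    show "sorted_wrt before (map (\<lambda>i. m ` S (t i)) [0..<r])"
      unfolding sorted_wrt_map before_def using m sep
      by (intro sorted_wrt_mono_rel[OF _ sorted_wrt_upt]) (auto simp: strict_mono_def)
    fix x assume "x \<in> m ` U"
    then obtain i s where s: "x = m s" "s \<in> S (t i)" by (auto simp: U_def)
    have "r \<le> s" using St[of i] s tle[of 0 i] t0 by fastforce
    then show "length (map (\<lambda>i. m ` S (t i)) [0..<r]) \<le> x"
      using strict_mono_imp_increasing[OF m, of s] s by simp
  qed
  moreover have "sum b G \<le> \<epsilon>" if G: "G \<subseteq> U" "(\<lambda>s. m (Suc s)) ` G \<in> schreier (Suc n)" for G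
  proof (cases "G = {}")
    case False
    have finG: "finite G" using G(1) finU by (rule finite_subset)
    obtain As where As: "(\<lambda>s. m (Suc s)) ` G = \<Union>(set As)" "set As \<subseteq> schreier n"
      "\<forall>x\<in>(\<lambda>s. m (Suc s)) ` G. length As \<le> x"
      using G(2) by (rule schreier_SucE)
    define g where "g = Min G"
    have g: "g \<in> G" "\<And>s. s \<in> G \<Longrightarrow> g \<le> s" using False finG by (auto simp: g_def)
    obtain i0 where i0: "i0 < r" "g \<in> S (t i0)" using g(1) G(1) by (auto simp: U_def)
    have d: "length As \<le> m (Suc g)" using As(3) g(1) by blast
    have part: "sum (a (t i)) (G \<inter> S (t i)) \<le> (if i = i0 then 1 else \<epsilon> / 2)" if "i < r" for i
    proof (cases i i0 rule: linorder_cases)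
      case less
      then have "G \<inter> S (t i) = {}" using sep[of _ i g i0] i0 g(2) by fastforce
      then show ?thesis using Suc.prems less by simp
    next
      case equal
      have "sum (a (t i)) (G \<inter> S (t i)) \<le> sum (a (t i)) (S (t i))"
        using P[of "t i"] by (intro sum_mono2) auto
      then show ?thesis using P[of "t i"] equal by simp
    next
      case greater
      let ?H = "\<lambda>A. {s \<in> G \<inter> S (t i). m (Suc s) \<in> A}"
      have cov: "\<exists>A\<in>set As. m (Suc s) \<in> A" if "s \<in> G" for s
        using imageI[OF that, of "\<lambda>s. m (Suc s)"] unfolding As(1) by simp
      have "G \<inter> S (t i) = (\<Union>A\<in>set As. ?H A)" by (rule set_eqI) (use cov in auto)
      then have "sum (a (t i)) (G \<inter> S (t i)) = sum (a (t i)) (\<Union>A\<in>set As. ?H A)" by (rule arg_cong)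
      also have "\<dots> \<le> (\<Sum>A\<in>set As. sum (a (t i)) (?H A))"
        using P[of "t i"] by (intro sum_UNION_le) (auto intro: finite_subset)
      also have "\<dots> \<le> (\<Sum>A\<in>set As. \<epsilon> / (2 * m (t i) + 2))"
      proof (rule sum_mono)
        fix A assume "A \<in> set As"
        then have "A \<in> schreier n" using As(2) by blast
        then have "(\<lambda>s. m (Suc s)) ` ?H A \<in> schreier n"
          by (rule schreier_subset) blast
        then show "sum (a (t i)) (?H A) \<le> \<epsilon> / (2 * m (t i) + 2)" by (intro Pm) blast+
      qed
      also have "\<dots> \<le> \<epsilon> / 2"
      proof -
        have "Suc g \<le> t i" using St[of i0] i0(2) tle[of "Suc i0" i] greater by fastforce
        then have "m (Suc g) \<le> m (t i)" using m by (simp add: strict_mono_less_eq)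
        then have "card (set As) \<le> m (t i) + 1" using d card_length[of As] by linarith
        then have "real (card (set As)) \<le> real (m (t i)) + 1" by linarith
        then have "real (card (set As)) * \<epsilon> \<le> (real (m (t i)) + 1) * \<epsilon>"
          using Suc.prems by (intro mult_right_mono) auto
        then show ?thesis by (simp add: field_simps)
      qed
      finally show ?thesis using greater by simp
    qed
    have "(\<Sum>i<r. sum (a (t i)) (G \<inter> S (t i))) \<le> (\<Sum>i<r. (if i = i0 then 1 else 0) + \<epsilon> / 2)"
      by (rule sum_mono) (use part Suc.prems in force)
    also have "\<dots> = 1 + r * (\<epsilon> / 2)" using i0(1) by (simp add: sum.distrib)
    also have "\<dots> \<le> r * \<epsilon>" using r Suc.prems by (simp add: field_simps)
    finally show ?thesis using r(2) by (simp add: bG[OF finG] divide_le_eq mult.commute)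
  qed (use Suc.prems in simp)
  moreover have "U \<noteq> {}" "U \<subseteq> {s0..}"
  proof -
    show "U \<noteq> {}" using P[of "t 0"] r(2) by (auto simp: U_def)
    show "U \<subseteq> {s0..}"
    proof
      fix s assume "s \<in> U"
      then obtain i where "s \<in> S (t i)" by (auto simp: U_def)
      then show "s \<in> {s0..}" using St[of i] t0 tle[of 0 i] by fastforce
    qed
  qed
  moreover have "0 \<le> b s" for s using P by (auto simp: b_def intro!: sum_nonneg divide_nonneg_nonneg)
  moreover have "b s = 0" if "s \<notin> U" for s using that P by (simp add: b_def U_def)
  ultimately show ?case using finU by blast
qed

section \<open>Splitting averages of block sequences\<close>

locale block_weights =
  fixes m :: "nat \<Rightarrow> nat" and a :: "nat \<Rightarrow> real"
  assumes m: "strict_mono m" and a: "0 \<le> a s"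
begin

text \<open>Blocks are represented by their right ends. By spreading this gives the largest class of
  test sets: if points chosen from different blocks form a Schreier set, so do the right ends of
  these blocks.\<close>

definition mass :: "nat \<Rightarrow> nat set \<Rightarrow> real" where
  "mass n S = Max (sum a ` {G. G \<subseteq> S \<and> (\<lambda>s. m (Suc s)) ` G \<in> schreier n})"

text \<open>Block \<open>s\<close> occupies \<open>{m s<..m (Suc s)}\<close>, hence the
  \<open>Suc\<close> at its left end.\<close>

definition inside :: "nat \<Rightarrow> nat \<Rightarrow> nat set \<Rightarrow> nat set" where
  "inside l u S = {s \<in> S. l \<le> Suc (m s) \<and> m (Suc s) \<le> u}"

definition cut :: "nat set \<Rightarrow> (nat \<Rightarrow> nat) \<Rightarrow> nat set \<Rightarrow> nat set" where
  "cut L u S = {s \<in> S. (\<exists>l\<in>L. l \<le> m (Suc s) \<and> Suc (m s) \<le> u l) \<and>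
     \<not> (\<exists>l\<in>L. l \<le> Suc (m s) \<and> m (Suc s) \<le> u l)}"

lemma m_less: "m s < m (Suc s)"
  using m by (simp add: strict_mono_def)

lemma m_Suc_le: "s < s' \<Longrightarrow> m (Suc s) \<le> m s'"
  using m by (simp add: strict_mono_less_eq)

lemma mass_finite: "finite S \<Longrightarrow> finite (sum a ` {G. G \<subseteq> S \<and> (\<lambda>s. m (Suc s)) ` G \<in> schreier n})"
  by (rule finite_imageI, rule finite_subset[of _ "Pow S"]) auto

lemma mass_ge:
  "finite S \<Longrightarrow> G \<subseteq> S \<Longrightarrow> (\<lambda>s. m (Suc s)) ` G \<in> schreier n \<Longrightarrow> sum a G \<le> mass n S"
  unfolding mass_def by (intro Max_ge mass_finite) auto

lemma mass_attained:
  assumes "finite S"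
  obtains G where "G \<subseteq> S" "(\<lambda>s. m (Suc s)) ` G \<in> schreier n" "sum a G = mass n S"
proof -
  have "{} \<in> {G. G \<subseteq> S \<and> (\<lambda>s. m (Suc s)) ` G \<in> schreier n}" by simp
  then have "mass n S \<in> sum a ` {G. G \<subseteq> S \<and> (\<lambda>s. m (Suc s)) ` G \<in> schreier n}"
    unfolding mass_def by (intro Max_in mass_finite assms) blast
  then obtain G where "G \<in> {G. G \<subseteq> S \<and> (\<lambda>s. m (Suc s)) ` G \<in> schreier n}" "mass n S = sum a G"
    by (elim imageE)
  then show thesis using that[of G] by simp
qed

lemma mass_nonneg: "finite S \<Longrightarrow> 0 \<le> mass n S"
  using mass_ge[of S "{}" n] by simp

lemma mass_mono:
  assumes "n \<le> n'" "finite S" shows "mass n S \<le> mass n' S"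
proof -
  obtain G where G: "G \<subseteq> S" "(\<lambda>s. m (Suc s)) ` G \<in> schreier n" "sum a G = mass n S"
    using mass_attained[OF assms(2)] by blast
  then show ?thesis using mass_ge[OF assms(2) G(1) schreier_mono[OF assms(1) G(2)]] by simp
qed

lemma weight_le_mass:
  assumes "finite S" "s \<in> S" shows "a s \<le> mass n S"
proof -
  have "{m (Suc s)} \<in> schreier n" using m_less[of s] by (intro singleton_in_schreier) simp
  then show ?thesis using mass_ge[of S "{s}" n] assms by simp
qed

lemma inside_subset: "inside l u S \<subseteq> S"
  by (auto simp: inside_def)

lemma finite_inside: "finite S \<Longrightarrow> finite (inside l u S)"
  by (simp add: inside_def)

lemma disjoint_inside:
  assumes "adm k L u" shows "disjoint_family_on (\<lambda>l. inside l (u l) S) L"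
  unfolding disjoint_family_on_def
proof (intro ballI impI equals0I)
  fix l l' s assume l: "l \<in> L" "l' \<in> L" "l \<noteq> l'" and s: "s \<in> inside l (u l) S \<inter> inside l' (u l') S"
  have "m (Suc s) \<in> {l..u l} \<inter> {l'..u l'}" using s m_less[of s] by (auto simp: inside_def)
  then show False using adm_disjoint[OF assms l] by blast
qed

lemma sum_inside_le:
  assumes "adm k L u" "finite S"
  shows "(\<Sum>l\<in>L. sum a (inside l (u l) S)) \<le> sum a S"
  by (intro sum_le_of_finite_partition assms(2) adm_finite[OF assms(1)] disjoint_inside[OF assms(1)]
      inside_subset a)

text \<open>A heaviest test set of order \<open>n\<close> is chosen in each interval; by composition
  their union is one test set of order \<open>k + n\<close>. In this way a splitting of order
  \<open>k\<close> consumes \<open>k\<close> of the order of an average.\<close>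

lemma sum_mass_inside_le:
  assumes adm: "adm k L u" and S: "finite S"
  shows "(\<Sum>l\<in>L. mass n (inside l (u l) S)) \<le> mass (k + n) S"
proof -
  have "\<exists>G. G \<subseteq> inside l (u l) S \<and> (\<lambda>s. m (Suc s)) ` G \<in> schreier n \<and> sum a G = mass n (inside l (u l) S)" for l
    using mass_attained[OF finite_inside[OF S]] by metis
  then obtain G where G: "\<And>l. G l \<subseteq> inside l (u l) S" "\<And>l. (\<lambda>s. m (Suc s)) ` G l \<in> schreier n"
    "\<And>l. sum a (G l) = mass n (inside l (u l) S)" by metis
  have GS: "G l \<subseteq> S" for l using G(1) inside_subset by blast
  have "disjoint_family_on G L"
    using disjoint_inside[OF adm] G(1) unfolding disjoint_family_on_def by blast
  then have "(\<Sum>l\<in>L. sum a (G l)) = sum a (\<Union>l\<in>L. G l)"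
    using GS S adm_finite[OF adm]
    by (intro sum.UNION_disjoint_family[symmetric]) (auto intro: finite_subset)
  also have "\<dots> \<le> mass (k + n) S"
  proof (rule mass_ge[OF S])
    show "(\<Union>l\<in>L. G l) \<subseteq> S" using GS by blast
    have "(\<Union>l\<in>L. (\<lambda>s. m (Suc s)) ` G l) \<in> schreier (k + n)"
    proof (rule schreier_compose)
      show "L \<in> schreier k" using adm by (simp add: adm_def)
      show "(\<lambda>s. m (Suc s)) ` G l \<in> schreier n" for l by (rule G)
      show "l \<le> x" if x: "x \<in> (\<lambda>s. m (Suc s)) ` G l" for l x
      proof -
        obtain s where "s \<in> G l" "x = m (Suc s)" using x by blast
        then show ?thesis using G(1)[of l] m_less[of s] by (auto simp: inside_def)
      qed
      show "x < l'" if l: "l \<in> L" "l' \<in> L" "l < l'" and x: "x \<in> (\<lambda>s. m (Suc s)) ` G l" for l l' x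
      proof -
        obtain s where "s \<in> G l" "x = m (Suc s)" using x by blast
        then have "x \<le> u l" using G(1)[of l] by (auto simp: inside_def)
        also have "u l < l'" using adm l by (auto simp: adm_def)
        finally show ?thesis .
      qed
    qed
    then show "(\<lambda>s. m (Suc s)) ` (\<Union>l\<in>L. G l) \<in> schreier (k + n)" by (simp add: image_UN)
  qed
  finally show ?thesis by (simp add: G(3))
qed

text \<open>Points of \<open>L\<close> that mark different blocks are spread to the right ends of
  these blocks.\<close>

lemma schreier_choice:
  assumes L: "L \<in> schreier k" and S: "finite S" "G \<subseteq> S"
    and f: "\<And>s. s \<in> G \<Longrightarrow> f s \<in> L" "\<And>s. s \<in> G \<Longrightarrow> f s \<le> m (Suc s)"
      "\<And>s s'. s \<in> G \<Longrightarrow> s' \<in> G \<Longrightarrow> s < s' \<Longrightarrow> f s < f s'"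
  shows "sum a G \<le> mass k S"
proof (rule mass_ge[OF S])
  show "(\<lambda>s. m (Suc s)) ` G \<in> schreier k"
  proof (rule schreier_spread[where f = f])
    show "f ` G \<in> schreier k" using L by (rule schreier_subset) (use f in blast)
    show "strict_mono_on G f" using f(3) by (auto simp: strict_mono_on_def)
    show "strict_mono_on G (\<lambda>s. m (Suc s))" using m by (auto simp: strict_mono_on_def strict_mono_def)
  qed (rule f(2))
qed

text \<open>A cut block either contains a left end \<open>l\<close> or has a right end \<open>u l\<close> in its interior, and in
  both cases \<open>l\<close> determines the block.\<close>

lemma sum_cut_le:
  assumes adm: "adm k L u" and S: "finite S"
  shows "sum a (cut L u S) \<le> 2 * mass k S"
proof -
  have L: "L \<in> schreier k" using adm by (simp add: adm_def)
  define C1 where "C1 = {s \<in> S. \<exists>l\<in>L. m s < l \<and> l \<le> m (Suc s)}"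
  define C2 where "C2 = {s \<in> S. \<exists>l\<in>L. l \<le> m s \<and> m s < u l \<and> u l < m (Suc s)}"
  have "sum a C1 \<le> mass k S"
  proof -
    have "\<forall>s\<in>C1. \<exists>l. l \<in> L \<and> m s < l \<and> l \<le> m (Suc s)" by (auto simp: C1_def)
    then obtain f where f: "\<And>s. s \<in> C1 \<Longrightarrow> f s \<in> L \<and> m s < f s \<and> f s \<le> m (Suc s)" by metis
    show ?thesis
    proof (rule schreier_choice[OF L S, where f = f])
      show "f s < f s'" if "s \<in> C1" "s' \<in> C1" "s < s'" for s s'
        using f[of s] f[of s'] m_Suc_le[of s s'] that by linarith
    qed (use f in \<open>auto simp: C1_def\<close>)
  qed
  moreover have "sum a C2 \<le> mass k S"
  proof -
    have "\<forall>s\<in>C2. \<exists>l. l \<in> L \<and> l \<le> m s \<and> m s < u l \<and> u l < m (Suc s)" by (auto simp: C2_def)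
    then obtain f where f: "\<And>s. s \<in> C2 \<Longrightarrow> f s \<in> L \<and> f s \<le> m s \<and> m s < u (f s) \<and> u (f s) < m (Suc s)"
      by metis
    show ?thesis
    proof (rule schreier_choice[OF L S, where f = f])
      show "f s \<le> m (Suc s)" if "s \<in> C2" for s using f[of s] m_less[of s] that by linarith
      show "f s < f s'" if s: "s \<in> C2" "s' \<in> C2" "s < s'" for s s'
      proof (rule ccontr)
        assume "\<not> f s < f s'"
        then consider "f s = f s'" | "f s' < f s" by linarith
        then show False
        proof cases
          case 1
          then show False using f[of s] f[of s'] m_Suc_le[of s s'] s by simp
        next
          case 2
          then have "u (f s') < f s" using adm f s by (simp add: adm_def)
          then show False using f[of s] f[of s'] m_Suc_le[of s s'] m_less[of s] s by linarith
        qed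
      qed
    qed (use f in \<open>auto simp: C2_def\<close>)
  qed
  moreover have "sum a (cut L u S) \<le> sum a (C1 \<union> C2)"
  proof (rule sum_mono2)
    show "cut L u S \<subseteq> C1 \<union> C2"
    proof
      fix s assume s: "s \<in> cut L u S"
      then obtain l where l: "l \<in> L" "l \<le> m (Suc s)" "Suc (m s) \<le> u l" by (auto simp: cut_def)
      then have "l \<le> m s \<Longrightarrow> u l < m (Suc s)" using s by (force simp: cut_def)
      then show "s \<in> C1 \<union> C2" using l s by (cases "l \<le> m s") (auto simp: C1_def C2_def cut_def)
    qed
  qed (use S a in \<open>auto simp: C1_def C2_def\<close>)
  moreover have "sum a (C1 \<union> C2) \<le> sum a C1 + sum a C2"
    by (intro sum_Un_le a) (use S in \<open>auto simp: C1_def C2_def\<close>)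
  ultimately show ?thesis by linarith
qed

end

section \<open>Averages under splitting, from above and from below\<close>

locale Tsirelson_blocks = subexponential_Tsirelson \<theta> + block_weights m a
  for \<theta> :: "nat \<Rightarrow> real" and m :: "nat \<Rightarrow> nat" and a :: "nat \<Rightarrow> real"
begin

text \<open>Each interval sees the blocks inside it unchanged. A cut block costs at most
  \<open>C\<close> over the whole family, and the cut blocks weigh at most twice a mass of order
  \<open>k\<close>, since an interval has only two ends.\<close>

lemma T_split:
  assumes adm: "adm k L u" and S: "finite S"
    and w: "\<And>s. s \<in> S \<Longrightarrow> w s \<in> c00" "\<And>s. s \<in> S \<Longrightarrow> supp (w s) \<subseteq> {m s<..m (Suc s)}"
    and C: "\<And>s. s \<in> S \<Longrightarrow> (\<Sum>l\<in>L. T (restr {l..u l} (w s))) \<le> C" "0 \<le> C"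
  shows "(\<Sum>l\<in>L. T (restr {l..u l} (comb S a w))) \<le>
    (\<Sum>l\<in>L. T (comb (inside l (u l) S) a w)) + 2 * C * mass k S"
proof -
  let ?C = "cut L u S"
  have sub: "?C \<subseteq> S" by (auto simp: cut_def)
  then have finC: "finite ?C" using S by (rule finite_subset)
  have one: "T (restr {l..u l} (comb S a w)) \<le> T (comb (inside l (u l) S) a w) +
      (\<Sum>s\<in>?C. a s * T (restr {l..u l} (w s)))" if l: "l \<in> L" for l
  proof -
    let ?I = "inside l (u l) S" and ?r = "\<lambda>s. restr {l..u l} (w s)"
    \<comment> \<open>A block that neither lies in this interval nor is cut either misses the
      interval or lies in another one, which is disjoint from it.\<close>
    have z: "?r s = (\<lambda>_. 0)" if sS: "s \<in> S - (?I \<union> ?C)" for s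
    proof (rule restr_zero, rule ccontr)
      assume "supp (w s) \<inter> {l..u l} \<noteq> {}"
      then obtain i where "i \<in> supp (w s)" and lu: "i \<in> {l..u l}" by blast
      then have "i \<in> {m s<..m (Suc s)}" using w(2)[of s] sS by blast
      then have i: "m s < i" "i \<le> m (Suc s)" "l \<le> i" "i \<le> u l" using lu by auto
      then obtain l' where l': "l' \<in> L" "l' \<le> Suc (m s)" "m (Suc s) \<le> u l'"
        using sS l by (force simp: cut_def)
      then have "l' \<noteq> l" using sS by (auto simp: inside_def)
      moreover have "i \<in> {l..u l} \<inter> {l'..u l'}" using i l' by auto
      ultimately show False using adm_disjoint[OF adm l l'(1)] by blast
    qed
    have dj: "?I \<inter> ?C = {}" using l by (auto simp: cut_def inside_def)
    have "restr {l..u l} (comb S a w) = (\<lambda>i. comb ?I a w i + comb ?C a ?r i)"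
    proof
      fix i
      have "restr {l..u l} (comb S a w) i = (\<Sum>s\<in>S. a s * ?r s i)"
        by (simp add: restr_comb) (simp add: comb_def)
      also have "\<dots> = (\<Sum>s\<in>?I \<union> ?C. a s * ?r s i)"
        by (intro sum.mono_neutral_right S) (use sub inside_subset z in auto)
      also have "\<dots> = (\<Sum>s\<in>?I. a s * ?r s i) + (\<Sum>s\<in>?C. a s * ?r s i)"
        using dj finC finite_inside[OF S] by (intro sum.union_disjoint) auto
      also have "(\<Sum>s\<in>?I. a s * ?r s i) = (\<Sum>s\<in>?I. a s * w s i)"
      proof (rule sum.cong[OF refl])
        fix s assume s: "s \<in> ?I"
        then have "supp (w s) \<subseteq> {l..u l}" using w(2)[of s] by (fastforce simp: inside_def)
        then show "a s * ?r s i = a s * w s i" by (simp add: restr_ident)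
      qed
      finally show "restr {l..u l} (comb S a w) i = comb ?I a w i + comb ?C a ?r i"
        by (simp add: comb_def)
    qed
    moreover have "comb ?I a w \<in> c00" using w(1) inside_subset finite_inside[OF S] by blast
    moreover have r: "?r s \<in> c00" if "s \<in> ?C" for s using w(1) sub that by auto
    then have "comb ?C a ?r \<in> c00" using finC by blast
    moreover have "T (comb ?C a ?r) \<le> (\<Sum>s\<in>?C. a s * T (?r s))"
      using T_comb[OF finC, of ?r a] r a by simp
    ultimately show ?thesis using T_add[of "comb ?I a w" "comb ?C a ?r"] by simp
  qed
  have "(\<Sum>l\<in>L. T (restr {l..u l} (comb S a w))) \<le>
    (\<Sum>l\<in>L. T (comb (inside l (u l) S) a w) + (\<Sum>s\<in>?C. a s * T (restr {l..u l} (w s))))"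
    by (intro sum_mono one)
  also have "\<dots> = (\<Sum>l\<in>L. T (comb (inside l (u l) S) a w)) +
      (\<Sum>s\<in>?C. a s * (\<Sum>l\<in>L. T (restr {l..u l} (w s))))"
    by (simp add: sum.distrib sum_distrib_left) (rule sum.swap)
  also have "(\<Sum>s\<in>?C. a s * (\<Sum>l\<in>L. T (restr {l..u l} (w s)))) \<le> (\<Sum>s\<in>?C. a s * C)"
    using C(1) sub a by (intro sum_mono mult_left_mono) auto
  also have "\<dots> = C * sum a ?C" by (simp add: sum_distrib_left mult.commute)
  also have "\<dots> \<le> C * (2 * mass k S)" by (intro mult_left_mono sum_cut_le[OF adm S] C(2))
  finally show ?thesis by simp
qed

text \<open>The tool for lower estimates. The families found in the single blocks are united, and
  composition adds the order \<open>j\<close> of the set of blocks to their order \<open>k\<close>.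
  Distinct blocks do not interact, so the sums are averaged without loss.\<close>

lemma adm_comb:
  assumes S: "finite S" "m ` S \<in> schreier j"
    and L: "\<And>s. s \<in> S \<Longrightarrow> adm k (L s) (v s)" "\<And>s. s \<in> S \<Longrightarrow> L s \<subseteq> {m s<..}"
      "\<And>s. s \<in> S \<Longrightarrow> v s ` L s \<subseteq> {..m (Suc s)}"
    and x: "\<And>s. s \<in> S \<Longrightarrow> x s \<in> c00" "\<And>s. s \<in> S \<Longrightarrow> supp (x s) \<subseteq> {m s<..m (Suc s)}"
  shows "\<exists>M u. adm (j + k) M u \<and> (\<forall>l\<in>M. \<exists>s\<in>S. m s < l \<and> u l \<le> m (Suc s)) \<and>
    (\<Sum>l\<in>M. T (restr {l..u l} (comb S a x))) = (\<Sum>s\<in>S. a s * (\<Sum>l\<in>L s. T (restr {l..v s l} (x s))))"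
proof -
  define M where "M = (\<Union>s\<in>S. L s)"
  have Lb: "m s < l" "l \<le> v s l" "v s l \<le> m (Suc s)" if "s \<in> S" "l \<in> L s" for s l
    using L[of s] that by (auto simp: adm_def)
  have uniq: "s = s'" if "s \<in> S" "l \<in> L s" "s' \<in> S" "l \<in> L s'" for s s' l
    using Lb[of s l] Lb[of s' l] m_Suc_le[of s s'] m_Suc_le[of s' s] that
    by (cases s s' rule: linorder_cases) auto
  define u where "u l = v (THE s. s \<in> S \<and> l \<in> L s) l" for l
  have u: "u l = v s l" if "s \<in> S" "l \<in> L s" for s l
  proof -
    have "(THE s. s \<in> S \<and> l \<in> L s) = s" using that uniq by blast
    then show ?thesis by (simp add: u_def)
  qed
  have "adm (j + k) M u"
    unfolding adm_def
  proof (intro conjI ballI impI)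
    show "l \<le> u l" if "l \<in> M" for l using that Lb u by (auto simp: M_def)
    show "u l < l'" if l: "l \<in> M" "l' \<in> M" "l < l'" for l l'
    proof -
      obtain s s' where s: "s \<in> S" "l \<in> L s" "s' \<in> S" "l' \<in> L s'" using l by (auto simp: M_def)
      show ?thesis
      proof (cases s s' rule: linorder_cases)
        case less
        then show ?thesis using Lb[of s l] Lb[of s' l'] m_Suc_le[of s s'] s u[of s l] by linarith
      next
        case equal
        then show ?thesis using L(1)[of s] s l(3) u[of s l] by (auto simp: adm_def)
      next
        case greater
        then show ?thesis using Lb[of s l] Lb[of s' l'] m_Suc_le[of s' s] s l(3) by linarith
      qed
    qed
    \<comment> \<open>\<open>m s\<close> lies just outside block \<open>s\<close>; its successor is
      the first point of the block.\<close>
    have Sj: "(\<lambda>s. Suc (m s)) ` S \<in> schreier j"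
      by (rule schreier_spread[OF S(2)]) (use m in \<open>auto simp: strict_mono_on_def strict_mono_def\<close>)
    define P where "P l = (\<Union>s\<in>{s\<in>S. Suc (m s) = l}. L s)" for l
    have Pm: "P (Suc (m s)) = L s" if "s \<in> S" for s
      using m that by (auto simp: P_def strict_mono_eq)
    have "(\<Union>l\<in>(\<lambda>s. Suc (m s)) ` S. P l) \<in> schreier (j + k)"
    proof (rule schreier_compose[OF Sj])
      show "P l \<in> schreier k" if "l \<in> (\<lambda>s. Suc (m s)) ` S" for l
        using that Pm L(1) by (auto simp: adm_def)
      show "l \<le> i" if "l \<in> (\<lambda>s. Suc (m s)) ` S" "i \<in> P l" for l i
        using that Pm Lb(1) by fastforce
      show "i < l'" if l: "l \<in> (\<lambda>s. Suc (m s)) ` S" "l' \<in> (\<lambda>s. Suc (m s)) ` S" "l < l'" "i \<in> P l" for l l' i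
      proof -
        obtain s s' where s: "s \<in> S" "l = Suc (m s)" "s' \<in> S" "l' = Suc (m s')" using l by blast
        then have "s < s'" using l(3) m by (simp add: strict_mono_less)
        then show ?thesis using m_Suc_le[of s s'] Lb[of s i] l(4) Pm[of s] s by force
      qed
    qed
    moreover have "(\<Union>l\<in>(\<lambda>s. Suc (m s)) ` S. P l) = M" using Pm by (auto simp: M_def)
    ultimately show "M \<in> schreier (j + k)" by simp
  qed
  moreover have "\<exists>s\<in>S. m s < l \<and> u l \<le> m (Suc s)" if "l \<in> M" for l
    using that Lb u by (fastforce simp: M_def)
  moreover have "(\<Sum>l\<in>M. T (restr {l..u l} (comb S a x))) =
      (\<Sum>s\<in>S. a s * (\<Sum>l\<in>L s. T (restr {l..v s l} (x s))))"
  proof -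
    have "(\<Sum>l\<in>M. T (restr {l..u l} (comb S a x))) = (\<Sum>s\<in>S. \<Sum>l\<in>L s. T (restr {l..u l} (comb S a x)))"
      unfolding M_def using uniq S(1) adm_finite[OF L(1)]
      by (intro sum.UNION_disjoint) blast+
    also have "\<dots> = (\<Sum>s\<in>S. \<Sum>l\<in>L s. a s * T (restr {l..v s l} (x s)))"
    proof (intro sum.cong refl)
      fix s l assume sl: "s \<in> S" "l \<in> L s"
      have z: "x s' i = 0" if "s' \<in> S" "s' \<noteq> s" "i \<in> {l..v s l}" for s' i
      proof (rule ccontr)
        assume "x s' i \<noteq> 0"
        then have "m s' < i" "i \<le> m (Suc s')" using x(2)[OF that(1)] by (auto simp: supp_def)
        then show False
          using that(2,3) Lb[OF sl] m_Suc_le[of s s'] m_Suc_le[of s' s]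
          by (cases s s' rule: linorder_cases) auto
      qed
      have "restr {l..u l} (comb S a x) = (\<lambda>i. a s * restr {l..v s l} (x s) i)"
      proof
        fix i
        have "i \<in> {l..v s l} \<Longrightarrow> (\<Sum>s'\<in>S. a s' * x s' i) = a s * x s i"
          using S(1) sl(1) z by (subst sum.remove[of S s]) (auto intro!: sum.neutral)
        then show "restr {l..u l} (comb S a x) i = a s * restr {l..v s l} (x s) i"
          using u[OF sl] by (simp add: restr_def comb_def)
      qed
      then show "T (restr {l..u l} (comb S a x)) = a s * T (restr {l..v s l} (x s))"
        using T_scale[of "restr {l..v s l} (x s)" "a s"] x(1) sl a by simp
    qed
    finally show ?thesis by (simp add: sum_distrib_left)
  qed
  ultimately show ?thesis by blast
qed

end

section \<open>Rapidly increasing sequences\<close>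

text \<open>Dependent choice: each interval starts where the preceding one ends and carries its
  datum \<open>d s\<close>.\<close>

lemma interval_chain:
  assumes "\<And>M. N \<le> M \<Longrightarrow> \<exists>M'>M. \<exists>d. P M M' d"
  shows "\<exists>m d. m 0 = N \<and> strict_mono (m :: nat \<Rightarrow> nat) \<and> (\<forall>s. P (m s) (m (Suc s)) (d s))"
proof -
  obtain f d where f: "\<And>M. N \<le> M \<Longrightarrow> M < f M \<and> P M (f M) (d M)" using assms by metis
  define m where "m = rec_nat N (\<lambda>_. f)"
  have m: "m 0 = N" "m (Suc s) = f (m s)" for s by (auto simp: m_def)
  have ge: "N \<le> m s" for s
  proof (induction s)
    case (Suc s)
    then show ?case using f[of "m s"] m by simp
  qed (simp add: m)
  have "strict_mono m" using f ge m by (simp add: strict_mono_Suc_iff)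
  moreover have "P (m s) (m (Suc s)) (d (m s))" for s using f ge m by simp
  ultimately show ?thesis using m(1) by (intro exI[of _ m] exI[of _ "\<lambda>s. d (m s)"]) simp
qed

lemma comb_scale: "comb S a (\<lambda>s i. c * w s i) = (\<lambda>i. c * comb S a w i)"
  by (simp add: comb_def sum_distrib_left mult.left_commute)

lemma restr_scale: "restr A (\<lambda>i. c * x i) = (\<lambda>i. c * restr A x i)"
  by (auto simp: restr_def)

lemma supp_scale: "supp (\<lambda>i. c * x i) \<subseteq> supp x"
  by (auto simp: supp_def)

context block_weights
begin

lemma mass_le:
  assumes "finite S" "\<And>G. G \<subseteq> S \<Longrightarrow> (\<lambda>s. m (Suc s)) ` G \<in> schreier n \<Longrightarrow> sum a G \<le> c"
  shows "mass n S \<le> c"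
proof -
  obtain G where "G \<subseteq> S" "(\<lambda>s. m (Suc s)) ` G \<in> schreier n" "sum a G = mass n S"
    using mass_attained[OF assms(1)] by blast
  then show ?thesis using assms(2)[of G] by simp
qed

lemma supp_comb_block:
  assumes "finite S" "\<And>s. s \<in> S \<Longrightarrow> supp (w s) \<subseteq> {m s<..m (Suc s)}"
  shows "supp (comb S a w) \<subseteq> {m 0<..m (Suc (Max S))}"
proof -
  have "{m s<..m (Suc s)} \<subseteq> {m 0<..m (Suc (Max S))}" if "s \<in> S" for s
  proof -
    have "m 0 \<le> m s" "m (Suc s) \<le> m (Suc (Max S))"
      using m that assms(1) by (simp_all add: strict_mono_less_eq)
    then show ?thesis by auto
  qed
  then show ?thesis using supp_comb[of S a w] assms(2) by blast
qed

end

context subexponential_Tsirelson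
begin

lemma flat_scale:
  assumes "flat k C x" "x \<in> c00" shows "flat k (\<bar>c\<bar> * C) (\<lambda>i. c * x i)"
  unfolding flat_def restr_scale
proof (intro allI impI)
  fix L u assume "adm k L u"
  then have "\<bar>c\<bar> * (\<Sum>l\<in>L. T (restr {l..u l} x)) \<le> \<bar>c\<bar> * C"
    using flatD[OF assms(1)] by (intro mult_left_mono) auto
  then show "(\<Sum>l\<in>L. T (\<lambda>i. c * restr {l..u l} x i)) \<le> \<bar>c\<bar> * C"
    using assms(2) by (simp add: T_scale sum_distrib_left)
qed

text \<open>With \<open>d = sqrt (1 / 2)\<close>, the weights along multiples of \<open>L\<close>
  are eventually at least \<open>d ^ r\<close>, and the other factor \<open>d ^ r\<close> of
  \<open>(1 / 2) ^ r\<close> absorbs \<open>C\<close>.\<close>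

lemma subexponential:
  assumes L: "1 \<le> L" and C: "0 < C"
  shows "\<exists>r\<ge>1. C * (1 / 2) ^ r < \<theta> (L * r)"
proof -
  define d :: real where "d = sqrt (1 / 2)"
  have d: "0 < d" "d < 1" "d * d = 1 / 2" by (auto simp: d_def real_sqrt_lt_1_iff)
  define c where "c = root L d"
  have c: "0 < c" "c < 1" "c ^ L = d"
    using L d by (auto simp: c_def real_root_lt_1_iff)
  have "\<forall>\<^sub>F n in sequentially. c < root n (\<theta> n)"
    using root_lim c(2) by (rule order_tendstoD)
  then obtain n0 where n0: "\<And>n. n \<ge> n0 \<Longrightarrow> c < root n (\<theta> n)"
    unfolding eventually_sequentially by blast
  have "(\<lambda>r. C * d ^ r) \<longlonglongrightarrow> C * 0" using d by (intro tendsto_intros LIMSEQ_realpow_zero) auto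
  then have "\<forall>\<^sub>F r in sequentially. C * d ^ r < 1" by (rule order_tendstoD) simp
  then obtain r0 where r0: "\<And>r. r \<ge> r0 \<Longrightarrow> C * d ^ r < 1"
    unfolding eventually_sequentially by blast
  define r where "r = max (max n0 r0) 1"
  have r: "1 \<le> r" "r0 \<le> r" "n0 \<le> r" by (auto simp: r_def)
  have Lr: "r \<le> L * r" using L by simp
  have "C * (1 / 2) ^ r = (C * d ^ r) * d ^ r" by (simp add: d(3)[symmetric] power_mult_distrib)
  also have "\<dots> < 1 * d ^ r" using r0[OF r(2)] d by (intro mult_strict_right_mono) auto
  also have "\<dots> = c ^ (L * r)" by (simp add: power_mult c(3))
  also have "\<dots> \<le> root (L * r) (\<theta> (L * r)) ^ (L * r)"
    using n0[of "L * r"] r Lr c(1) by (intro power_mono) auto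
  also have "\<dots> = \<theta> (L * r)" using theta_pos[of "L * r"] L r by simp
  finally show ?thesis using r(1) by blast
qed

text \<open>Otherwise every step of length \<open>L\<close> would halve \<theta>, which contradicts
  subexponential decay along the multiples of \<open>L\<close>.\<close>

lemma slow_decay: "\<exists>j>K. \<theta> (j - K) \<le> 2 * \<theta> (j + Q)"
proof (rule ccontr)
  assume *: "\<not> ?thesis"
  \<comment> \<open>The summand one keeps \<open>L\<close> positive when \<open>K\<close> and
    \<open>Q\<close> vanish.\<close>
  define L where "L = K + Q + 1"
  have half: "\<theta> (n + L) \<le> \<theta> n / 2" if "1 \<le> n" for n
  proof -
    have "\<theta> (n + L) \<le> \<theta> (n + K + Q)" using that by (intro theta_antimono) (auto simp: L_def)
    also have "\<dots> \<le> \<theta> n / 2" using * that by (auto dest!: spec[of _ "n + K"])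
    finally show ?thesis .
  qed
  have "\<theta> (L * Suc r) \<le> 2 * (1 / 2) ^ Suc r" for r
  proof (induction r)
    case 0
    then show ?case using theta_less_1[of L] by (simp add: L_def)
  next
    case (Suc r)
    have "\<theta> (L * Suc (Suc r)) \<le> \<theta> (L * Suc r) / 2"
      using half[of "L * Suc r"] by (simp add: L_def add.commute add.left_commute)
    then show ?case using Suc by simp
  qed
  moreover obtain r where "1 \<le> r" "2 * (1 / 2) ^ r < \<theta> (L * r)"
    using subexponential[of L 2] by (auto simp: L_def)
  ultimately show False by (cases r) (auto simp: not_le[symmetric] simp del: power_Suc mult_Suc_right)
qed

end

context Tsirelson_blocks
begin

lemma sum_T_comb_le:
  assumes "finite S" "\<And>s. s \<in> S \<Longrightarrow> w s \<in> c00"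
  shows "(\<Sum>l\<in>L. T (restr {l..u l} (comb S a w))) \<le> (\<Sum>s\<in>S. a s * (\<Sum>l\<in>L. T (restr {l..u l} (w s))))"
proof -
  have "(\<Sum>l\<in>L. T (restr {l..u l} (comb S a w))) \<le> (\<Sum>l\<in>L. \<Sum>s\<in>S. a s * T (restr {l..u l} (w s)))"
    unfolding restr_comb using T_comb[OF assms(1), of "\<lambda>s. restr _ (w s)" a] assms a
    by (intro sum_mono) simp
  also have "\<dots> = (\<Sum>s\<in>S. a s * (\<Sum>l\<in>L. T (restr {l..u l} (w s))))"
    unfolding sum_distrib_left by (rule sum.swap)
  finally show ?thesis .
qed

text \<open>At most one block is active at a coordinate, and its weight is bounded by the mass of
  any order because singletons belong to all Schreier families.\<close>

lemma coord_comb_le: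
  assumes S: "finite S"
    and w: "\<And>s. s \<in> S \<Longrightarrow> w s \<in> c00" "\<And>s. s \<in> S \<Longrightarrow> supp (w s) \<subseteq> {m s<..m (Suc s)}"
      "\<And>s. s \<in> S \<Longrightarrow> T (w s) \<le> C" "0 \<le> C"
  shows "\<bar>comb S a w i\<bar> \<le> C * mass n S"
proof (cases "\<exists>s\<in>S. w s i \<noteq> 0")
  case True
  then obtain s where s: "s \<in> S" "w s i \<noteq> 0" by blast
  have i: "m s < i" "i \<le> m (Suc s)" using w(2)[OF s(1)] s(2) by (auto simp: supp_def)
  have z: "w s' i = 0" if "s' \<in> S" "s' \<noteq> s" for s'
  proof (rule ccontr)
    assume "w s' i \<noteq> 0"
    then have "m s' < i" "i \<le> m (Suc s')" using w(2)[OF that(1)] by (auto simp: supp_def)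
    then show False using i that(2) m_Suc_le[of s s'] m_Suc_le[of s' s]
      by (cases s s' rule: linorder_cases) auto
  qed
  have "comb S a w i = a s * w s i"
    unfolding comb_def using S s(1) z by (subst sum.remove[of S s]) (auto intro!: sum.neutral)
  moreover have "\<bar>w s i\<bar> \<le> C" using coord_le_T[OF w(1)[OF s(1)], of i] w(3)[OF s(1)] i by simp
  ultimately have "\<bar>comb S a w i\<bar> \<le> C * a s"
    using a[of s] by (simp add: abs_mult mult.commute[of C] mult_left_mono)
  also have "\<dots> \<le> C * mass n S" using weight_le_mass[OF S s(1)] w(4) by (rule mult_left_mono)
  finally show ?thesis .
next
  case False
  then show ?thesis using mass_nonneg[OF S, of n] w(4) by (simp add: comb_def)
qed

end

text \<open>In a rapidly increasing sequence of flat vectors, a functional of weight \<open>\<theta> k\<close> acts on all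
  but one of its members like on a vector of the basis.\<close>

locale rapidly_increasing = Tsirelson_blocks +
  fixes y :: "nat \<Rightarrow> nat \<Rightarrow> real" and q :: "nat \<Rightarrow> nat" and \<sigma> :: real
  assumes y_c00: "y s \<in> c00" and y_supp: "supp (y s) \<subseteq> {m s<..m (Suc s)}" and T_y: "T (y s) \<le> 2"
    and y_flat: "flat (q s) 4 (y s)" and rapid: "q s \<le> k \<Longrightarrow> \<theta> k * (2 * real (m s)) \<le> \<sigma>"
    and sigma: "0 \<le> \<sigma>"
begin

text \<open>Let \<open>s0\<close> be the last member of \<open>S\<close> with
  \<open>q s0 < k\<close>. Later members are flat at order \<open>k\<close> and contribute at most
  \<open>4 * \<theta> k\<close> each. An earlier one has l1-norm at most
  \<open>2 * real (m s0)\<close>, which the weight reduces to \<open>\<sigma>\<close>. The critical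
  member \<open>s0\<close> may contribute 2, but only with a single coefficient, bounded by the
  mass.\<close>

lemma large_weight_le:
  assumes k: "1 \<le> k" and adm: "adm k L u" and S: "finite S"
  shows "\<theta> k * (\<Sum>l\<in>L. T (restr {l..u l} (comb S a y))) \<le> (4 * \<theta> k + \<sigma>) * sum a S + 2 * mass n S"
proof -
  define g where "g s = (\<Sum>l\<in>L. T (restr {l..u l} (y s)))" for s
  have g2: "\<theta> k * g s \<le> 2" for s
    using T_adm[OF y_c00 k adm, of s] T_y[of s] unfolding g_def by linarith
  have gf: "\<theta> k * g s \<le> 4 * \<theta> k + \<sigma>" if "k \<le> q s" for s
  proof -
    have "g s \<le> 4" unfolding g_def by (rule flatD[OF flat_mono[OF that order_refl y_flat] adm])
    then have "\<theta> k * g s \<le> \<theta> k * 4" using theta_pos[OF k] by (intro mult_left_mono) auto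
    then show ?thesis using sigma by linarith
  qed
  have gl: "\<theta> k * g s \<le> 4 * \<theta> k + \<sigma>" if "s < s0" "q s0 \<le> k" for s s0
  proof -
    have "g s \<le> (\<Sum>i\<in>{m s<..m (Suc s)}. \<bar>y s i\<bar>)"
      unfolding g_def by (rule adm_sum_le_l1[OF adm _ y_supp]) auto
    also have "\<dots> \<le> (\<Sum>i\<in>{m s<..m (Suc s)}. 2)"
    proof (rule sum_mono)
      fix i assume "i \<in> {m s<..m (Suc s)}"
      then show "\<bar>y s i\<bar> \<le> 2" using coord_le_T[OF y_c00, of i s] T_y[of s] by simp
    qed
    also have "\<dots> \<le> 2 * real (m s0)" using m_Suc_le[OF that(1)] by simp
    finally have "\<theta> k * g s \<le> \<theta> k * (2 * real (m s0))" using theta_pos[OF k] by simp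
    also have "\<dots> \<le> \<sigma>" by (rule rapid[OF that(2)])
    finally show ?thesis using theta_pos[OF k] by simp
  qed
  obtain s0 where s0: "\<And>s. s \<in> S \<Longrightarrow> s \<noteq> s0 \<Longrightarrow> \<theta> k * g s \<le> 4 * \<theta> k + \<sigma>"
  proof (cases "{s\<in>S. q s < k} = {}")
    case True
    then show ?thesis using that gf by (metis (mono_tags, lifting) empty_Collect_eq not_less)
  next
    case False
    define s0 where "s0 = Max {s\<in>S. q s < k}"
    have s0: "s0 \<in> {s\<in>S. q s < k}" using S False unfolding s0_def by (intro Max_in) auto
    have "\<theta> k * g s \<le> 4 * \<theta> k + \<sigma>" if "s \<in> S" "s \<noteq> s0" for s
    proof (cases "s < s0")
      case True
      then show ?thesis using gl s0 by simp
    next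
      case False
      have "\<not> q s < k"
      proof
        assume "q s < k"
        then have "s \<le> s0" unfolding s0_def using S that by (intro Max_ge) auto
        then show False using False that by simp
      qed
      then show ?thesis by (intro gf) simp
    qed
    then show ?thesis using that by blast
  qed
  have "\<theta> k * (\<Sum>l\<in>L. T (restr {l..u l} (comb S a y))) \<le> \<theta> k * (\<Sum>s\<in>S. a s * g s)"
    unfolding g_def using theta_pos[OF k] by (intro mult_left_mono sum_T_comb_le S y_c00) auto
  also have "\<dots> = (\<Sum>s\<in>S. a s * (\<theta> k * g s))" by (simp add: sum_distrib_left algebra_simps)
  also have "\<dots> \<le> (\<Sum>s\<in>S. a s * (4 * \<theta> k + \<sigma>) + (if s = s0 then 2 * a s else 0))"
  proof (rule sum_mono)
    fix s assume s: "s \<in> S"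
    have p: "0 \<le> a s * (4 * \<theta> k + \<sigma>)" using a[of s] theta_pos[OF k] sigma by simp
    show "a s * (\<theta> k * g s) \<le> a s * (4 * \<theta> k + \<sigma>) + (if s = s0 then 2 * a s else 0)"
    proof (cases "s = s0")
      case True
      have "a s * (\<theta> k * g s) \<le> a s * 2" by (intro mult_left_mono g2 a)
      then show ?thesis using p True by simp
    next
      case False
      then show ?thesis using mult_left_mono[OF s0[OF s False] a[of s]] by simp
    qed
  qed
  also have "\<dots> = (4 * \<theta> k + \<sigma>) * sum a S + (if s0 \<in> S then 2 * a s0 else 0)"
    using S by (simp add: sum.distrib sum.delta sum_distrib_right[symmetric] mult.commute)
  also have "\<dots> \<le> (4 * \<theta> k + \<sigma>) * sum a S + 2 * mass n S"
    using weight_le_mass[OF S, of s0 n] mass_nonneg[OF S, of n] by simp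
  finally show ?thesis .
qed

text \<open>For \<open>n < k\<close> the previous estimate applies, and
  \<open>4 * \<theta> k + \<sigma>\<close> is at most \<open>5 * \<theta> (Suc n)\<close>. For
  \<open>k \<le> n\<close> the average is split: inside the intervals the induction hypothesis
  applies with \<open>n - k\<close>, and regularity recombines the weights \<open>\<theta> k\<close>
  and \<open>\<theta> (Suc (n - k))\<close> to at most \<open>\<theta> (Suc n)\<close>. A cut block
  costs at most \<open>2 / \<theta> k\<close>, so after multiplication by the weight the cut blocks
  add \<open>4 * mass k S\<close> per splitting; hence the factor \<open>Suc n\<close>.\<close>

lemma T_comb_rapid_le:
  assumes "\<sigma> \<le> \<theta> (Suc n)" "finite S"
  shows "T (comb S a y) \<le> 5 * \<theta> (Suc n) * sum a S + 4 * real (Suc n) * mass n S"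
  using assms
proof (induction n arbitrary: S rule: less_induct)
  case (less n)
  note S = less.prems(2)
  let ?B = "5 * \<theta> (Suc n) * sum a S + 4 * real (Suc n) * mass n S"
  have a0: "0 \<le> sum a S" using a by (simp add: sum_nonneg)
  have m0: "0 \<le> mass n' S" for n' by (rule mass_nonneg[OF S])
  have t0: "0 < \<theta> (Suc n)" by (rule theta_pos) simp
  have B2: "2 * mass n S \<le> 4 * real (Suc n) * mass n S"
    using m0[of n] by (intro mult_right_mono) auto
  show ?case
  proof (rule T_leI)
    show "comb S a y \<in> c00" using S y_c00 by blast
    fix i
    have "\<bar>comb S a y i\<bar> \<le> 2 * mass n S" using S y_c00 y_supp T_y by (intro coord_comb_le) auto
    also have "\<dots> \<le> ?B" using B2 mult_nonneg_nonneg[of "5 * \<theta> (Suc n)" "sum a S"] a0 t0 by linarith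
    finally show "\<bar>comb S a y i\<bar> \<le> ?B" .
  next
    fix k L u assume k: "1 \<le> k" and adm: "adm k L u"
    show "\<theta> k * (\<Sum>l\<in>L. T (restr {l..u l} (comb S a y))) \<le> ?B"
    proof (cases "k \<le> n")
      case False
      have "\<theta> k \<le> \<theta> (Suc n)" using False by (intro theta_antimono) auto
      then have "(4 * \<theta> k + \<sigma>) * sum a S \<le> 5 * \<theta> (Suc n) * sum a S"
        using less.prems(1) a0 by (intro mult_right_mono) auto
      then show ?thesis using large_weight_le[OF k adm S, of n] B2 by linarith
    next
      case True
      define n' where "n' = n - k"
      have n': "n' < n" "k + n' = n" "\<theta> k * \<theta> (Suc n') \<le> \<theta> (Suc n)" "real (Suc n') + 1 \<le> real (Suc n)"
        using True k theta_mult[of k "Suc n'"] by (auto simp: n'_def)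
      have sig: "\<sigma> \<le> \<theta> (Suc n')"
        using less.prems(1) theta_antimono[of "Suc n'" "Suc n"] n'(1) by simp
      let ?S = "\<lambda>l. inside l (u l) S"
      have tk: "0 < \<theta> k" "\<theta> k \<le> 1" using theta_pos[OF k] theta_less_1[OF k] by auto
      have C: "(\<Sum>l\<in>L. T (restr {l..u l} (y s))) \<le> 2 / \<theta> k" for s
        using T_adm[OF y_c00 k adm, of s] T_y[of s] tk by (simp add: pos_le_divide_eq mult.commute)
      have "(\<Sum>l\<in>L. T (restr {l..u l} (comb S a y))) \<le>
          (\<Sum>l\<in>L. T (comb (?S l) a y)) + 2 * (2 / \<theta> k) * mass k S"
        by (rule T_split[OF adm S y_c00 y_supp C]) (use tk in simp)
      also have "(\<Sum>l\<in>L. T (comb (?S l) a y)) \<le>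
          (\<Sum>l\<in>L. 5 * \<theta> (Suc n') * sum a (?S l) + 4 * real (Suc n') * mass n' (?S l))"
        using less.IH[OF n'(1) sig] finite_inside[OF S] by (intro sum_mono) blast
      also have "\<dots> = 5 * \<theta> (Suc n') * (\<Sum>l\<in>L. sum a (?S l)) + 4 * real (Suc n') * (\<Sum>l\<in>L. mass n' (?S l))"
        by (simp add: sum.distrib sum_distrib_left)
      also have "\<dots> \<le> 5 * \<theta> (Suc n') * sum a S + 4 * real (Suc n') * mass n S"
        using sum_inside_le[OF adm S] sum_mass_inside_le[OF adm S, of n'] theta_pos[of "Suc n'"] n'(2)
        by (intro add_mono mult_left_mono) auto
      finally have "\<theta> k * (\<Sum>l\<in>L. T (restr {l..u l} (comb S a y))) \<le>
          \<theta> k * (5 * \<theta> (Suc n') * sum a S + 4 * real (Suc n') * mass n S + 2 * (2 / \<theta> k) * mass k S)"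
        using tk by simp
      also have "\<dots> = 5 * (\<theta> k * \<theta> (Suc n')) * sum a S + \<theta> k * (4 * real (Suc n') * mass n S) + 4 * mass k S"
        using tk by (simp add: field_simps)
      also have "\<dots> \<le> 5 * \<theta> (Suc n) * sum a S + 1 * (4 * real (Suc n') * mass n S) + 4 * mass n S"
        using n'(3) a0 tk m0[of n] mass_mono[OF True S]
        by (intro add_mono mult_right_mono mult_left_mono) auto
      also have "\<dots> = 5 * \<theta> (Suc n) * sum a S + 4 * (real (Suc n') + 1) * mass n S"
        by (simp add: algebra_simps)
      also have "\<dots> \<le> ?B" using n'(4) m0[of n] by (intro add_left_mono mult_right_mono) auto
      finally show ?thesis .
    qed
  qed
qed

end

section \<open>Flat vectors\<close>

text \<open>\<open>V\<close> stands for the finitely supported vectors of a block subspace; of the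
  block structure only the existence of nonzero vectors arbitrarily far out is kept.\<close>

locale rich_subspace = subexponential_Tsirelson +
  fixes V :: "(nat \<Rightarrow> real) set"
  assumes V_c00: "x \<in> V \<Longrightarrow> x \<in> c00"
    and V_add: "x \<in> V \<Longrightarrow> y \<in> V \<Longrightarrow> (\<lambda>i. x i + y i) \<in> V"
    and V_scale: "x \<in> V \<Longrightarrow> (\<lambda>i. c * x i) \<in> V"
    and V_rich: "\<exists>x\<in>V. x \<noteq> (\<lambda>_. 0) \<and> supp x \<subseteq> {N<..}"
begin

lemma V_zero: "(\<lambda>_. 0) \<in> V"
proof -
  obtain x where "x \<in> V" using V_rich by blast
  then show ?thesis using V_scale[of x 0] by simp
qed

lemma V_comb: "finite S \<Longrightarrow> (\<And>s. s \<in> S \<Longrightarrow> w s \<in> V) \<Longrightarrow> comb S a w \<in> V"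
proof (induction S rule: finite_induct)
  case empty
  then show ?case by (simp add: comb_def V_zero)
next
  case (insert s S)
  then have "comb S a w \<in> V" by blast
  then show ?case
    using insert V_add[OF V_scale[of "w s" "a s"], of "comb S a w"] by (simp add: comb_def)
qed

text \<open>James' argument for \<open>\<ell>\<^sub>1\<close>: if all averages of order \<open>Suc q\<close> of vectors of norm at most one had norm
  less than one half, then iterating \<open>r\<close> times would give a vector of norm at most \<open>(1/2) ^ r\<close>,
  although its norm is at least \<open>\<theta> (Suc q * r)\<close>.\<close>

theorem flat_vector_exists:
  assumes q: "1 \<le> q"
  shows "\<exists>y\<in>V. supp y \<subseteq> {N<..} \<and> 1 \<le> T y \<and> T y \<le> 2 \<and> flat q 4 y"
proof (rule ccontr)
  assume none: "\<not> ?thesis"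
  \<comment> \<open>The outcome of \<open>r\<close> rounds: the norm has been halved
    \<open>r\<close> times, while a family of order \<open>Suc q * r\<close> still sees a total of
    one. The positions \<open>M\<close> and \<open>M'\<close> enclose both the vector and this
    family, so that outcomes can be lined up as blocks.\<close>
  define R where "R r M M' w \<longleftrightarrow> w \<in> V \<and> supp w \<subseteq> {M<..M'} \<and> T w \<le> (1 / 2) ^ r \<and>
      (\<exists>L u. adm (Suc q * r) L u \<and> L \<subseteq> {M<..} \<and> u ` L \<subseteq> {..M'} \<and>
         1 \<le> (\<Sum>l\<in>L. T (restr {l..u l} w)))" for r M M' w
  have ex: "\<exists>M'>M. \<exists>w. R r M M' w" if "N \<le> M" for r M
    using that
  proof (induction r arbitrary: M)
    case 0
    obtain x where x: "x \<in> V" "x \<noteq> (\<lambda>_. 0)" "supp x \<subseteq> {M<..}" using V_rich by blast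
    note xc = V_c00[OF x(1)]
    have Tx: "0 < T x"
      using norm_on_c00_T xc x(2) T_nonneg[OF xc] by (auto simp: norm_on_c00_def less_le)
    define w where "w = (\<lambda>i. (1 / T x) * x i)"
    obtain M1 where M1: "supp x \<subseteq> {..<M1}" using finite_nat_bounded[OF c00_finite[OF xc]] by blast
    have w: "w \<in> V" "T w = 1" "supp w \<subseteq> supp x"
    proof -
      show "w \<in> V" unfolding w_def by (rule V_scale[OF x(1)])
      show "T w = 1" unfolding w_def using T_scale[OF xc, of "1 / T x"] Tx by simp
      show "supp w \<subseteq> supp x" unfolding w_def by (rule supp_scale)
    qed
    have sw: "supp w \<subseteq> {M<..M + M1 + 1}" using w(3) x(3) M1 by fastforce
    have "restr {Suc M..M + M1 + 1} w = w" using sw by (intro restr_ident) auto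
    then have "R 0 M (M + M1 + 1) w"
      unfolding R_def using w sw singleton_in_schreier[of "Suc M" 0]
      by (intro conjI exI[of _ "{Suc M}"] exI[of _ "\<lambda>_. M + M1 + 1"]) (auto simp: adm_def)
    then show ?case by (intro exI[of _ "M + M1 + 1"]) auto
  next
    case (Suc r)
    have "\<exists>m w. m 0 = M \<and> strict_mono m \<and> (\<forall>s. R r (m s) (m (Suc s)) (w s))"
      by (rule interval_chain, rule Suc.IH) (use Suc.prems in simp)
    then obtain m w where m0: "m 0 = M" and sm: "strict_mono m" and R: "\<And>s. R r (m s) (m (Suc s)) (w s)"
      by blast
    have tq: "0 < \<theta> q" using theta_pos[OF q] .
    \<comment> \<open>After scaling, a cut block costs up to \<open>1 / \<theta> q\<close>, and the
      cut blocks weigh up to twice the mass; with this tolerance their total cost is at most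
      one.\<close>
    obtain S a where S: "finite S" "S \<noteq> {}" "\<And>s. 0 \<le> a s" "sum a S = 1" "m ` S \<in> schreier (Suc q)"
      "\<And>G. G \<subseteq> S \<Longrightarrow> (\<lambda>s. m (Suc s)) ` G \<in> schreier q \<Longrightarrow> sum a G \<le> \<theta> q / 2"
      using special_convex_combination[OF sm, of "\<theta> q / 2" 0 q] tq by auto
    interpret Tsirelson_blocks \<theta> m a by unfold_locales (use sm S in auto)
    have wV: "w s \<in> V" and wsupp: "supp (w s) \<subseteq> {m s<..m (Suc s)}" and Tw: "T (w s) \<le> (1 / 2) ^ r" for s
      using R[of s] by (auto simp: R_def)
    have wc: "w s \<in> c00" for s by (rule V_c00[OF wV])
    have ex: "\<forall>s. \<exists>L u. adm (Suc q * r) L u \<and> L \<subseteq> {m s<..} \<and> u ` L \<subseteq> {..m (Suc s)} \<and>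
         1 \<le> (\<Sum>l\<in>L. T (restr {l..u l} (w s)))"
      using R by (auto simp: R_def)
    obtain L where "\<forall>s. \<exists>u. adm (Suc q * r) (L s) u \<and> L s \<subseteq> {m s<..} \<and> u ` L s \<subseteq> {..m (Suc s)} \<and>
         1 \<le> (\<Sum>l\<in>L s. T (restr {l..u l} (w s)))"
      using choice[OF ex] by blast
    from choice[OF this] obtain v where L: "\<And>s. adm (Suc q * r) (L s) (v s)" "\<And>s. L s \<subseteq> {m s<..}"
      "\<And>s. v s ` L s \<subseteq> {..m (Suc s)}" "\<And>s. 1 \<le> (\<Sum>l\<in>L s. T (restr {l..v s l} (w s)))"
      by blast
    define x where "x = comb S a w"
    \<comment> \<open>Scaling gives the blocks norm at most one, which makes \<open>y\<close> flat
      with constant 2. If its norm were at least one half, its double would be the vector sought;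
      hence the norm has been halved once more.\<close>
    define y where "y = (\<lambda>i. 2 ^ r * x i)"
    have xV: "x \<in> V" unfolding x_def using S(1) wV by (rule V_comb)
    have yV: "y \<in> V" unfolding y_def by (rule V_scale[OF xV])
    have y: "y = comb S a (\<lambda>s i. 2 ^ r * w s i)" by (simp add: y_def x_def comb_scale)
    define w' where "w' = (\<lambda>s i. 2 ^ r * w s i)"
    have w'c: "w' s \<in> c00" and w's: "supp (w' s) \<subseteq> {m s<..m (Suc s)}" and Tw': "T (w' s) \<le> 1" for s
    proof -
      show "w' s \<in> c00" unfolding w'_def using wc by simp
      show "supp (w' s) \<subseteq> {m s<..m (Suc s)}" using supp_scale wsupp unfolding w'_def by blast
      have "T (w' s) = 2 ^ r * T (w s)" unfolding w'_def using T_scale[OF wc] by simp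
      also have "\<dots> \<le> 2 ^ r * (1 / 2) ^ r" by (intro mult_left_mono Tw) auto
      finally show "T (w' s) \<le> 1" by (simp add: power_mult_distrib[symmetric])
    qed
    have Tcomb: "T (comb G a w') \<le> sum a G" if "finite G" for G
    proof -
      have "T (comb G a w') \<le> (\<Sum>s\<in>G. \<bar>a s\<bar> * T (w' s))" by (rule T_comb[OF that w'c])
      also have "\<dots> \<le> (\<Sum>s\<in>G. a s)" using S(3) Tw' by (intro sum_mono) (simp add: mult_left_le)
      finally show ?thesis .
    qed
    have "flat q 2 y"
      unfolding flat_def
    proof (intro allI impI)
      fix L u assume adm: "adm q L u"
      have C: "(\<Sum>l\<in>L. T (restr {l..u l} (w' s))) \<le> 1 / \<theta> q" for s
        using T_adm[OF w'c q adm, of s] Tw'[of s] tq by (simp add: pos_le_divide_eq mult.commute)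
      have "(\<Sum>l\<in>L. T (restr {l..u l} y)) \<le> (\<Sum>l\<in>L. T (comb (inside l (u l) S) a w')) + 2 * (1 / \<theta> q) * mass q S"
        unfolding y w'_def[symmetric]
        by (rule T_split[OF adm S(1) w'c w's C]) (use tq in simp)
      also have "\<dots> \<le> (\<Sum>l\<in>L. sum a (inside l (u l) S)) + 2 * (1 / \<theta> q) * (\<theta> q / 2)"
        using tq by (intro add_mono sum_mono Tcomb finite_inside S(1) mult_left_mono mass_le S(6)) auto
      also have "\<dots> \<le> 1 + 1" using sum_inside_le[OF adm S(1)] S(4) tq by (intro add_mono) auto
      finally show "(\<Sum>l\<in>L. T (restr {l..u l} y)) \<le> 2" by simp
    qed
    note yc = V_c00[OF yV]
    have "T y < 1 / 2"
    proof (rule ccontr)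
      assume y2: "\<not> T y < 1 / 2"
      have "T y \<le> 1" using Tcomb[OF S(1)] S(4) by (simp add: y w'_def)
      moreover have "T (\<lambda>i. 2 * y i) = 2 * T y" using T_scale[OF yc, of 2] by simp
      moreover have "flat q 4 (\<lambda>i. 2 * y i)" using flat_scale[OF \<open>flat q 2 y\<close> yc, of 2] by simp
      moreover have "supp (\<lambda>i. 2 * y i) \<subseteq> {N<..}"
      proof -
        have "supp (\<lambda>i. 2 * y i) \<subseteq> supp y" by (rule supp_scale)
        also have "supp y \<subseteq> {m 0<..m (Suc (Max S))}"
          unfolding y w'_def[symmetric] by (rule supp_comb_block[OF S(1) w's])
        also have "\<dots> \<subseteq> {N<..}" using m0 Suc.prems by auto
        finally show ?thesis .
      qed
      ultimately show False using none V_scale[OF yV, of 2] y2 by (auto dest!: bspec)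
    qed
    moreover have "T y = 2 ^ r * T x" unfolding y_def using T_scale[OF V_c00[OF xV]] by simp
    ultimately have Tx: "T x \<le> (1 / 2) ^ Suc r" by (simp add: field_simps power_divide)
    obtain M2 u where M2: "adm (Suc q + Suc q * r) M2 u" "\<And>l. l \<in> M2 \<Longrightarrow> \<exists>s\<in>S. m s < l \<and> u l \<le> m (Suc s)"
      "(\<Sum>l\<in>M2. T (restr {l..u l} (comb S a w))) = (\<Sum>s\<in>S. a s * (\<Sum>l\<in>L s. T (restr {l..v s l} (w s))))"
      using adm_comb[where S = S and x = w and L = L and v = v, OF S(1,5) L(1-3) wc wsupp] by blast
    have "1 \<le> (\<Sum>l\<in>M2. T (restr {l..u l} x))"
    proof -
      have "1 = (\<Sum>s\<in>S. a s * 1)" using S(4) by simp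
      also have "\<dots> \<le> (\<Sum>s\<in>S. a s * (\<Sum>l\<in>L s. T (restr {l..v s l} (w s))))"
        by (intro sum_mono mult_left_mono L(4) S(3))
      finally show ?thesis by (simp add: x_def M2(3))
    qed
    moreover have "M2 \<subseteq> {M<..}" "u ` M2 \<subseteq> {..m (Suc (Max S))}"
    proof -
      have b: "m 0 \<le> m s" "m (Suc s) \<le> m (Suc (Max S))" if "s \<in> S" for s
        using sm that S(1) by (simp_all add: strict_mono_less_eq)
      show "M2 \<subseteq> {M<..}" using M2(2) b(1) m0 by fastforce
      show "u ` M2 \<subseteq> {..m (Suc (Max S))}" using M2(2) b(2) by fastforce
    qed
    moreover have "supp x \<subseteq> {M<..m (Suc (Max S))}"
      using supp_comb_block[OF S(1) wsupp] m0 by (simp add: x_def)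
    moreover have "M < m (Suc (Max S))" using m0 sm by (metis strict_mono_less zero_less_Suc)
    ultimately show ?case
      using M2(1) xV Tx by (intro exI[of _ "m (Suc (Max S))"]) (auto simp: R_def)
  qed
  obtain r where r: "1 \<le> r" "1 * (1 / 2) ^ r < \<theta> (Suc q * r)" using subexponential[of "Suc q" 1] by auto
  obtain M' w where "R r N M' w" using ex by blast
  then obtain L u where w: "w \<in> V" "T w \<le> (1 / 2) ^ r" and L: "adm (Suc q * r) L u"
    "1 \<le> (\<Sum>l\<in>L. T (restr {l..u l} w))" by (auto simp: R_def)
  have k: "1 \<le> Suc q * r" using r(1) by simp
  have "\<theta> (Suc q * r) * 1 \<le> \<theta> (Suc q * r) * (\<Sum>l\<in>L. T (restr {l..u l} w))"
    using theta_pos[OF k] L(2) by (intro mult_left_mono) auto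
  also have "\<dots> \<le> T w" by (rule T_adm[OF V_c00[OF w(1)] k L(1)])
  finally show False using w(2) r(2) by simp
qed

end

section \<open>Disjoint vectors with a bounded sum\<close>

context rapidly_increasing
begin

text \<open>Here \<open>K\<close> is the order at which the old tuples \<open>Z s\<close> are flat,
  and the case distinction is at this order. From \<open>K\<close> on the tuples are bounded by
  their norms, and the weight is too small against \<open>t\<close> to detect the new vectors. Below
  \<open>K\<close> flatness bounds the split tuples, so the weight is a true gain. Exceptional
  members and cut blocks are collected in the mass term, which a suitable average makes
  small.\<close>

lemma T_comb_package_le:
  assumes Z: "\<And>s. Z s \<in> c00" "\<And>s. supp (Z s) \<subseteq> {m s<..m (Suc s)}" "\<And>s. flat K (D + \<eta> / 2) (Z s)"
    and D: "D = 10 / (1 - \<theta> 1)" and \<eta>: "0 < \<eta>" and t: "0 < t" "\<theta> (Suc n) \<le> 2 * t" "\<sigma> \<le> \<theta> (Suc n)"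
    and K: "\<And>k. K \<le> k \<Longrightarrow> 4 * \<theta> k + \<sigma> \<le> \<eta> * t / 4" and S: "finite S"
  shows "T (comb S a (\<lambda>s i. Z s i + 1 / t * y s i)) \<le>
    (D + 3 * \<eta> / 4) * sum a S + ((4 * real (Suc n) + 2) / t + D + \<eta>) * mass n S"
proof -
  define z where "z = comb S a Z"
  define v where "v = comb S a y"
  define w where "w = comb S a (\<lambda>s i. Z s i + 1 / t * y s i)"
  define A where "A = sum a S"
  define M where "M = mass n S"
  let ?B = "(D + 3 * \<eta> / 4) * A + ((4 * real (Suc n) + 2) / t + D + \<eta>) * M"
  have \<theta>1: "\<theta> 1 < 1" "0 < \<theta> 1" using theta_less_1[of 1] theta_pos[of 1] by auto
  have D0: "0 < D" "\<theta> 1 * D + 10 = D" using \<theta>1 by (auto simp: D field_simps)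
  have A0: "0 \<le> A" using a by (simp add: A_def sum_nonneg)
  have M0: "0 \<le> M" using mass_nonneg[OF S] by (simp add: M_def)
  have zc: "z \<in> c00" and vc: "v \<in> c00" using S Z(1) y_c00 by (auto simp: z_def v_def)
  have w: "w = (\<lambda>i. z i + 1 / t * v i)"
    by (simp add: w_def z_def v_def comb_def sum.distrib sum_distrib_left algebra_simps)
  have wc: "w \<in> c00" unfolding w using c00_add[OF zc c00_scale[OF vc]] .
  have Tv: "T v \<le> 10 * t * A + 4 * real (Suc n) * M"
  proof -
    have "T v \<le> 5 * \<theta> (Suc n) * A + 4 * real (Suc n) * M"
      unfolding v_def A_def M_def by (rule T_comb_rapid_le[OF t(3) S])
    also have "5 * \<theta> (Suc n) * A \<le> 5 * (2 * t) * A" using t(2) A0 by (intro mult_right_mono) auto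
    finally show ?thesis by simp
  qed
  have T_sum: "T (\<lambda>i. f i + 1 / t * g i) \<le> T f + T g / t" if "f \<in> c00" "g \<in> c00" for f g
    using T_add[OF that(1) c00_scale[OF that(2)], of "1 / t"] T_scale[OF that(2), of "1 / t"] t(1) by simp
  have split: "(\<Sum>l\<in>L. T (restr {l..u l} w)) \<le>
      (\<Sum>l\<in>L. T (restr {l..u l} z)) + (\<Sum>l\<in>L. T (restr {l..u l} v)) / t" for L :: "nat set" and u
  proof -
    have "restr F w = (\<lambda>i. restr F z i + 1 / t * restr F v i)" for F
      by (auto simp: w restr_def)
    then have "T (restr F w) \<le> T (restr F z) + T (restr F v) / t" for F
      using T_sum[of "restr F z" "restr F v"] zc vc by simp
    then show ?thesis by (simp add: sum_divide_distrib sum.distrib[symmetric] sum_mono)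
  qed
  have Aeq: "(\<Sum>s\<in>S. a s * c) = c * A" for c by (simp add: A_def sum_distrib_left mult.commute)
  have TZ: "T (Z s) \<le> D + \<eta> / 2" for s by (rule flat_norm[OF Z(3,1)])
  have "T w \<le> ?B"
  proof (rule T_leI[OF wc])
    fix i
    have "\<bar>w i\<bar> \<le> (D + \<eta> / 2 + 2 / t) * M"
      unfolding w_def M_def
    proof (rule coord_comb_le[OF S])
      fix s
      show "(\<lambda>i. Z s i + 1 / t * y s i) \<in> c00" using c00_add[OF Z(1) c00_scale[OF y_c00]] .
      show "supp (\<lambda>i. Z s i + 1 / t * y s i) \<subseteq> {m s<..m (Suc s)}"
      proof
        fix i assume "i \<in> supp (\<lambda>i. Z s i + 1 / t * y s i)"
        then have "i \<in> supp (Z s) \<union> supp (y s)" by (auto simp: supp_def)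
        then show "i \<in> {m s<..m (Suc s)}" using Z(2) y_supp by blast
      qed
      have "T (y s) / t \<le> 2 / t" using T_y t(1) by (intro divide_right_mono) auto
      then show "T (\<lambda>i. Z s i + 1 / t * y s i) \<le> D + \<eta> / 2 + 2 / t"
        using T_sum[OF Z(1) y_c00, of s s] TZ[of s] by linarith
    qed (use D0 \<eta> t in simp)
    also have "\<dots> \<le> ((4 * real (Suc n) + 2) / t + D + \<eta>) * M"
    proof (rule mult_right_mono[OF _ M0])
      have "2 / t \<le> (4 * real (Suc n) + 2) / t" using t(1) by (intro divide_right_mono) auto
      then show "D + \<eta> / 2 + 2 / t \<le> (4 * real (Suc n) + 2) / t + D + \<eta>" using \<eta> by linarith
    qed
    also have "\<dots> \<le> ?B" using D0 \<eta> A0 by simp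
    finally show "\<bar>w i\<bar> \<le> ?B" .
  next
    fix k L u assume k: "1 \<le> k" and adm: "adm k L u"
    have tk: "0 < \<theta> k" by (rule theta_pos[OF k])
    have s: "\<theta> k * (\<Sum>l\<in>L. T (restr {l..u l} w)) \<le>
      \<theta> k * (\<Sum>l\<in>L. T (restr {l..u l} z)) + (\<theta> k * (\<Sum>l\<in>L. T (restr {l..u l} v))) / t"
      using mult_left_mono[OF split, of "\<theta> k"] tk by (simp add: distrib_left)
    show "\<theta> k * (\<Sum>l\<in>L. T (restr {l..u l} w)) \<le> ?B"
    proof (cases "K \<le> k")
      case True
      have "\<theta> k * (\<Sum>l\<in>L. T (restr {l..u l} z)) \<le> T z" by (rule T_adm[OF zc k adm])
      also have "\<dots> \<le> (\<Sum>s\<in>S. \<bar>a s\<bar> * T (Z s))" unfolding z_def by (rule T_comb[OF S Z(1)])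
      also have "\<dots> \<le> (\<Sum>s\<in>S. a s * (D + \<eta> / 2))" using a TZ by (intro sum_mono) (simp add: mult_left_mono)
      finally have 1: "\<theta> k * (\<Sum>l\<in>L. T (restr {l..u l} z)) \<le> (D + \<eta> / 2) * A" by (simp add: Aeq)
      have "\<theta> k * (\<Sum>l\<in>L. T (restr {l..u l} v)) \<le> (4 * \<theta> k + \<sigma>) * A + 2 * M"
        unfolding v_def A_def M_def by (rule large_weight_le[OF k adm S])
      also have "(4 * \<theta> k + \<sigma>) * A \<le> \<eta> * t / 4 * A" using K[OF True] A0 by (rule mult_right_mono)
      finally have "\<theta> k * (\<Sum>l\<in>L. T (restr {l..u l} v)) / t \<le> (\<eta> * t / 4 * A + 2 * M) / t"
        using t(1) by (intro divide_right_mono) auto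
      also have "\<dots> = \<eta> / 4 * A + 2 / t * M" using t(1) by (simp add: field_simps)
      also have "2 / t * M \<le> ((4 * real (Suc n) + 2) / t + D + \<eta>) * M"
      proof (rule mult_right_mono[OF _ M0])
        have "2 / t \<le> (4 * real (Suc n) + 2) / t" using t(1) by (intro divide_right_mono) auto
        then show "2 / t \<le> (4 * real (Suc n) + 2) / t + D + \<eta>" using \<eta> D0 by linarith
      qed
      finally have 2: "\<theta> k * (\<Sum>l\<in>L. T (restr {l..u l} v)) / t \<le>
        \<eta> / 4 * A + ((4 * real (Suc n) + 2) / t + D + \<eta>) * M" by simp
      have "(D + \<eta> / 2) * A + \<eta> / 4 * A = (D + 3 * \<eta> / 4) * A" by (simp add: field_simps)
      then show ?thesis using s 1 2 by linarith
    next
      case False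
      have "(\<Sum>l\<in>L. T (restr {l..u l} z)) \<le> (\<Sum>s\<in>S. a s * (\<Sum>l\<in>L. T (restr {l..u l} (Z s))))"
        unfolding z_def by (rule sum_T_comb_le[OF S Z(1)])
      also have "\<dots> \<le> (\<Sum>s\<in>S. a s * (D + \<eta> / 2))"
        by (intro sum_mono mult_left_mono a flatD[OF Z(3)] adm_mono[OF _ adm]) (use False in simp)
      finally have "\<theta> k * (\<Sum>l\<in>L. T (restr {l..u l} z)) \<le> \<theta> k * ((D + \<eta> / 2) * A)"
        using tk by (simp add: Aeq)
      also have "\<dots> \<le> \<theta> 1 * ((D + \<eta> / 2) * A)"
        using theta_antimono[of 1 k] k D0 \<eta> A0 by (intro mult_right_mono) auto
      also have "\<dots> = (\<theta> 1 * D) * A + \<theta> 1 * (\<eta> / 2 * A)" by (simp add: algebra_simps)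
      also have "\<dots> \<le> (\<theta> 1 * D) * A + 1 * (\<eta> / 2 * A)"
        using \<theta>1 \<eta> A0 by (intro add_left_mono mult_right_mono) auto
      finally have e: "\<theta> k * (\<Sum>l\<in>L. T (restr {l..u l} z)) \<le> (\<theta> 1 * D) * A + 1 * (\<eta> / 2 * A)" .
      \<comment> \<open>The factor \<theta> 1 on the tuples frees exactly the 10 that the new
        vectors use up.\<close>
      have "\<theta> 1 * D = D - 10" using D0(2) by linarith
      with e have 1: "\<theta> k * (\<Sum>l\<in>L. T (restr {l..u l} z)) \<le> (D - 10) * A + \<eta> / 2 * A"
        by simp
      have "\<theta> k * (\<Sum>l\<in>L. T (restr {l..u l} v)) / t \<le> (10 * t * A + 4 * real (Suc n) * M) / t"
        using T_adm[OF vc k adm] Tv t(1) by (intro divide_right_mono) auto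
      also have "\<dots> = 10 * A + 4 * real (Suc n) / t * M" using t(1) by (simp add: field_simps)
      also have "4 * real (Suc n) / t * M \<le> ((4 * real (Suc n) + 2) / t + D + \<eta>) * M"
      proof (rule mult_right_mono[OF _ M0])
        have "4 * real (Suc n) / t \<le> (4 * real (Suc n) + 2) / t" using t(1) by (intro divide_right_mono) auto
        then show "4 * real (Suc n) / t \<le> (4 * real (Suc n) + 2) / t + D + \<eta>" using \<eta> D0 by linarith
      qed
      finally have 2: "\<theta> k * (\<Sum>l\<in>L. T (restr {l..u l} v)) / t \<le>
        10 * A + ((4 * real (Suc n) + 2) / t + D + \<eta>) * M" by simp
      have "(D - 10) * A + \<eta> / 2 * A + 10 * A \<le> (D + 3 * \<eta> / 4) * A"
        using mult_nonneg_nonneg[OF less_imp_le[OF \<eta>] A0] by (simp add: algebra_simps)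
      then show ?thesis using s 1 2 by linarith
    qed
  qed
  then show ?thesis by (simp add: w_def A_def M_def)
qed

end

section \<open>Tuples prepared for further averaging\<close>

context rich_subspace
begin

text \<open>The offset \<open>Q\<close> is the total order of the averages still to be taken, which raise the order \<open>k\<close>
  of the norming family to at most \<open>k + Q\<close>.\<close>

definition normed_by :: "nat \<Rightarrow> nat \<Rightarrow> nat \<Rightarrow> nat \<Rightarrow> (nat \<Rightarrow> real) \<Rightarrow> bool" where
  "normed_by k Q M M' x \<longleftrightarrow> (\<exists>L u. adm k L u \<and> L \<subseteq> {M<..} \<and> u ` L \<subseteq> {..M'} \<and>
     1 \<le> \<theta> (k + Q) * (\<Sum>l\<in>L. T (restr {l..u l} x)))"

text \<open>The sum is required to be flat, not merely bounded, since flatness is what the next step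
  uses. The orders \<open>k\<close> are a parameter separate from the position, so that tuples at
  different positions can share them.\<close>

definition package ::
    "nat \<Rightarrow> nat \<Rightarrow> nat \<Rightarrow> real \<Rightarrow> (nat \<Rightarrow> nat) \<Rightarrow> nat \<Rightarrow> nat \<Rightarrow> (nat \<Rightarrow> nat \<Rightarrow> real) \<Rightarrow> bool" where
  "package p K Q C k M M' x \<longleftrightarrow>
     (\<forall>i<p. x i \<in> V \<and> supp (x i) \<subseteq> {M<..M'} \<and> normed_by (k i) Q M M' (x i)) \<and>
     (\<forall>i<p. \<forall>j<p. i \<noteq> j \<longrightarrow> supp (x i) \<inter> supp (x j) = {}) \<and>
     flat K C (\<lambda>i. \<Sum>t<p. x t i)"

lemma package_mono:
  assumes "package p K Q C k M1 M' x" "M \<le> M1" shows "package p K Q C k M M' x"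
proof -
  have P: "\<And>i. i < p \<Longrightarrow> x i \<in> V" "\<And>i. i < p \<Longrightarrow> supp (x i) \<subseteq> {M1<..M'}"
    "\<And>i. i < p \<Longrightarrow> normed_by (k i) Q M1 M' (x i)"
    "\<And>i j. i < p \<Longrightarrow> j < p \<Longrightarrow> i \<noteq> j \<Longrightarrow> supp (x i) \<inter> supp (x j) = {}"
    "flat K C (\<lambda>i. \<Sum>t<p. x t i)"
    using assms(1) by (simp_all add: package_def)
  have nb: "normed_by (k i) Q M M' (x i)" if nb: "normed_by (k i) Q M1 M' (x i)" for i
  proof -
    obtain L u where L: "adm (k i) L u" "L \<subseteq> {M1<..}" "u ` L \<subseteq> {..M'}"
      "1 \<le> \<theta> (k i + Q) * (\<Sum>l\<in>L. T (restr {l..u l} (x i)))"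
      using nb unfolding normed_by_def by blast
    have "L \<subseteq> {M<..}" using L(2) assms(2) by auto
    then show ?thesis using L unfolding normed_by_def by blast
  qed
  have s: "supp (x i) \<subseteq> {M<..M'}" if "supp (x i) \<subseteq> {M1<..M'}" for i
    using that assms(2) by auto
  show ?thesis unfolding package_def
    by (intro conjI allI impI P(1,4,5) nb P(3) s P(2))
qed

lemma theta_eventually_le: "0 < e \<Longrightarrow> \<exists>k0\<ge>K. \<forall>k\<ge>k0. \<theta> k * c \<le> e"
proof -
  assume e: "0 < e"
  have "(\<lambda>k. \<theta> k * c) \<longlonglongrightarrow> 0 * c" by (intro tendsto_intros theta_lim)
  then have "\<forall>\<^sub>F k in sequentially. \<theta> k * c < e" by (rule order_tendstoD) (use e in simp)
  then obtain k1 where "\<And>k. k \<ge> k1 \<Longrightarrow> \<theta> k * c < e" unfolding eventually_sequentially by blast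
  then show ?thesis by (intro exI[of _ "max K k1"]) (auto intro: less_imp_le)
qed

text \<open>An average of order \<open>j\<close> moves \<open>j\<close> from the offset to the order
  of the norming family. Their sum, and hence the weight, stays the same, so nothing is
  lost.\<close>

lemma normed_by_comb:
  assumes sm: "strict_mono m" and S: "finite S" "\<And>s. 0 \<le> a s" "sum a S = 1" "m ` S \<in> schreier j"
    and x: "\<And>s. x s \<in> c00" "\<And>s. supp (x s) \<subseteq> {m s<..m (Suc s)}"
    and n: "\<And>s. normed_by k (Q + j) (m s) (m (Suc s)) (x s)"
  shows "normed_by (k + j) Q (m 0) (m (Suc (Max S))) (comb S a x)"
proof -
  interpret Tsirelson_blocks \<theta> m a by unfold_locales (use sm S in auto)
  have ex: "\<forall>s. \<exists>L u. adm k L u \<and> L \<subseteq> {m s<..} \<and> u ` L \<subseteq> {..m (Suc s)} \<and>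
     1 \<le> \<theta> (k + (Q + j)) * (\<Sum>l\<in>L. T (restr {l..u l} (x s)))"
    using n by (auto simp: normed_by_def)
  obtain L where "\<forall>s. \<exists>u. adm k (L s) u \<and> L s \<subseteq> {m s<..} \<and> u ` L s \<subseteq> {..m (Suc s)} \<and>
     1 \<le> \<theta> (k + (Q + j)) * (\<Sum>l\<in>L s. T (restr {l..u l} (x s)))"
    using choice[OF ex] by blast
  from choice[OF this] obtain v where L: "\<And>s. adm k (L s) (v s)" "\<And>s. L s \<subseteq> {m s<..}"
    "\<And>s. v s ` L s \<subseteq> {..m (Suc s)}"
    "\<And>s. 1 \<le> \<theta> (k + (Q + j)) * (\<Sum>l\<in>L s. T (restr {l..v s l} (x s)))" by blast
  obtain M u where M: "adm (j + k) M u" "\<And>l. l \<in> M \<Longrightarrow> \<exists>s\<in>S. m s < l \<and> u l \<le> m (Suc s)"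
    "(\<Sum>l\<in>M. T (restr {l..u l} (comb S a x))) = (\<Sum>s\<in>S. a s * (\<Sum>l\<in>L s. T (restr {l..v s l} (x s))))"
    using adm_comb[where S = S and x = x and L = L and v = v, OF S(1,4) L(1-3) x] by blast
  have b: "m 0 \<le> m s" "m (Suc s) \<le> m (Suc (Max S))" if "s \<in> S" for s
    using sm that S(1) by (simp_all add: strict_mono_less_eq)
  have "1 = (\<Sum>s\<in>S. a s * 1)" using S(3) by simp
  also have "\<dots> \<le> (\<Sum>s\<in>S. a s * (\<theta> (k + (Q + j)) * (\<Sum>l\<in>L s. T (restr {l..v s l} (x s)))))"
    by (intro sum_mono mult_left_mono L(4) S(2))
  also have "\<dots> = \<theta> (k + j + Q) * (\<Sum>l\<in>M. T (restr {l..u l} (comb S a x)))"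
    unfolding M(3) by (simp add: sum_distrib_left algebra_simps)
  finally have "1 \<le> \<theta> (k + j + Q) * (\<Sum>l\<in>M. T (restr {l..u l} (comb S a x)))" .
  moreover have "M \<subseteq> {m 0<..}" using M(2) b(1) by fastforce
  moreover have "u ` M \<subseteq> {..m (Suc (Max S))}" using M(2) b(2) by fastforce
  moreover have "adm (k + j) M u" using M(1) by (simp add: add.commute)
  ultimately show ?thesis unfolding normed_by_def by blast
qed

lemma disjoint_comb:
  assumes "strict_mono m" "\<And>s. supp (x s) \<subseteq> {m s<..m (Suc s)}" "\<And>s. supp (x' s) \<subseteq> {m s<..m (Suc s)}"
    "\<And>s. supp (x s) \<inter> supp (x' s) = {}"
  shows "supp (comb S a x) \<inter> supp (comb S a x') = {}"
proof (rule ccontr)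
  assume "supp (comb S a x) \<inter> supp (comb S a x') \<noteq> {}"
  then obtain i where "i \<in> supp (comb S a x)" "i \<in> supp (comb S a x')" by blast
  then obtain s s' where s: "i \<in> supp (x s)" "i \<in> supp (x' s')" using supp_comb by blast
  have i: "m s < i" "i \<le> m (Suc s)" "m s' < i" "i \<le> m (Suc s')" using s assms(2)[of s] assms(3)[of s'] by auto
  have "s = s'"
  proof (rule ccontr)
    assume "s \<noteq> s'"
    then have "Suc s \<le> s' \<or> Suc s' \<le> s" by linarith
    then have "m (Suc s) \<le> m s' \<or> m (Suc s') \<le> m s" using assms(1) by (simp add: strict_mono_less_eq)
    then show False using i by linarith
  qed
  then show False using s assms(4)[of s] by blast
qed

end

lemma (in subexponential_Tsirelson) flat_add_scaled:
  assumes "flat k C f" "flat k C' g" "f \<in> c00" "g \<in> c00" "0 < t"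
  shows "flat k (C + C' / t) (\<lambda>i. f i + 1 / t * g i)"
  unfolding flat_def
proof (intro allI impI)
  fix L u assume adm: "adm k L u"
  have "T (restr F (\<lambda>i. f i + 1 / t * g i)) \<le> T (restr F f) + T (restr F g) / t" for F
  proof -
    have "restr F (\<lambda>i. f i + 1 / t * g i) = (\<lambda>i. restr F f i + 1 / t * restr F g i)"
      by (auto simp: restr_def)
    then show ?thesis
      using T_add[of "restr F f" "\<lambda>i. 1 / t * restr F g i"] T_scale[of "restr F g" "1 / t"]
        c00_scale[of "restr F g" "1 / t"] assms by simp
  qed
  then have "(\<Sum>l\<in>L. T (restr {l..u l} (\<lambda>i. f i + 1 / t * g i))) \<le>
      (\<Sum>l\<in>L. T (restr {l..u l} f)) + (\<Sum>l\<in>L. T (restr {l..u l} g)) / t"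
    by (simp add: sum_divide_distrib sum.distrib[symmetric] sum_mono)
  also have "\<dots> \<le> C + C' / t"
    using flatD[OF assms(1) adm] flatD[OF assms(2) adm] assms(5) by (intro add_mono divide_right_mono) auto
  finally show "(\<Sum>l\<in>L. T (restr {l..u l} (\<lambda>i. f i + 1 / t * g i))) \<le> C + C' / t" .
qed

context rich_subspace
begin

text \<open>\<open>K\<close>, \<open>Q\<close> and \<open>\<eta>\<close> vary in the induction
  because the old tuples are needed with a higher order of flatness, a larger offset and a smaller
  error. The orders \<open>k\<close> come before \<open>N\<close>: tuples at different positions are
  averaged and must be normed at the same orders.\<close>

theorem packages_exist:
  assumes "0 < \<eta>"
  shows "\<exists>k. (\<forall>i<p. 1 \<le> k i) \<and> (\<forall>N. \<exists>N'>N. \<exists>x. package p K Q (10 / (1 - \<theta> 1) + \<eta>) k N N' x)"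
  using assms
proof (induction p arbitrary: K Q \<eta>)
  case 0
  have "0 \<le> 10 / (1 - \<theta> 1) + \<eta>" using theta_less_1[of 1] 0 by simp
  then have "package 0 K Q (10 / (1 - \<theta> 1) + \<eta>) k N (Suc N) x" for k N x
    by (simp add: package_def flat_def restr_def)
  then show ?case by blast
next
  case (Suc p)
  note \<eta> = Suc.prems
  define D where "D = 10 / (1 - \<theta> 1)"
  have D0: "0 < D" using theta_less_1[of 1] by (simp add: D_def)
  obtain j where j: "K < j" "\<theta> (j - K) \<le> 2 * \<theta> (j + Q)" using slow_decay by blast
  define n where "n = j - K - 1"
  have n: "Suc n = j - K" "K + n = j - 1" using j(1) by (auto simp: n_def)
  define t where "t = \<theta> (j + Q)"
  have t: "0 < t" using theta_pos[of "j + Q"] j(1) by (simp add: t_def)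
  \<comment> \<open>The first bound serves the norm estimate for averages of the \<open>y s\<close>;
    the second uses at most half of the permitted \<open>\<eta> * t / 4\<close>.\<close>
  define \<sigma> where "\<sigma> = min (\<theta> j) (\<eta> * t / 8)"
  have \<sigma>: "0 < \<sigma>" "\<sigma> \<le> \<theta> (Suc n)" "\<sigma> \<le> \<eta> * t / 8"
    using theta_pos[of j] theta_antimono[of "Suc n" j] j(1) t \<eta> n(1) by (auto simp: \<sigma>_def)
  \<comment> \<open>From \<open>K2\<close> on the flat contribution \<open>4 * \<theta> k\<close>
    fits into the other half.\<close>
  obtain K2 where K2: "Suc K \<le> K2" "\<And>k. K2 \<le> k \<Longrightarrow> \<theta> k * 4 \<le> \<eta> * t / 8"
    using theta_eventually_le[of "\<eta> * t / 8" "Suc K" 4] \<eta> t by auto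
  obtain k where k: "\<And>i. i < p \<Longrightarrow> 1 \<le> k i"
    and IH: "\<And>N. \<exists>N'>N. \<exists>x. package p K2 (Q + j) (D + \<eta> / 2) k N N' x"
    using Suc.IH[of "\<eta> / 2" K2 "Q + j"] \<eta> unfolding D_def by auto
  \<comment> \<open>The order of flatness depends only on the position \<open>M\<close>, so it is
    known before the flat vector beyond \<open>M\<close> is chosen.\<close>
  have "\<forall>M. \<exists>q. Suc K \<le> q \<and> (\<forall>k\<ge>q. \<theta> k * (2 * real M) \<le> \<sigma>)"
    using theta_eventually_le[OF \<sigma>(1)] by blast
  from choice[OF this] obtain q where q: "\<And>M. Suc K \<le> q M"
    "\<And>M k. q M \<le> k \<Longrightarrow> \<theta> k * (2 * real M) \<le> \<sigma>" by blast
  define R where "R M M' d \<longleftrightarrow> fst d \<in> V \<and> supp (fst d) \<subseteq> {M<..M'} \<and> 1 \<le> T (fst d) \<and> T (fst d) \<le> 2 \<and>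
     flat (q M) 4 (fst d) \<and> package p K2 (Q + j) (D + \<eta> / 2) k M M' (snd d) \<and>
     (\<forall>i<p. supp (fst d) \<inter> supp (snd d i) = {})" for M M' and d :: "(nat \<Rightarrow> real) \<times> (nat \<Rightarrow> nat \<Rightarrow> real)"
  have ex: "\<exists>M'>M. \<exists>d. R M M' d" for M
  proof -
    have "1 \<le> q M" using q(1)[of M] by simp
    then obtain y where y: "y \<in> V" "supp y \<subseteq> {M<..}" "1 \<le> T y" "T y \<le> 2" "flat (q M) 4 y"
      using flat_vector_exists by blast
    obtain M1 where M1: "supp y \<subseteq> {..<M1}" using finite_nat_bounded[OF c00_finite[OF V_c00[OF y(1)]]] by blast
    \<comment> \<open>The tuple is placed beyond the flat vector and then regarded as starting at
      \<open>M\<close>, so that both share one block with disjoint supports.\<close>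
    obtain M' x where M': "M + M1 < M'" and x: "package p K2 (Q + j) (D + \<eta> / 2) k (M + M1) M' x"
      using IH by blast
    have ys: "supp y \<subseteq> {M<..M + M1}" using y(2) M1 by fastforce
    have "supp y \<inter> supp (x i) = {}" if "i < p" for i
    proof -
      have "supp (x i) \<subseteq> {M + M1<..M'}" using x that by (simp add: package_def)
      then show ?thesis using ys by fastforce
    qed
    moreover have "supp y \<subseteq> {M<..M'}" using ys M' by fastforce
    ultimately have "R M M' (y, x)" using y package_mono[OF x, of M] by (simp add: R_def)
    then show ?thesis using M' by (intro exI[of _ M']) auto
  qed
  define k' where "k' i = (if i < p then k i + j else j)" for i
  \<comment> \<open>\<open>c\<close> dominates the coefficient of the mass in the norm estimate as
    well as the cost of a cut block.\<close>
  define c where "c = (4 * real (Suc n) + 4) / t + D + \<eta>"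
  have c: "0 < c" "(4 * real (Suc n) + 2) / t + D + \<eta> \<le> c" "D + \<eta> / 2 + 4 / t \<le> c"
  proof -
    have 1: "0 < (4 * real (Suc n) + 4) / t" using t by simp
    have 2: "(4 * real (Suc n) + 2) / t \<le> (4 * real (Suc n) + 4) / t" "4 / t \<le> (4 * real (Suc n) + 4) / t"
      using t by (auto intro!: divide_right_mono)
    show "0 < c" "(4 * real (Suc n) + 2) / t + D + \<eta> \<le> c" "D + \<eta> / 2 + 4 / t \<le> c"
      using 1 2 D0 \<eta> unfolding c_def by linarith+
  qed
  have "\<exists>N'>N. \<exists>x. package (Suc p) K Q (D + \<eta>) k' N N' x" for N
  proof -
    have "\<exists>m d. m 0 = N \<and> strict_mono m \<and> (\<forall>s. R (m s) (m (Suc s)) (d s))"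
      by (rule interval_chain, rule ex)
    then obtain m d where m0: "m 0 = N" and sm: "strict_mono m" and R: "\<And>s. R (m s) (m (Suc s)) (d s)"
      by blast
    define y where "y s = fst (d s)" for s
    define x where "x s = snd (d s)" for s
    have y: "y s \<in> V" "supp (y s) \<subseteq> {m s<..m (Suc s)}" "1 \<le> T (y s)" "T (y s) \<le> 2" "flat (q (m s)) 4 (y s)" for s
      using R[of s] by (auto simp: R_def y_def)
    have pk: "package p K2 (Q + j) (D + \<eta> / 2) k (m s) (m (Suc s)) (x s)" for s
      using R[of s] by (simp add: R_def x_def)
    have x: "x s i \<in> V" "supp (x s i) \<subseteq> {m s<..m (Suc s)}" "normed_by (k i) (Q + j) (m s) (m (Suc s)) (x s i)"
      "supp (y s) \<inter> supp (x s i) = {}" if "i < p" for s i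
      using pk[of s] R[of s] that by (auto simp: package_def R_def x_def y_def)
    have xx: "supp (x s i) \<inter> supp (x s i') = {}" if "i < p" "i' < p" "i \<noteq> i'" for s i i'
      using pk[of s] that by (auto simp: package_def)
    note yc = V_c00[OF y(1)]
    define Z where "Z s = (\<lambda>i. \<Sum>t<p. x s t i)" for s
    have Zcomb: "Z s = comb {..<p} (\<lambda>_. 1) (x s)" for s by (simp add: Z_def comb_def)
    have Zc: "Z s \<in> c00" for s unfolding Zcomb using V_c00[OF x(1)] by blast
    have Zs: "supp (Z s) \<subseteq> {m s<..m (Suc s)}" for s
      unfolding Zcomb using supp_comb[of "{..<p}" "\<lambda>_. 1" "x s"] x(2)[of _ s] by fastforce
    have Zf: "flat K2 (D + \<eta> / 2) (Z s)" for s using pk[of s] by (simp add: package_def Z_def)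
    have jn: "Suc (K + n) = j" using n j(1) by simp
    \<comment> \<open>The order \<open>j\<close> is \<open>Suc (K + n)\<close>: the family that
      tests flatness consumes \<open>K\<close>, and the norm estimate inside its intervals uses mass
      of order \<open>n\<close>. Three terms \<open>c * mass (K + n) S\<close> will arise, and the
      tolerance keeps them below the \<open>\<eta> / 4\<close> that is left.\<close>
    obtain S a where S: "finite S" "S \<noteq> {}" "\<And>s. 0 \<le> a s" "sum a S = 1" "m ` S \<in> schreier j"
      "\<And>G. G \<subseteq> S \<Longrightarrow> (\<lambda>s. m (Suc s)) ` G \<in> schreier (K + n) \<Longrightarrow> sum a G \<le> \<eta> / (12 * c)"
      using special_convex_combination[OF sm, of "\<eta> / (12 * c)" 0 "K + n"] \<eta> c(1) unfolding jn by auto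
    interpret rapidly_increasing \<theta> m a y "\<lambda>s. q (m s)" \<sigma>
      by unfold_locales (use sm S(3) y yc q(2) \<sigma>(1) in auto)
    define w where "w s = (\<lambda>i. Z s i + 1 / t * y s i)" for s
    have wc: "w s \<in> c00" for s unfolding w_def using c00_add[OF Zc c00_scale[OF yc]] .
    have ws: "supp (w s) \<subseteq> {m s<..m (Suc s)}" for s
    proof
      fix i assume "i \<in> supp (w s)"
      then have "i \<in> supp (Z s) \<union> supp (y s)" by (auto simp: w_def supp_def)
      then show "i \<in> {m s<..m (Suc s)}" using Zs y(2) by blast
    qed
    have wf: "flat K (D + \<eta> / 2 + 4 / t) (w s)" for s
      unfolding w_def
    proof (rule flat_add_scaled[OF _ _ Zc yc t])
      show "flat K (D + \<eta> / 2) (Z s)" by (rule flat_mono[OF _ order_refl Zf]) (use K2(1) in simp)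
      show "flat K 4 (y s)" by (rule flat_mono[OF _ order_refl y(5)]) (use q(1)[of "m s"] in simp)
    qed
    have Tw: "T (comb S' a w) \<le> (D + 3 * \<eta> / 4) * sum a S' + c * mass n S'" if S': "finite S'" for S'
    proof -
      have "T (comb S' a (\<lambda>s i. Z s i + 1 / t * y s i)) \<le>
        (D + 3 * \<eta> / 4) * sum a S' + ((4 * real (Suc n) + 2) / t + D + \<eta>) * mass n S'"
      proof (rule T_comb_package_le[OF Zc Zs Zf D_def \<eta> t _ \<sigma>(2) _ S'])
        show "\<theta> (Suc n) \<le> 2 * t" using j(2) n(1) by (simp add: t_def)
        show "4 * \<theta> k + \<sigma> \<le> \<eta> * t / 4" if "K2 \<le> k" for k using K2(2)[OF that] \<sigma>(3) by simp
      qed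
      also have "\<dots> \<le> (D + 3 * \<eta> / 4) * sum a S' + c * mass n S'"
        by (intro add_left_mono mult_right_mono c(2) mass_nonneg[OF S'])
      finally show ?thesis unfolding w_def .
    qed
    \<comment> \<open>The new vector gets the index \<open>p\<close>. All members are averaged with
      the same coefficients, so their sum is the average of the blocks \<open>w s\<close>.\<close>
    define X where "X i = comb S a (if i < p then (\<lambda>s. x s i) else (\<lambda>s l. 1 / t * y s l))" for i
    define N' where "N' = m (Suc (Max S))"
    have blk: "(if i < p then x s i else (\<lambda>l. 1 / t * y s l)) \<in> V"
      "supp (if i < p then x s i else (\<lambda>l. 1 / t * y s l)) \<subseteq> {m s<..m (Suc s)}" for s i
      using V_scale[OF y(1)[of s], of "1 / t"] x(1,2)[of i s] y(2)[of s] supp_scale[of "1 / t" "y s"] by auto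
    have X: "X i = comb S a (\<lambda>s. if i < p then x s i else (\<lambda>l. 1 / t * y s l))" for i
      by (simp add: X_def)
    have "package (Suc p) K Q (D + \<eta>) k' N N' X"
      unfolding package_def
    proof (intro conjI allI impI)
      fix i
      show "X i \<in> V" unfolding X by (intro V_comb S(1) blk(1))
      show "supp (X i) \<subseteq> {N<..N'}" unfolding X N'_def m0[symmetric]
        by (rule supp_comb_block[OF S(1) blk(2)])
      show "normed_by (k' i) Q N N' (X i)"
      proof (cases "i < p")
        case True
        have "normed_by (k i + j) Q (m 0) (m (Suc (Max S))) (comb S a (\<lambda>s. x s i))"
          using V_c00[OF x(1)[OF True]] x(2,3)[OF True]
          by (intro normed_by_comb[OF sm S(1,3,4,5)]) auto
        then show ?thesis using True by (simp add: k'_def X_def N'_def m0)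
      next
        case False
        \<comment> \<open>Before averaging, one interval norms the new vector, so the order is 0;
          the factor \<open>1 / t\<close> cancels the weight at \<open>Q + j\<close>.\<close>
        have nb: "normed_by 0 (Q + j) (m s) (m (Suc s)) (\<lambda>l. 1 / t * y s l)" for s
        proof -
          have "restr {Suc (m s)..m (Suc s)} (y s) = y s" using y(2)[of s] by (intro restr_ident) auto
          moreover have "\<theta> (0 + (Q + j)) = t" by (simp add: t_def add.commute)
          ultimately have "1 \<le> \<theta> (0 + (Q + j)) * (\<Sum>l\<in>{Suc (m s)}. T (restr {l..m (Suc s)} (\<lambda>l. 1 / t * y s l)))"
            using T_scale[OF yc, of "1 / t" s] y(3)[of s] t unfolding restr_scale by simp
          moreover have "adm 0 {Suc (m s)} (\<lambda>_. m (Suc s))"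
            using m_less[of s] by (auto simp: adm_def)
          ultimately show ?thesis unfolding normed_by_def
            by (intro exI[of _ "{Suc (m s)}"] exI[of _ "\<lambda>_. m (Suc s)"]) auto
        qed
        have "normed_by (0 + j) Q (m 0) (m (Suc (Max S))) (comb S a (\<lambda>s l. 1 / t * y s l))"
        proof (rule normed_by_comb[OF sm S(1,3,4,5) _ _ nb])
          show "(\<lambda>l. 1 / t * y s l) \<in> c00" for s by (rule c00_scale[OF yc])
          show "supp (\<lambda>l. 1 / t * y s l) \<subseteq> {m s<..m (Suc s)}" for s using supp_scale y(2) by blast
        qed
        then show ?thesis using False by (simp add: k'_def X_def N'_def m0)
      qed
    next
      fix i i' assume i: "i < Suc p" "i' < Suc p" "i \<noteq> i'"
      show "supp (X i) \<inter> supp (X i') = {}"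
        unfolding X
      proof (rule disjoint_comb[OF sm blk(2) blk(2)])
        fix s
        have "supp (x s l) \<inter> supp (\<lambda>l. 1 / t * y s l) = {}" if "l < p" for l
          using x(4)[OF that, of s] supp_scale[of "1 / t" "y s"] by blast
        then show "supp (if i < p then x s i else (\<lambda>l. 1 / t * y s l)) \<inter>
            supp (if i' < p then x s i' else (\<lambda>l. 1 / t * y s l)) = {}"
          using i xx[of i i' s] by (cases "i < p"; cases "i' < p") auto
      qed
    next
      have Xw: "(\<lambda>i. \<Sum>l<Suc p. X l i) = comb S a w"
      proof
        fix i
        have "(\<Sum>l<p. X l i) = (\<Sum>l<p. \<Sum>s\<in>S. a s * x s l i)" by (simp add: X_def comb_def)
        also have "\<dots> = (\<Sum>s\<in>S. a s * Z s i)" by (subst sum.swap) (simp add: Z_def sum_distrib_left)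
        finally show "(\<Sum>l<Suc p. X l i) = comb S a w i"
          by (simp add: X_def comb_def w_def sum.distrib[symmetric] distrib_left)
      qed
      show "flat K (D + \<eta>) (\<lambda>i. \<Sum>l<Suc p. X l i)"
        unfolding Xw flat_def
      proof (intro allI impI)
        fix L u assume adm: "adm K L u"
        have ms: "mass (K + n) S \<le> \<eta> / (12 * c)" by (rule mass_le[OF S(1) S(6)])
        have "(\<Sum>l\<in>L. T (restr {l..u l} (comb S a w))) \<le>
            (\<Sum>l\<in>L. T (comb (inside l (u l) S) a w)) + 2 * (D + \<eta> / 2 + 4 / t) * mass K S"
          by (rule T_split[OF adm S(1) wc ws flatD[OF wf adm]]) (use D0 \<eta> t in simp)
        also have "\<dots> \<le> (\<Sum>l\<in>L. (D + 3 * \<eta> / 4) * sum a (inside l (u l) S) + c * mass n (inside l (u l) S)) +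
            2 * c * mass (K + n) S"
          using c mass_mono[of K "K + n" S] S(1) mass_nonneg[OF S(1)]
          by (intro add_mono sum_mono Tw finite_inside S(1) mult_mono[of _ "2 * c"]) auto
        also have "\<dots> = (D + 3 * \<eta> / 4) * (\<Sum>l\<in>L. sum a (inside l (u l) S)) +
            c * (\<Sum>l\<in>L. mass n (inside l (u l) S)) + 2 * c * mass (K + n) S"
          by (simp add: sum.distrib sum_distrib_left)
        also have "\<dots> \<le> (D + 3 * \<eta> / 4) * 1 + c * mass (K + n) S + 2 * c * mass (K + n) S"
          using sum_inside_le[OF adm S(1)] sum_mass_inside_le[OF adm S(1), of n] S(4) D0 \<eta> c(1)
          by (intro add_mono mult_left_mono) auto
        also have "\<dots> = D + 3 * \<eta> / 4 + 3 * c * mass (K + n) S" by simp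
        also have "\<dots> \<le> D + 3 * \<eta> / 4 + 3 * c * (\<eta> / (12 * c))"
          using ms c(1) by (intro add_left_mono mult_left_mono) auto
        also have "\<dots> = D + \<eta>" using c(1) by (simp add: field_simps)
        finally show "(\<Sum>l\<in>L. T (restr {l..u l} (comb S a w))) \<le> D + \<eta>" .
      qed
    qed
    moreover have "N < N'" using sm by (simp add: N'_def m0[symmetric] strict_mono_less)
    ultimately show ?thesis by blast
  qed
  moreover have "\<forall>i<Suc p. 1 \<le> k' i" using k j(1) by (auto simp: k'_def)
  ultimately show ?case unfolding D_def by blast
qed

text \<open>James' argument for \<open>\<ell>\<^sub>\<infinity>\<close>: lower estimates for disjoint sums multiply, so a lower bound above one
  for \<open>n\<close> vectors would contradict the uniform bound for packages.\<close>

theorem linf_vectors_exist: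
  fixes n :: nat
  assumes \<epsilon>: "0 < \<epsilon>"
  shows "\<exists>x. (\<forall>i<n. x i \<in> V \<and> 1 \<le> T (x i)) \<and>
    (\<forall>i<n. \<forall>j<n. i \<noteq> j \<longrightarrow> supp (x i) \<inter> supp (x j) = {}) \<and> T (\<lambda>i. \<Sum>t<n. x t i) \<le> 1 + \<epsilon>"
proof (rule ccontr)
  assume none: "\<not> ?thesis"
  have V_sum: "(\<lambda>i. \<Sum>t\<in>I. x t i) \<in> V" if "finite I" "\<And>t. t \<in> I \<Longrightarrow> x t \<in> V" for x and I :: "nat set"
    using V_comb[OF that(1), of x "\<lambda>_. 1"] that(2) by (simp add: comb_def)
  have supp_sum: "\<exists>t\<in>I. i \<in> supp (x t)" if "i \<in> supp (\<lambda>i. \<Sum>t\<in>I. x t i)" for x i and I :: "nat set"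
    using that supp_comb[of I "\<lambda>_. 1" x] by (auto simp: comb_def)
  have low: "(1 + \<epsilon>) ^ r \<le> T (\<lambda>i. \<Sum>t<n ^ r. x t i)"
    if "\<And>t. t < n ^ r \<Longrightarrow> x t \<in> V \<and> 1 \<le> T (x t)"
      "\<And>t t'. t < n ^ r \<Longrightarrow> t' < n ^ r \<Longrightarrow> t \<noteq> t' \<Longrightarrow> supp (x t) \<inter> supp (x t') = {}" for r x
    using that
  proof (induction r arbitrary: x)
    case 0
    then show ?case by simp
  next
    case (Suc r)
    let ?k = "n ^ r"
    have idx: "g * ?k + e < n ^ Suc r" if "g < n" "e < ?k" for g e
    proof -
      have "g * ?k + e < Suc g * ?k" using that by simp
      also have "\<dots> \<le> n * ?k" using that by (intro mult_right_mono) auto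
      finally show ?thesis by simp
    qed
    have idx_eq: "g = g' \<and> e = e'" if "g * ?k + e = g' * ?k + e'" "e < ?k" "e' < ?k" for g g' e e'
    proof -
      have "(g * ?k + e) div ?k = g" by (rule div_nat_eqI) (use that(2) in simp_all)
      moreover have "(g' * ?k + e') div ?k = g'" by (rule div_nat_eqI) (use that(3) in simp_all)
      ultimately show ?thesis using that(1) by simp
    qed
    \<comment> \<open>The \<open>n ^ Suc r\<close> vectors are cut into \<open>n\<close> consecutive
      groups of \<open>n ^ r\<close>; the index \<open>g * ?k + e\<close> belongs to member
      \<open>e\<close> of group \<open>g\<close>.\<close>
    define G where "G g = (\<lambda>i. \<Sum>e<?k. x (g * ?k + e) i)" for g
    have GV: "G g \<in> V" if "g < n" for g unfolding G_def using Suc.prems(1) idx[OF that] by (intro V_sum) auto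
    have GT: "(1 + \<epsilon>) ^ r \<le> T (G g)" if "g < n" for g
      unfolding G_def
    proof (rule Suc.IH)
      show "x (g * ?k + e) \<in> V \<and> 1 \<le> T (x (g * ?k + e))" if "e < ?k" for e
        using Suc.prems(1) idx[OF \<open>g < n\<close> that] by blast
      show "supp (x (g * ?k + e)) \<inter> supp (x (g * ?k + e')) = {}" if "e < ?k" "e' < ?k" "e \<noteq> e'" for e e'
        using Suc.prems(2)[OF idx[OF \<open>g < n\<close> that(1)] idx[OF \<open>g < n\<close> that(2)]] that(3) by simp
    qed
    have Gd: "supp (G g) \<inter> supp (G g') = {}" if "g < n" "g' < n" "g \<noteq> g'" for g g'
    proof (rule ccontr)
      assume "supp (G g) \<inter> supp (G g') \<noteq> {}"
      then obtain i where "i \<in> supp (G g)" "i \<in> supp (G g')" by blast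
      then obtain e e' where e: "e < ?k" "i \<in> supp (x (g * ?k + e))" "e' < ?k" "i \<in> supp (x (g' * ?k + e'))"
        unfolding G_def by (metis supp_sum lessThan_iff)
      have "g * ?k + e \<noteq> g' * ?k + e'" using idx_eq e that(3) by blast
      then show False using Suc.prems(2)[OF idx[OF that(1) e(1)] idx[OF that(2) e(3)]] e by blast
    qed
    have sumG: "(\<Sum>t<n ^ Suc r. x t i) = (\<Sum>g<n. G g i)" for i
    proof -
      have "(\<Sum>t<n * ?k. x t i) = (\<Sum>g<n. sum (\<lambda>t. x t i) {g * ?k..<g * ?k + ?k})"
        by (rule sum.nat_group[symmetric])
      also have "\<dots> = (\<Sum>g<n. G g i)"
        by (intro sum.cong refl) (simp add: sum.atLeastLessThan_shift_0[of _ "_ * _"] G_def lessThan_atLeast0)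
      finally show ?thesis by simp
    qed
    define \<rho> where "\<rho> = (1 + \<epsilon>) ^ r"
    have \<rho>: "0 < \<rho>" using \<epsilon> by (simp add: \<rho>_def)
    \<comment> \<open>Divided by their guaranteed norm, the group sums are again disjoint vectors of
      norm at least one, to which the assumption applies.\<close>
    define H where "H g = (\<lambda>i. 1 / \<rho> * G g i)" for g
    have "H g \<in> V \<and> 1 \<le> T (H g)" if "g < n" for g
      using V_scale[OF GV[OF that], of "1 / \<rho>"] T_scale[OF V_c00[OF GV[OF that]], of "1 / \<rho>"]
        GT[OF that] \<rho> by (simp add: H_def \<rho>_def[symmetric])
    moreover have "supp (H g) \<inter> supp (H g') = {}" if "g < n" "g' < n" "g \<noteq> g'" for g g'
      using Gd[OF that] supp_scale[of "1 / \<rho>" "G g"] supp_scale[of "1 / \<rho>" "G g'"]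
      unfolding H_def by blast
    ultimately have "1 + \<epsilon> \<le> T (\<lambda>i. \<Sum>g<n. H g i)" using none by (metis less_imp_le not_le)
    also have "(\<lambda>i. \<Sum>g<n. H g i) = (\<lambda>i. 1 / \<rho> * (\<Sum>g<n. G g i))"
      by (simp add: H_def sum_distrib_left)
    also have "T \<dots> = 1 / \<rho> * T (\<lambda>i. \<Sum>g<n. G g i)"
      using T_scale[OF V_c00[OF V_sum], of "{..<n}" G "1 / \<rho>"] GV \<rho> by simp
    finally show ?case using \<rho> by (simp add: sumG[simplified] field_simps \<rho>_def)
  qed
  \<comment> \<open>The package bound with error one. It is independent of the number of vectors, so
    \<open>r\<close> may be chosen against it.\<close>
  define D where "D = 10 / (1 - \<theta> 1) + 1"
  obtain r where r: "D < (1 + \<epsilon>) ^ r" using real_arch_pow[of "1 + \<epsilon>" D] \<epsilon> by auto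
  \<comment> \<open>No further averages follow, so the offset is zero; flatness of order zero
    already bounds the norm.\<close>
  obtain k N' x where k: "\<And>i. i < n ^ r \<Longrightarrow> 1 \<le> k i" and pk: "package (n ^ r) 0 0 D k 0 N' x"
    using packages_exist[OF zero_less_one, of "n ^ r" 0 0] unfolding D_def by blast
  have xV: "x i \<in> V" if "i < n ^ r" for i using pk that by (simp add: package_def)
  have "1 \<le> T (x i)" if i: "i < n ^ r" for i
  proof -
    have "normed_by (k i) 0 0 N' (x i)" using pk i by (simp add: package_def)
    then obtain L u where "adm (k i) L u" "1 \<le> \<theta> (k i) * (\<Sum>l\<in>L. T (restr {l..u l} (x i)))"
      by (auto simp: normed_by_def)
    then show ?thesis using T_adm[OF V_c00[OF xV[OF i]] k[OF i]] by (meson order_trans)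
  qed
  then have "(1 + \<epsilon>) ^ r \<le> T (\<lambda>i. \<Sum>t<n ^ r. x t i)"
    using xV pk by (intro low) (auto simp: package_def)
  also have "\<dots> \<le> D"
  proof (rule flat_norm)
    show "flat 0 D (\<lambda>i. \<Sum>t<n ^ r. x t i)" using pk by (simp add: package_def)
    show "(\<lambda>i. \<Sum>t<n ^ r. x t i) \<in> c00" using xV by (intro V_c00 V_sum) auto
  qed
  finally show False using r by simp
qed

end

section \<open>Passage to the completion\<close>

text \<open>The finite expansion in the unit vectors is a convergent series, and such an expansion
  is unique.\<close>

lemma coords_of_c00:
  assumes reg: "regular_seq \<theta>" and J: "is_completion (mixed_Tsirelson_norm schreier \<theta>) X J"
    and x: "x \<in> c00"
  shows "coords J (J x) = x"
proof -
  interpret mixed_Tsirelson_data schreier \<theta> "\<theta> 1"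
    by (rule regular_seq_mixed_Tsirelson_data[OF reg])
  have Jadd: "J (\<lambda>i. x i + y i) = J x + J y" if "x \<in> c00" "y \<in> c00" for x y
    using J that by (auto simp: is_completion_def)
  have Jscale: "J (\<lambda>i. c * x i) = c *\<^sub>R J x" if "x \<in> c00" for c x
    using J that by (auto simp: is_completion_def)
  have J0: "J (\<lambda>_. 0) = 0" using Jscale[of "\<lambda>_. 0" 0] by simp
  have fin: "finite (supp x)" "x 0 = 0" using x by (auto simp: c00_def)
  have "J (restr F x) = (\<Sum>i\<in>F. x i *\<^sub>R J (unit_vec i))" if "finite F" "F \<subseteq> supp x" for F
    using that
  proof (induction F rule: finite_induct)
    case empty
    then show ?case by (simp add: restr_def J0)
  next
    case (insert i F)
    then have i: "1 \<le> i" using fin(2) by (cases i) (auto simp: supp_def)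
    have "restr (insert i F) x = (\<lambda>j. x i * unit_vec i j + restr F x j)"
      using insert.hyps by (auto simp: restr_def unit_vec_def fun_eq_iff)
    then show ?case using insert x i by (simp add: Jadd Jscale)
  qed
  from this[OF fin(1) order_refl] have "J x = (\<Sum>i\<in>supp x. x i *\<^sub>R J (unit_vec i))"
    by (simp add: restr_ident)
  moreover have "(\<lambda>i. x i *\<^sub>R J (unit_vec i)) sums (\<Sum>i\<in>supp x. x i *\<^sub>R J (unit_vec i))"
    by (rule sums_finite) (use fin in \<open>auto simp: supp_def\<close>)
  ultimately have s: "(\<lambda>i. x i *\<^sub>R J (unit_vec i)) sums J x" by simp
  have "J x \<in> X" using J x closure_subset[of "J ` c00"] by (auto simp: is_completion_def)
  then have "\<exists>!a. a 0 = 0 \<and> (\<lambda>i. a i *\<^sub>R J (unit_vec i)) sums J x" by (rule coords_ex1[OF J])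
  then show ?thesis unfolding coords_def using s fin(2) by (intro the1_equality) auto
qed

text \<open>The minima of successive nonempty supports grow by at least one at each step; this is
  what makes a block subspace rich.\<close>

lemma block_sequence_supp:
  assumes u: "block_sequence u" shows "supp (u k) \<subseteq> {k<..}"
proof -
  have fin: "finite (supp (u k))" "supp (u k) \<noteq> {}" "0 \<notin> supp (u k)" for k
    using u by (auto simp: block_sequence_def c00_def supp_def fun_eq_iff)
  have "k < Min (supp (u k))"
  proof (induction k)
    case 0
    then show ?case using fin[of 0] Min_in[of "supp (u 0)"] by (metis gr0I)
  next
    case (Suc k)
    have "Min (supp (u k)) \<le> Max (supp (u k))" using fin by simp
    also have "\<dots> < Min (supp (u (Suc k)))" using u fin by (auto simp: block_sequence_def block_less_def)
    finally show ?case using Suc by simp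
  qed
  then show ?thesis using fin by (auto intro: less_le_trans)
qed

text \<open>Both bounds are coordinatewise comparisons: with the single term whose coefficient is
  largest, and with the plain sum multiplied by that coefficient.\<close>

lemma (in subexponential_Tsirelson) disjoint_sum_bounds:
  assumes n: "1 \<le> n" and x: "\<And>i. i \<in> {1..n} \<Longrightarrow> x i \<in> c00" "\<And>i. i \<in> {1..n} \<Longrightarrow> 1 \<le> T (x i)"
    and disj: "\<And>i j. i \<in> {1..n} \<Longrightarrow> j \<in> {1..n} \<Longrightarrow> i \<noteq> j \<Longrightarrow> supp (x i) \<inter> supp (x j) = {}"
  shows "Max ((\<lambda>i. \<bar>c i\<bar>) ` {1..n}) \<le> T (comb {1..n} c x)"
    and "T (comb {1..n} c x) \<le> Max ((\<lambda>i. \<bar>c i\<bar>) ` {1..n}) * T (comb {1..n} (\<lambda>_. 1) x)"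
proof -
  let ?M = "Max ((\<lambda>i. \<bar>c i\<bar>) ` {1..n})"
  have cM: "\<bar>c i\<bar> \<le> ?M" if "i \<in> {1..n}" for i using that by (intro Max_ge) auto
  have "\<bar>c 1\<bar> \<le> ?M" using cM[of 1] n by simp
  then have M0: "0 \<le> ?M" by linarith
  have one: "comb {1..n} b x l = b i * x i l" if "i \<in> {1..n}" "l \<in> supp (x i)" for b i l
  proof -
    have "x j l = 0" if "j \<in> {1..n}" "j \<noteq> i" for j
      using disj[OF \<open>i \<in> {1..n}\<close> that(1)] that(2) \<open>l \<in> supp (x i)\<close> by (auto simp: supp_def)
    then show ?thesis unfolding comb_def using that(1) by (subst sum.remove[of _ i]) (auto intro!: sum.neutral)
  qed
  have comb0: "comb {1..n} b x l = 0" if "\<And>i. i \<in> {1..n} \<Longrightarrow> l \<notin> supp (x i)" for b l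
    unfolding comb_def using that by (intro sum.neutral) (auto simp: supp_def)
  have cc: "comb {1..n} b x \<in> c00" for b using x(1) by blast
  have "?M \<in> (\<lambda>i. \<bar>c i\<bar>) ` {1..n}" using n by (intro Max_in) auto
  then obtain i where i: "i \<in> {1..n}" "?M = \<bar>c i\<bar>" by auto
  have "?M \<le> \<bar>c i\<bar> * T (x i)" unfolding i(2)
    using mult_left_mono[OF x(2)[OF i(1)], of "\<bar>c i\<bar>"] by simp
  also have "\<dots> = T (\<lambda>l. c i * x i l)" using T_scale[OF x(1)[OF i(1)]] by simp
  also have "\<dots> \<le> T (comb {1..n} c x)"
  proof (rule T_mono[OF c00_scale[OF x(1)[OF i(1)]] cc])
    fix l show "\<bar>c i * x i l\<bar> \<le> \<bar>comb {1..n} c x l\<bar>"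
      using one[OF i(1), of l] by (cases "l \<in> supp (x i)") (auto simp: supp_def)
  qed
  finally show "?M \<le> T (comb {1..n} c x)" .
  have "T (comb {1..n} c x) \<le> T (\<lambda>l. ?M * comb {1..n} (\<lambda>_. 1) x l)"
  proof (rule T_mono[OF cc c00_scale[OF cc]])
    fix l
    show "\<bar>comb {1..n} c x l\<bar> \<le> \<bar>?M * comb {1..n} (\<lambda>_. 1) x l\<bar>"
    proof (cases "\<exists>i\<in>{1..n}. l \<in> supp (x i)")
      case True
      then obtain i where i: "i \<in> {1..n}" "l \<in> supp (x i)" by blast
      show ?thesis using cM[OF i(1)] M0
        by (simp only: one[OF i] abs_mult abs_one mult_1 abs_of_nonneg) (rule mult_right_mono, auto)
    next
      case False
      then show ?thesis using comb0 by simp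
    qed
  qed
  also have "\<dots> = ?M * T (comb {1..n} (\<lambda>_. 1) x)" using T_scale[OF cc, of ?M] M0 by simp
  finally show "T (comb {1..n} c x) \<le> ?M * T (comb {1..n} (\<lambda>_. 1) x)" .
qed

theorem theorem1p6:
  fixes \<theta> :: "nat \<Rightarrow> real"
    and X :: "'a::banach set" and J :: "(nat \<Rightarrow> real) \<Rightarrow> 'a"
  assumes "regular_seq \<theta>"
    and "(\<lambda>n. root n (\<theta> n)) \<longlonglongrightarrow> 1"
    and "is_completion (mixed_Tsirelson_norm schreier \<theta>) X J"
  shows "\<forall>\<epsilon>>0. \<forall>Y. block_subspace J Y \<longrightarrow>
    (\<forall>n\<ge>1. \<exists>y. (\<forall>i\<in>{1..n}. y i \<in> Y) \<and> disjointly_supported J n y \<and>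
       equivalent_linf_basis (1 + \<epsilon>) n y)"
proof (intro allI impI)
  fix \<epsilon> :: real and Y :: "'a set" and n :: nat
  assume \<epsilon>: "0 < \<epsilon>" and Y: "block_subspace J Y" and n: "1 \<le> n"
  obtain u where u: "block_sequence u" "Y = closure (span (range (\<lambda>k. J (u k))))"
    using Y by (auto simp: block_subspace_def)
  interpret subexponential_Tsirelson \<theta> by unfold_locales (use assms in auto)
  have Jadd: "J (\<lambda>i. x i + y i) = J x + J y" and Jscale: "J (\<lambda>i. c * x i) = c *\<^sub>R J x"
    and Jnorm: "norm (J x) = T x" if "x \<in> c00" "y \<in> c00" for c x y
    using assms(3) that by (auto simp: is_completion_def mixed_Tsirelson_norm_eq_T)
  \<comment> \<open>Working in the span, before its closure is taken, keeps all vectors finitely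
    supported.\<close>
  define V where "V = {x \<in> c00. J x \<in> span (range (\<lambda>k. J (u k)))}"
  have uc: "u k \<in> c00" "u k \<noteq> (\<lambda>_. 0)" for k using u(1) by (auto simp: block_sequence_def)
  interpret rich_subspace \<theta> V
  proof unfold_locales
    fix N
    have "u N \<in> V" using uc by (auto simp: V_def intro: span_base)
    then show "\<exists>x\<in>V. x \<noteq> (\<lambda>_. 0) \<and> supp x \<subseteq> {N<..}" using uc(2) block_sequence_supp[OF u(1)] by blast
  qed (auto simp: V_def Jadd Jscale intro: span_add span_scale)
  obtain z where z: "\<And>i. i < n \<Longrightarrow> z i \<in> V" "\<And>i. i < n \<Longrightarrow> 1 \<le> T (z i)"
    "\<And>i j. i < n \<Longrightarrow> j < n \<Longrightarrow> i \<noteq> j \<Longrightarrow> supp (z i) \<inter> supp (z j) = {}"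
    "T (\<lambda>i. \<Sum>t<n. z t i) \<le> 1 + \<epsilon>"
    using linf_vectors_exist[OF \<epsilon>, of n] by blast
  \<comment> \<open>Shift from indices below \<open>n\<close> to the indices
    \<open>{1..n}\<close>.\<close>
  define x where "x i = z (i - 1)" for i
  have x: "x i \<in> V" "x i \<in> c00" "1 \<le> T (x i)" if "i \<in> {1..n}" for i
    using z(1,2)[of "i - 1"] that V_c00 by (auto simp: x_def)
  have disj: "supp (x i) \<inter> supp (x j) = {}" if "i \<in> {1..n}" "j \<in> {1..n}" "i \<noteq> j" for i j
    unfolding x_def using that by (intro z(3)) auto
  have Tsum: "T (comb {1..n} (\<lambda>_. 1) x) \<le> 1 + \<epsilon>"
  proof -
    have "(\<Sum>t\<in>{1..n}. x t i) = (\<Sum>t<n. z t i)" for i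
      unfolding x_def by (rule sum.reindex_bij_witness[of _ Suc "\<lambda>t. t - 1"]) auto
    then show ?thesis using z(4) by (simp add: comb_def)
  qed
  have Jcomb: "(\<Sum>i\<in>I. c i *\<^sub>R J (x i)) = J (comb I c x)" if "finite I" "I \<subseteq> {1..n}" for c I
    using that
  proof (induction I rule: finite_induct)
    case empty
    then show ?case using Jscale[of "\<lambda>_. 0" "\<lambda>_. 0" 0] by (simp add: comb_def)
  next
    case (insert i I)
    then have c: "x i \<in> c00" "comb I c x \<in> c00" using x(2) by blast+
    have "comb (insert i I) c x = (\<lambda>l. c i * x i l + comb I c x l)" using insert by (simp add: comb_def)
    then show ?case using insert Jadd[OF c00_scale[OF c(1)] c(2)] Jscale[OF c] by simp
  qed
  let ?y = "\<lambda>i. J (x i)"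
  show "\<exists>y. (\<forall>i\<in>{1..n}. y i \<in> Y) \<and> disjointly_supported J n y \<and> equivalent_linf_basis (1 + \<epsilon>) n y"
  proof (intro exI[of _ ?y] conjI ballI)
    show "J (x i) \<in> Y" if "i \<in> {1..n}" for i
      using x(1)[OF that] closure_subset by (auto simp: V_def u(2))
    show "disjointly_supported J n ?y"
      unfolding disjointly_supported_def using disj x(2) by (simp add: coords_of_c00[OF assms(1,3)])
    have "1 * Max ((\<lambda>i. \<bar>c i\<bar>) ` {1..n}) \<le> norm (\<Sum>i=1..n. c i *\<^sub>R ?y i) \<and>
        norm (\<Sum>i=1..n. c i *\<^sub>R ?y i) \<le> (1 + \<epsilon>) * Max ((\<lambda>i. \<bar>c i\<bar>) ` {1..n})" for c
    proof -
      let ?M = "Max ((\<lambda>i. \<bar>c i\<bar>) ` {1..n})"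
      have cc: "comb {1..n} c x \<in> c00" using x(2) by blast
      have e: "norm (\<Sum>i=1..n. c i *\<^sub>R ?y i) = T (comb {1..n} c x)"
        using Jcomb[of "{1..n}" c] Jnorm[OF cc cc] by simp
      have "\<bar>c 1\<bar> \<le> ?M" using n by (intro Max_ge) auto
      then have "?M * T (comb {1..n} (\<lambda>_. 1) x) \<le> ?M * (1 + \<epsilon>)"
        by (intro mult_left_mono Tsum) linarith
      then show ?thesis unfolding e
        using disjoint_sum_bounds[where x = x and c = c, OF n x(2,3) disj] by (simp add: mult.commute)
    qed
    then show "equivalent_linf_basis (1 + \<epsilon>) n ?y"
      unfolding equivalent_linf_basis_def using \<epsilon> by (intro exI[of _ 1] conjI exI[of _ "1 + \<epsilon>"]) auto
  qed
qed

end
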